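(* Let $a,b,c$ be positive integers, $n=a+b+c$, and let $(A,B,C)$ be three unoccupied external edges of the $n\times n$ square grid such that the number of occupied external edges between $A$ and $B$ (on the perimeter arc not containing $C$) is $a+b$, between $B$ and $C$ (on the arc not containing $A$) is $b+c$, and between $C$ and $A$ (on the arc not containing $B$) is $c+a$. Then there is a bijection between the set of FPL configurations of type $(A,B,C)$ on the $n\times n$ grid (those whose link pattern consists of three sets of $a$, $b$ and $c$ nested arches centered at $A$, $B$, $C$ respectively) and the set of plane partitions in a box of size $a\times b\times c$.
   Context: The $n\times n$ square grid has vertex set $\{1,\dots,n\}^2$. Its internal edges join vertices at distance 1. It also has $4n$ external edges, $n$ on each side of the square: each one is attached to a single boundary vertex and points perpendicularly out of the side (so a corner vertex carries two external edges). Every vertex therefore has exactly four incident edges. The $4n$ external edges are cyclically ordered around the perimeter. Fix one of the two ways of declaring every other external edge (in this cyclic order) to be occupied; there are then $2n$ occupied and $2n$ unoccupied external edges. A Fully Packed Loop (FPL) configuration is a set of edges (called occupied) such that each vertex is incident to exactly two occupied edges and such that the occupied external edges are exactly the chosen ones. The occupied edges then form $n$ disjoint open paths joining the $2n$ occupied external edges in pairs, plus possibly some closed loops. The link pattern of the configuration is the pairing of occupied external edges given by the open paths. An FPL configuration is of type $(A,B,C)$, where $A,B,C$ are unoccupied external edges with the stated numbers of occupied external edges between them, if its link pattern is made of three sets of $a$, $b$, $c$ nested arches centered at $A,B,C$: for each $j=1,\dots,a$, the $j$-th occupied external edge met going clockwise along the perimeter from $A$ is connected by a path to the $j$-th occupied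 external edge met going counterclockwise from $A$; and similarly around $B$ for $j=1,\dots,b$ and around $C$ for $j=1,\dots,c$. The choice of which external edges are occupied is the one for which $A,B,C$ are all unoccupied. The data of $A,B,C$ determine $a,b,c$. A plane partition in a box of size $a\times b\times c$ is an array $(\pi_{ij})_{1\le i\le a,\,1\le j\le b}$ of integers in $\{0,1,\dots,c\}$ that is weakly decreasing along rows and columns. *)

theory Defs
  imports Main
begin

subsection \<open>The grid\<close>

type_synonym point = "nat \<times> nat"

definition verts :: "nat \<Rightarrow> point set" where
  "verts n = {1..n} \<times> {1..n}"

fun adjacent :: "point \<Rightarrow> point \<Rightarrow> bool" where
  "adjacent (x, y) (x', y') \<longleftrightarrow>
     x = x' \<and> (y' = Suc y \<or> y = Suc y') \<or> y = y' \<and> (x' = Suc x \<or> x = Suc x')"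

text \<open>An external edge is represented as ending in an auxiliary point outside the square, with a
  coordinate equal to 0 or n + 1; these auxiliary points are not vertices of the grid.\<close>

definition edges :: "nat \<Rightarrow> point set set" where
  "edges n = {{u, v} | u v. u \<in> verts n \<and> adjacent u v}"

definition external_edges :: "nat \<Rightarrow> point set set" where
  "external_edges n = {e \<in> edges n. \<not> e \<subseteq> verts n}"

text \<open>The external edges in clockwise order, with indices modulo 4n: the top side from left to
  right, the right side downwards, the bottom side from right to left, the left side upwards.\<close>

definition ext_edge :: "nat \<Rightarrow> nat \<Rightarrow> point set" where
  "ext_edge n k =
    (if k < n then {(k + 1, n), (k + 1, n + 1)}
     else if k < 2 * n then {(n, 2 * n - k), (n + 1, 2 * n - k)}
     else if k < 3 * n then {(3 * n - k, 1), (3 * n - k, 0)}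
     else {(1, k + 1 - 3 * n), (0, k + 1 - 3 * n)})"

definition alternating :: "nat \<Rightarrow> nat set \<Rightarrow> bool" where
  "alternating n Occ \<longleftrightarrow>
     Occ \<subseteq> {..<4 * n} \<and> (\<forall>k<4 * n. k \<in> Occ \<longleftrightarrow> Suc k mod (4 * n) \<notin> Occ)"

subsection \<open>Fully packed loops and link patterns\<close>

definition FPL :: "nat \<Rightarrow> nat set \<Rightarrow> point set set set" where
  "FPL n Occ = {F. F \<subseteq> edges n \<and> (\<forall>v\<in>verts n. card {e \<in> F. v \<in> e} = 2) \<and>
     F \<inter> external_edges n = ext_edge n ` Occ}"

definition open_path :: "nat \<Rightarrow> point set set \<Rightarrow> point list \<Rightarrow> bool" where
  "open_path n F ps \<longleftrightarrow> 2 \<le> length ps \<and> distinct ps \<and>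
     (\<forall>i. Suc i < length ps \<longrightarrow> {ps ! i, ps ! Suc i} \<in> F) \<and>
     hd ps \<notin> verts n \<and> last ps \<notin> verts n"

definition linked :: "nat \<Rightarrow> point set set \<Rightarrow> nat \<Rightarrow> nat \<Rightarrow> bool" where
  "linked n F k l \<longleftrightarrow> (\<exists>ps. open_path n F ps \<and>
     {ps ! 0, ps ! 1} = ext_edge n k \<and>
     {ps ! (length ps - 2), ps ! (length ps - 1)} = ext_edge n l)"

definition link_pattern :: "nat \<Rightarrow> point set set \<Rightarrow> nat set set" where
  "link_pattern n F = {{k, l} | k l. k < 4 * n \<and> l < 4 * n \<and> linked n F k l}"

subsection \<open>Configurations of type (A,B,C)\<close>

definition occ_cw :: "nat \<Rightarrow> nat set \<Rightarrow> nat \<Rightarrow> nat list" where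
  "occ_cw n Occ A = filter (\<lambda>k. k \<in> Occ) (map (\<lambda>t. (A + t) mod (4 * n)) [1..<4 * n])"

definition occ_ccw :: "nat \<Rightarrow> nat set \<Rightarrow> nat \<Rightarrow> nat list" where
  "occ_ccw n Occ A = filter (\<lambda>k. k \<in> Occ) (map (\<lambda>t. (A + (4 * n - t)) mod (4 * n)) [1..<4 * n])"

definition nested_arches :: "nat \<Rightarrow> nat set \<Rightarrow> nat \<Rightarrow> nat \<Rightarrow> nat set set" where
  "nested_arches n Occ A a = {{occ_cw n Occ A ! (j - 1), occ_ccw n Occ A ! (j - 1)} | j. j \<in> {1..a}}"

definition FPL_of_type ::
  "nat \<Rightarrow> nat set \<Rightarrow> nat \<Rightarrow> nat \<Rightarrow> nat \<Rightarrow> nat \<Rightarrow> nat \<Rightarrow> nat \<Rightarrow> point set set set" where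
  "FPL_of_type n Occ A B C a b c = {F \<in> FPL n Occ. link_pattern n F =
     nested_arches n Occ A a \<union> nested_arches n Occ B b \<union> nested_arches n Occ C c}"

text \<open>The positions strictly between A and B, going clockwise from A to B.\<close>

definition cw_arc :: "nat \<Rightarrow> nat \<Rightarrow> nat \<Rightarrow> nat set" where
  "cw_arc n A B = (if A < B then {A<..<B} else {A<..<4 * n} \<union> {..<B})"

text \<open>No clockwise orientation of the triple A, B, C is presupposed.\<close>

definition arc_avoiding :: "nat \<Rightarrow> nat \<Rightarrow> nat \<Rightarrow> nat \<Rightarrow> nat set" where
  "arc_avoiding n A B C = (if C \<in> cw_arc n A B then cw_arc n B A else cw_arc n A B)"

subsection \<open>Plane partitions\<close>

text \<open>Arrays are functions with value 0 outside of the index range, so that each array has exactly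
  one representative.\<close>

definition plane_partitions :: "nat \<Rightarrow> nat \<Rightarrow> nat \<Rightarrow> (nat \<Rightarrow> nat \<Rightarrow> nat) set" where
  "plane_partitions a b c = {\<pi>.
     (\<forall>i\<in>{1..a}. \<forall>j\<in>{1..b}. \<pi> i j \<in> {0..c}) \<and>
     (\<forall>i j. i \<notin> {1..a} \<or> j \<notin> {1..b} \<longrightarrow> \<pi> i j = 0) \<and>
     (\<forall>i\<in>{1..a}. \<forall>j\<in>{1..b}. \<forall>j'\<in>{1..b}. j \<le> j' \<longrightarrow> \<pi> i j' \<le> \<pi> i j) \<and>
     (\<forall>i\<in>{1..a}. \<forall>i'\<in>{1..a}. \<forall>j\<in>{1..b}. i \<le> i' \<longrightarrow> \<pi> i' j \<le> \<pi> i j)}"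

end

theory Submission
  imports Defs "HOL-Library.Transitive_Closure_Table"
begin

text \<open>
The proof has three ingredients: gyration, which brings the three centres into a normal position;
an encoding of configurations by integer heights on the plaquettes, under which the configurations
with the prescribed links are those whose heights satisfy linear equations; and a reading of these
heights as a pile of cubes seen along the direction $(1,1,1)$.

Gyration (\<open>gyration\<close>) is a local involution that exchanges the two admissible sets of external edges
and turns the link pattern by one step (\<open>link_pattern_gyration\<close>). Hence only the relative position of
$A$, $B$, $C$ matters. Plane partitions in a box are equinumerous under permutations of the sides
of the box, so $c \le b$ may be assumed, with the centres at the positions $4n + c - b$, $n + a$ and
$3n - a$ (\<open>FPL3_normal\<close>).

In the normal position the fully packed loops correspond to height functions $T$ on the plaquettes
(\<open>csum\<close>): crossing an edge changes $T$ by 0 or 1, according to whether the edge is occupied and to its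
parity, and degree 2 at every vertex makes this consistent. These are the corner sums of alternating
sign matrices.

If the links form nested arches around $A$, $B$, $C$, no path joins two external edges of the same arc
between consecutive centres. A count of edges (\<open>frozen_edge\<close>) then shows that many edges belong to every
such configuration (\<open>unlinked_frozen\<close>). In terms of $T$ this is the condition \<open>frozen\<close>. Conversely,
in a configuration with frozen heights, there is a label on the vertices, computed from $T$, that is
constant along every path (\<open>lab_vt\<close>, \<open>lab_hz\<close>). Each value occurs at exactly two occupied
external edges, namely those which the nested arches join. A component meets an even number of
occupied external edges (\<open>even_exts\<close>), so the links are forced: \<open>link_pattern_iff\<close>.

Finally, frozen heights are constant on pairs of plaquettes, so they are a function of a point of a
two-dimensional projection of the box; $T$ at such a point counts the cubes of a pile on the line
that projects to it (\<open>depth\<close>), and the inequalities between neighbouring heights say that the cubes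
form the diagram of a plane partition. This is \<open>frozen_FPL_bij\<close>.
\<close>


section \<open>Edges and external edges of the grid\<close>

definition vt :: "nat \<Rightarrow> nat \<Rightarrow> point set" where "vt x y = {(x, y), (x, Suc y)}"
definition hz :: "nat \<Rightarrow> nat \<Rightarrow> point set" where "hz x y = {(x, y), (Suc x, y)}"

lemma vt_eq [simp]: "vt x y = vt x' y' \<longleftrightarrow> x = x' \<and> y = y'"
  by (auto simp: vt_def doubleton_eq_iff)
lemma hz_eq [simp]: "hz x y = hz x' y' \<longleftrightarrow> x = x' \<and> y = y'"
  by (auto simp: hz_def doubleton_eq_iff)
lemma vt_hz [simp]: "vt x y \<noteq> hz x' y'" "hz x' y' \<noteq> vt x y"
  by (auto simp: vt_def hz_def doubleton_eq_iff)

lemma mem_verts [simp]: "(x, y) \<in> verts n \<longleftrightarrow> 1 \<le> x \<and> x \<le> n \<and> 1 \<le> y \<and> y \<le> n"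
  by (auto simp: verts_def)

lemma finite_verts [simp]: "finite (verts n)" by (simp add: verts_def)

lemma edgesI: "u \<in> verts n \<Longrightarrow> adjacent u v \<Longrightarrow> {u, v} \<in> edges n"
  unfolding edges_def by blast

lemma edges_eq:
  "edges n = {vt x y | x y. 1 \<le> x \<and> x \<le> n \<and> y \<le> n} \<union> {hz x y | x y. x \<le> n \<and> 1 \<le> y \<and> y \<le> n}"
  (is "_ = ?V \<union> ?H")
proof (rule set_eqI, rule iffI)
  fix e assume "e \<in> edges n"
  then obtain u v where uv: "e = {u, v}" "u \<in> verts n" "adjacent u v" by (auto simp: edges_def)
  obtain x y x' y' where u: "u = (x, y)" and v: "v = (x', y')" by (metis surj_pair)
  from uv(3)[unfolded u v] consider "x' = x" "y' = Suc y" | "x' = x" "y = Suc y'" | "y' = y" "x' = Suc x" | "y' = y" "x = Suc x'"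
    by auto
  then show "e \<in> ?V \<union> ?H"
  proof cases
    case 1 then have "e = vt x y" using uv u v by (auto simp: vt_def)
    then show ?thesis using uv(2) u by auto
  next
    case 2 then have "e = vt x y'" using uv u v by (auto simp: vt_def)
    then show ?thesis using uv(2) u 2 by auto
  next
    case 3 then have "e = hz x y" using uv u v by (auto simp: hz_def)
    then show ?thesis using uv(2) u by auto
  next
    case 4 then have "e = hz x' y" using uv u v by (auto simp: hz_def)
    then show ?thesis using uv(2) u 4 by auto
  qed
next
  fix e assume e: "e \<in> ?V \<union> ?H"
  consider x y where "e = vt x y" "1 \<le> x" "x \<le> n" "y \<le> n" "1 \<le> y" | x where "e = vt x 0" "1 \<le> x" "x \<le> n"
    | x y where "e = hz x y" "x \<le> n" "1 \<le> y" "y \<le> n" "1 \<le> x" | y where "e = hz 0 y" "1 \<le> y" "y \<le> n"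
  proof (cases "e \<in> ?V")
    case True
    then obtain x y where "e = vt x y" "1 \<le> x" "x \<le> n" "y \<le> n" by blast
    then show ?thesis using that(1)[of x y] that(2)[of x] by (cases y) auto
  next
    case False
    then obtain x y where "e = hz x y" "x \<le> n" "1 \<le> y" "y \<le> n" using e by blast
    then show ?thesis using that(3)[of x y] that(4)[of y] by (cases x) auto
  qed
  then show "e \<in> edges n"
  proof cases
    case (1 x y) then show ?thesis using edgesI[of "(x, y)" n "(x, Suc y)"] by (simp add: vt_def)
  next
    case (2 x) then show ?thesis using edgesI[of "(x, Suc 0)" n "(x, 0)"] by (simp add: vt_def insert_commute)
  next
    case (3 x y) then show ?thesis using edgesI[of "(x, y)" n "(Suc x, y)"] by (simp add: hz_def)
  next
    case (4 y) then show ?thesis using edgesI[of "(Suc 0, y)" n "(0, y)"] by (simp add: hz_def insert_commute)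
  qed
qed

lemma vt_in_edges [simp]: "vt x y \<in> edges n \<longleftrightarrow> 1 \<le> x \<and> x \<le> n \<and> y \<le> n"
  by (auto simp: edges_eq)
lemma hz_in_edges [simp]: "hz x y \<in> edges n \<longleftrightarrow> x \<le> n \<and> 1 \<le> y \<and> y \<le> n"
  by (auto simp: edges_eq)

lemma edges_cases:
  assumes "e \<in> edges n"
  obtains (vt) x y where "e = vt x y" "1 \<le> x" "x \<le> n" "y \<le> n"
    | (hz) x y where "e = hz x y" "x \<le> n" "1 \<le> y" "y \<le> n"
  using assms by (auto simp: edges_eq)

lemma finite_edges [simp]: "finite (edges n)"
proof -
  have "edges n \<subseteq> case_prod vt ` ({..n} \<times> {..n}) \<union> case_prod hz ` ({..n} \<times> {..n})"
    by (auto simp: edges_eq image_iff)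
  then show ?thesis by (rule finite_subset) auto
qed

lemma degree_eq:
  assumes "F \<subseteq> edges n"
  shows "card {e \<in> F. (Suc x, Suc y) \<in> e} =
    of_bool (vt (Suc x) (Suc y) \<in> F) + of_bool (vt (Suc x) y \<in> F) +
    of_bool (hz (Suc x) (Suc y) \<in> F) + of_bool (hz x (Suc y) \<in> F)"
proof -
  let ?A = "{vt (Suc x) (Suc y), vt (Suc x) y, hz (Suc x) (Suc y), hz x (Suc y)}"
  have "e \<in> ?A" if "e \<in> F" "(Suc x, Suc y) \<in> e" for e
  proof -
    have "e \<in> edges n" using that assms by blast
    then show ?thesis using that(2) by (cases rule: edges_cases) (auto simp: vt_def hz_def)
  qed
  moreover have "(Suc x, Suc y) \<in> e" if "e \<in> ?A" for e using that by (auto simp: vt_def hz_def)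
  ultimately have "{e \<in> F. (Suc x, Suc y) \<in> e} = {e \<in> ?A. e \<in> F}" by blast
  then have "card {e \<in> F. (Suc x, Suc y) \<in> e} = sum (\<lambda>e. 1) {e \<in> ?A. e \<in> F}" by simp
  also have "\<dots> = (\<Sum>e\<in>?A. if e \<in> F then 1 else 0)" by (rule sum.inter_filter) simp
  also have "\<dots> = (\<Sum>e\<in>?A. of_bool (e \<in> F))" by (rule sum.cong) auto
  finally show ?thesis by simp
qed

definition inn :: "nat \<Rightarrow> nat \<Rightarrow> point" where
  "inn n k = (if k < n then (k + 1, n) else if k < 2 * n then (n, 2 * n - k)
     else if k < 3 * n then (3 * n - k, 1) else (1, k + 1 - 3 * n))"
definition out :: "nat \<Rightarrow> nat \<Rightarrow> point" where
  "out n k = (if k < n then (k + 1, n + 1) else if k < 2 * n then (n + 1, 2 * n - k)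
     else if k < 3 * n then (3 * n - k, 0) else (0, k + 1 - 3 * n))"

lemma ext_edge_eq: "ext_edge n k = {inn n k, out n k}"
  by (simp add: ext_edge_def inn_def out_def)

lemma inn_verts [simp]: "k < 4 * n \<Longrightarrow> inn n k \<in> verts n"
  by (auto simp: inn_def)
lemma out_verts [simp]: "k < 4 * n \<Longrightarrow> out n k \<notin> verts n"
  by (auto simp: out_def)

lemma inn_top: "1 \<le> x \<Longrightarrow> x \<le> n \<Longrightarrow> inn n (x - 1) = (x, n)"
  by (simp add: inn_def)
lemma inn_right: assumes "1 \<le> y" "y \<le> n" shows "inn n (2 * n - y) = (n, y)"
proof -
  have "\<not> 2 * n - y < n" "2 * n - y < 2 * n" "2 * n - (2 * n - y) = y" using assms by linarith+
  then show ?thesis by (simp add: inn_def)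
qed
lemma inn_bottom: assumes "1 \<le> x" "x \<le> n" shows "inn n (3 * n - x) = (x, 1)"
proof -
  have "\<not> 3 * n - x < n" "\<not> 3 * n - x < 2 * n" "3 * n - x < 3 * n" "3 * n - (3 * n - x) = x" using assms by linarith+
  then show ?thesis by (simp add: inn_def)
qed
lemma inn_left: assumes "1 \<le> y" "y \<le> n" shows "inn n (3 * n + y - 1) = (1, y)"
proof -
  have "\<not> 3 * n + y - 1 < n" "\<not> 3 * n + y - 1 < 2 * n" "\<not> 3 * n + y - 1 < 3 * n" "3 * n + y - 1 + 1 - 3 * n = y"
    using assms by linarith+
  then show ?thesis by (simp only: inn_def if_False)
qed

lemma ext_edge_top: "1 \<le> x \<Longrightarrow> x \<le> n \<Longrightarrow> ext_edge n (x - 1) = vt x n"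
  by (auto simp: ext_edge_def vt_def)
lemma ext_edge_right: "1 \<le> y \<Longrightarrow> y \<le> n \<Longrightarrow> ext_edge n (2 * n - y) = hz n y"
  by (auto simp: ext_edge_def hz_def)
lemma ext_edge_bottom: "1 \<le> x \<Longrightarrow> x \<le> n \<Longrightarrow> ext_edge n (3 * n - x) = vt x 0"
  by (auto simp: ext_edge_def vt_def)
lemma ext_edge_left: "1 \<le> y \<Longrightarrow> y \<le> n \<Longrightarrow> ext_edge n (3 * n + y - 1) = hz 0 y"
  by (auto simp: ext_edge_def hz_def)

lemma index_cases:
  fixes k n :: nat
  assumes "k < 4 * n"
  obtains (top) x where "1 \<le> x" "x \<le> n" "k = x - 1" | (right) y where "1 \<le> y" "y \<le> n" "k = 2 * n - y"
    | (bottom) x where "1 \<le> x" "x \<le> n" "k = 3 * n - x" | (left) y where "1 \<le> y" "y \<le> n" "k = 3 * n + y - 1"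
proof -
  consider "k < n" | "n \<le> k" "k < 2 * n" | "2 * n \<le> k" "k < 3 * n" | "3 * n \<le> k" "k < 4 * n" using assms by linarith
  then show ?thesis
  proof cases
    case 1 then show ?thesis using top[of "k + 1"] by auto
  next
    case 2 then show ?thesis using right[of "2 * n - k"] by auto
  next
    case 3 then show ?thesis using bottom[of "3 * n - k"] by auto
  next
    case 4 then show ?thesis using left[of "k + 1 - 3 * n"] by auto
  qed
qed

lemma ext_edge_external:
  assumes "k < 4 * n" shows "ext_edge n k \<in> external_edges n"
proof -
  have "ext_edge n k \<in> edges n"
    using assms by (cases rule: index_cases)
      (simp_all only: ext_edge_top ext_edge_right ext_edge_bottom ext_edge_left, auto)
  then show ?thesis using out_verts[OF assms] by (auto simp: external_edges_def ext_edge_eq)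
qed

lemma external_edges_eq: "external_edges n = ext_edge n ` {..<4 * n}"
proof
  show "external_edges n \<subseteq> ext_edge n ` {..<4 * n}"
  proof
    fix e assume e: "e \<in> external_edges n"
    then have "e \<in> edges n" "\<not> e \<subseteq> verts n" by (auto simp: external_edges_def)
    from this(1) show "e \<in> ext_edge n ` {..<4 * n}"
    proof (cases rule: edges_cases)
      case (vt x y)
      with \<open>\<not> e \<subseteq> verts n\<close> have "y = 0 \<or> y = n" by (auto simp: vt_def)
      then show ?thesis
      proof
        assume "y = 0" then have "e = ext_edge n (3 * n - x)" using vt ext_edge_bottom by simp
        then show ?thesis using vt by auto
      next
        assume "y = n" then have "e = ext_edge n (x - 1)" using vt ext_edge_top by simp
        moreover have "x - 1 < 4 * n" using vt by auto
        ultimately show ?thesis by auto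
      qed
    next
      case (hz x y)
      with \<open>\<not> e \<subseteq> verts n\<close> have "x = 0 \<or> x = n" by (auto simp: hz_def)
      then show ?thesis
      proof
        assume "x = 0" then have "e = ext_edge n (3 * n + y - 1)" using hz ext_edge_left by simp
        moreover have "3 * n + y - 1 < 4 * n" using hz by auto
        ultimately show ?thesis by auto
      next
        assume "x = n" then have "e = ext_edge n (2 * n - y)" using hz ext_edge_right by simp
        moreover have "2 * n - y < 4 * n" using hz by auto
        ultimately show ?thesis by auto
      qed
    qed
  qed
next
  show "ext_edge n ` {..<4 * n} \<subseteq> external_edges n" using ext_edge_external by auto
qed

lemma out_inj:
  assumes "k < 4 * n" "l < 4 * n" "out n k = out n l" shows "k = l"
  using assms by (auto simp: out_def split: if_splits)

lemma ext_edge_inj: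
  assumes "k < 4 * n" "l < 4 * n" "ext_edge n k = ext_edge n l" shows "k = l"
proof (rule out_inj[OF assms(1,2)])
  show "out n k = out n l"
    using assms inn_verts out_verts unfolding ext_edge_eq by (metis doubleton_eq_iff)
qed

lemma edge_at_out:
  assumes "k < 4 * n" "e \<in> edges n" "out n k \<in> e" shows "e = ext_edge n k"
proof -
  have "\<not> e \<subseteq> verts n" using assms out_verts by blast
  then have "e \<in> external_edges n" using assms by (simp add: external_edges_def)
  then obtain l where l: "l < 4 * n" "e = ext_edge n l" by (auto simp: external_edges_eq)
  then have "out n k = inn n l \<or> out n k = out n l" using assms by (auto simp: ext_edge_eq)
  then have "out n k = out n l" using inn_verts[OF l(1)] out_verts[OF assms(1)] by metis
  then show ?thesis using out_inj[OF assms(1) l(1)] l by simp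
qed

lemma outside_point:
  assumes "{u, v} \<in> edges n" "u \<notin> verts n"
  obtains k where "k < 4 * n" "u = out n k" "v = inn n k"
proof -
  have "{u, v} \<in> external_edges n" using assms by (auto simp: external_edges_def)
  then obtain k where k: "k < 4 * n" "{u, v} = {inn n k, out n k}" by (auto simp: external_edges_eq ext_edge_eq)
  then have "u = out n k \<and> v = inn n k" using assms(2) inn_verts[OF k(1)]
    by (auto simp: doubleton_eq_iff)
  with k that show thesis by auto
qed

lemma adjacent_verts:
  assumes "{(x, y), (x', y')} \<in> edges n"
  shows "(x = x' \<and> (y' = Suc y \<or> y = Suc y')) \<or> (y = y' \<and> (x' = Suc x \<or> x = Suc x'))"
  using assms by (auto simp: edges_eq vt_def hz_def doubleton_eq_iff)

lemma FPL_D: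
  assumes "F \<in> FPL n Occ"
  shows "F \<subseteq> edges n" "v \<in> verts n \<Longrightarrow> card {e \<in> F. v \<in> e} = 2" "finite F"
    "k < 4 * n \<Longrightarrow> Occ \<subseteq> {..<4 * n} \<Longrightarrow> ext_edge n k \<in> F \<longleftrightarrow> k \<in> Occ"
proof -
  show s: "F \<subseteq> edges n" and "v \<in> verts n \<Longrightarrow> card {e \<in> F. v \<in> e} = 2" using assms by (auto simp: FPL_def)
  show "finite F" using s finite_edges finite_subset by blast
  assume k: "k < 4 * n" "Occ \<subseteq> {..<4 * n}"
  have "F \<inter> external_edges n = ext_edge n ` Occ" using assms by (auto simp: FPL_def)
  then have "ext_edge n k \<in> F \<longleftrightarrow> ext_edge n k \<in> ext_edge n ` Occ" using ext_edge_external[OF k(1)] by blast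
  also have "\<dots> \<longleftrightarrow> k \<in> Occ" using ext_edge_inj[OF k(1)] k(2) by fastforce
  finally show "ext_edge n k \<in> F \<longleftrightarrow> k \<in> Occ" .
qed

section \<open>Links as connectedness\<close>

definition joined :: "point set set \<Rightarrow> point \<Rightarrow> point \<Rightarrow> bool" where
  "joined F u v \<longleftrightarrow> {u, v} \<in> F"
abbreviation conn :: "point set set \<Rightarrow> point \<Rightarrow> point \<Rightarrow> bool" where
  "conn F \<equiv> (joined F)\<^sup>*\<^sup>*"

lemma conn_sym: "conn F u v \<Longrightarrow> conn F v u"
proof -
  have "symp (joined F)" by (auto simp: symp_def joined_def insert_commute)
  then have "symp (conn F)" by (rule symp_rtranclp)
  then show "conn F u v \<Longrightarrow> conn F v u" by (rule sympD)
qed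

lemma conn_edge: "{u, v} \<in> F \<Longrightarrow> conn F u v"
  by (auto simp: joined_def)

lemma conn_ext: "ext_edge n k \<in> F \<Longrightarrow> conn F (inn n k) (out n k)"
  by (simp add: ext_edge_eq conn_edge)

lemma rtrancl_path_nth:
  "rtrancl_path r x xs y \<Longrightarrow> (\<forall>i. Suc i < length (x # xs) \<longrightarrow> r ((x # xs) ! i) ((x # xs) ! Suc i)) \<and> last (x # xs) = y"
proof (induction rule: rtrancl_path.induct)
  case (base x) then show ?case by simp
next
  case (step x y ys z)
  show ?case
  proof (intro conjI allI impI)
    fix i assume "Suc i < length (x # y # ys)"
    then show "r ((x # y # ys) ! i) ((x # y # ys) ! Suc i)"
      using step by (cases i) auto
  qed (use step in auto)
qed

text \<open>
A walk between the outer ends of two external edges can be shortened to a path without repeated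
vertices, and an outer end lies on only one edge, so the first and last edges of that path are the
two external edges. The inner ends are used on the right-hand side because arguments about
components deal with vertices of the grid only.
\<close>
lemma linked_iff:
  assumes F: "F \<in> FPL n Occ" and O: "Occ \<subseteq> {..<4 * n}" and k: "k < 4 * n" and l: "l < 4 * n"
  shows "linked n F k l \<longleftrightarrow> k \<noteq> l \<and> k \<in> Occ \<and> l \<in> Occ \<and> conn F (inn n k) (inn n l)"
proof
  assume "linked n F k l"
  then obtain ps where ps: "open_path n F ps" and h: "{ps ! 0, ps ! 1} = ext_edge n k"
    and t: "{ps ! (length ps - 2), ps ! (length ps - 1)} = ext_edge n l" by (auto simp: linked_def)
  have len: "2 \<le> length ps" and dist: "distinct ps" and ste: "\<And>i. Suc i < length ps \<Longrightarrow> {ps ! i, ps ! Suc i} \<in> F"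
    and hd: "hd ps \<notin> verts n" and la: "last ps \<notin> verts n" using ps by (auto simp: open_path_def)
  have ne: "ps \<noteq> []" using len by auto
  have "{ps ! 0, ps ! 1} \<in> F" using ste[of 0] len by auto
  then have kO: "k \<in> Occ" using h FPL_D(4)[OF F k O] by simp
  have "Suc (length ps - 2) = length ps - 1" using len by simp
  then have "{ps ! (length ps - 2), ps ! (length ps - 1)} \<in> F" using ste[of "length ps - 2"] len by simp
  then have lO: "l \<in> Occ" using t FPL_D(4)[OF F l O] by simp
  have p0: "ps ! 0 = out n k" using h hd ne inn_verts[OF k] unfolding ext_edge_eq
    by (auto simp: hd_conv_nth doubleton_eq_iff)
  have pl: "ps ! (length ps - 1) = out n l" using t la ne inn_verts[OF l] unfolding ext_edge_eq
    by (auto simp: last_conv_nth doubleton_eq_iff)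
  have "ps ! 0 \<noteq> ps ! (length ps - 1)" using dist len by (subst nth_eq_iff_index_eq) auto
  then have "out n k \<noteq> out n l" using p0 pl by simp
  then have "k \<noteq> l" by auto
  have "i < length ps \<Longrightarrow> conn F (ps ! 0) (ps ! i)" for i
  proof (induction i)
    case (Suc i) then show ?case using ste[of i] conn_edge by (metis Suc_lessD rtranclp_trans)
  qed simp
  from this[of "length ps - 1"] have "conn F (out n k) (out n l)" using p0 pl ne by simp
  moreover have "conn F (inn n k) (out n k)" "conn F (inn n l) (out n l)"
    using conn_ext FPL_D(4)[OF F _ O] kO lO k l by blast+
  ultimately have "conn F (inn n k) (inn n l)" using conn_sym by (meson rtranclp_trans)
  with \<open>k \<noteq> l\<close> kO lO show "k \<noteq> l \<and> k \<in> Occ \<and> l \<in> Occ \<and> conn F (inn n k) (inn n l)" by simp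
next
  assume a: "k \<noteq> l \<and> k \<in> Occ \<and> l \<in> Occ \<and> conn F (inn n k) (inn n l)"
  have ek: "ext_edge n k \<in> F" and el: "ext_edge n l \<in> F" using a FPL_D(4)[OF F _ O] k l by blast+
  have "conn F (out n k) (out n l)" using a conn_ext[OF ek] conn_ext[OF el] conn_sym by (meson rtranclp_trans)
  then obtain xs where "rtrancl_path (joined F) (out n k) xs (out n l)" by (auto simp: rtranclp_eq_rtrancl_path)
  then obtain ys where ys: "rtrancl_path (joined F) (out n k) ys (out n l)" and d: "distinct (out n k # ys)"
    by (rule rtrancl_path_distinct)
  define ps where "ps = out n k # ys"
  have ste: "Suc i < length ps \<Longrightarrow> {ps ! i, ps ! Suc i} \<in> F" for i
    using rtrancl_path_nth[OF ys] unfolding ps_def joined_def by blast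
  have la: "last ps = out n l" using rtrancl_path_nth[OF ys] unfolding ps_def by blast
  have "out n k \<noteq> out n l" using a out_inj[OF k l] by blast
  then have len: "2 \<le> length ps" using la by (cases ys) (auto simp: ps_def)
  have op: "open_path n F ps" using len d ste la k l by (auto simp: open_path_def ps_def)
  have e1: "{ps ! 0, ps ! 1} \<in> edges n" using ste[of 0] len FPL_D(1)[OF F] by auto
  have h: "{ps ! 0, ps ! 1} = ext_edge n k" using edge_at_out[OF k e1] by (simp add: ps_def)
  have ne: "ps \<noteq> []" by (simp add: ps_def)
  have pl: "ps ! (length ps - 1) = out n l" using la ne by (simp add: last_conv_nth)
  have "Suc (length ps - 2) = length ps - 1" using len by simp
  then have e2: "{ps ! (length ps - 2), ps ! (length ps - 1)} \<in> edges n"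
    using ste[of "length ps - 2"] len FPL_D(1)[OF F] by auto
  have t: "{ps ! (length ps - 2), ps ! (length ps - 1)} = ext_edge n l" using edge_at_out[OF l e2] pl by simp
  show "linked n F k l" using op h t by (auto simp: linked_def)
qed

section \<open>Invariants along paths, degree counts and frozen edges\<close>

(* Vertices are treated as single variables from here on; coordinates are introduced explicitly. *)
declare split_paired_All [simp del] split_paired_Ex [simp del] mem_verts [simp del]

text \<open>
A walk may run into the outer end of an external edge, where the property is not assumed to make
sense; but from there it can only return to the vertex it came from. The induction therefore also
carries the property of the inner end.
\<close>
lemma conn_invariant:
  assumes sub: "F \<subseteq> edges n" and c: "conn F u v" and u: "u \<in> verts n" "Q u" and v: "v \<in> verts n"
    and step: "\<And>p q. p \<in> verts n \<Longrightarrow> q \<in> verts n \<Longrightarrow> {p, q} \<in> F \<Longrightarrow> Q p \<Longrightarrow> Q q"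
  shows "Q v"
proof -
  have "(v \<in> verts n \<longrightarrow> Q v) \<and> (\<forall>k<4 * n. v = out n k \<longrightarrow> Q (inn n k))"
    using c
  proof (induction rule: rtranclp_induct)
    case base
    have "u \<noteq> out n k" if "k < 4 * n" for k using out_verts[OF that] u by metis
    then show ?case using u by blast
  next
    case (step v w)
    have e: "{v, w} \<in> F" using step.hyps(2) by (simp add: joined_def)
    then have ee: "{v, w} \<in> edges n" using sub by blast
    show ?case
    proof (cases "v \<in> verts n")
      case False
      then obtain k where k: "k < 4 * n" "v = out n k" "w = inn n k" by (rule outside_point[OF ee])
      then have "w \<noteq> out n m" if "m < 4 * n" for m using out_verts[OF that] inn_verts[OF k(1)] by metis
      moreover have "Q w" using step.IH k by blast
      ultimately show ?thesis by blast
    next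
      case v: True
      then have Qv: "Q v" using step.IH by blast
      show ?thesis
      proof (cases "w \<in> verts n")
        case True
        then have "w \<noteq> out n m" if "m < 4 * n" for m using out_verts[OF that] by metis
        then show ?thesis using assms(6)[OF v True e Qv] by blast
      next
        case False
        have "{w, v} \<in> edges n" using ee by (simp add: insert_commute)
        from this False obtain k where k: "k < 4 * n" "w = out n k" "v = inn n k" by (rule outside_point)
        have "Q (inn n m)" if m: "m < 4 * n" "w = out n m" for m
        proof -
          have "m = k" using out_inj[OF m(1) k(1)] m k by metis
          then show ?thesis using Qv k by blast
        qed
        then show ?thesis using False by blast
      qed
    qed
  qed
  then show ?thesis using v by blast
qed

lemma conn_constant:
  fixes g :: "point \<Rightarrow> 'a"
  assumes sub: "F \<subseteq> edges n" and c: "conn F u v" and u: "u \<in> verts n" and v: "v \<in> verts n"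
    and vt: "\<And>x y. vt x y \<in> F \<Longrightarrow> 1 \<le> x \<Longrightarrow> x \<le> n \<Longrightarrow> 1 \<le> y \<Longrightarrow> y < n \<Longrightarrow> g (x, y) = g (x, Suc y)"
    and hz: "\<And>x y. hz x y \<in> F \<Longrightarrow> 1 \<le> x \<Longrightarrow> x < n \<Longrightarrow> 1 \<le> y \<Longrightarrow> y \<le> n \<Longrightarrow> g (x, y) = g (Suc x, y)"
  shows "g v = g u"
proof (rule conn_invariant[where Q = "\<lambda>p. g p = g u", OF sub c u _ v])
  fix p q assume pq: "p \<in> verts n" "q \<in> verts n" "{p, q} \<in> F" "g p = g u"
  obtain x y x' y' where xy: "p = (x, y)" "q = (x', y')" by (metis surj_pair)
  have b: "1 \<le> x" "x \<le> n" "1 \<le> y" "y \<le> n" "1 \<le> x'" "x' \<le> n" "1 \<le> y'" "y' \<le> n"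
    using pq xy by (simp_all add: mem_verts)
  have ed: "{(x, y), (x', y')} \<in> F" using pq(3) xy by simp
  have "g (x', y') = g (x, y)"
    using adjacent_verts[OF subsetD[OF sub ed]]
  proof (elim disjE conjE)
    assume "x = x'" "y' = Suc y"
    then show ?thesis using vt[of x y] ed b by (simp add: vt_def)
  next
    assume "x = x'" "y = Suc y'"
    then show ?thesis using vt[of x y'] ed b by (simp add: vt_def insert_commute)
  next
    assume "y = y'" "x' = Suc x"
    then show ?thesis using hz[of x y] ed b by (simp add: hz_def)
  next
    assume "y = y'" "x = Suc x'"
    then show ?thesis using hz[of x' y] ed b by (simp add: hz_def insert_commute)
  qed
  then show "g q = g u" using pq(4) xy by simp
qed simp

lemma degree_sum:
  assumes F: "F \<in> FPL n Occ" and Q: "Q \<subseteq> verts n"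
  shows "2 * card Q = (\<Sum>e\<in>F. card {v \<in> Q. v \<in> e})"
proof -
  have fQ: "finite Q" using Q finite_verts finite_subset by blast
  have "(\<Sum>v\<in>Q. card {e \<in> F. v \<in> e}) = (\<Sum>e\<in>F. card {v \<in> Q. v \<in> e})"
    by (rule sum_multicount_gen) (use fQ FPL_D(3)[OF F] in auto)
  moreover have "(\<Sum>v\<in>Q. card {e \<in> F. v \<in> e}) = (\<Sum>v\<in>Q. 2)"
    by (rule sum.cong) (use FPL_D(2)[OF F] Q in auto)
  ultimately show ?thesis by simp
qed

lemma FPL_edge_cases:
  assumes F: "F \<in> FPL n Occ" and O: "Occ \<subseteq> {..<4 * n}" and e: "e \<in> F"
  obtains (internal) u v where "e = {u, v}" "u \<in> verts n" "v \<in> verts n" "u \<noteq> v" "e \<notin> ext_edge n ` Occ"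
    | (external) k where "k \<in> Occ" "e = ext_edge n k"
proof (cases "e \<in> external_edges n")
  case True
  then have "e \<in> ext_edge n ` Occ" using e F by (auto simp: FPL_def)
  then show ?thesis using external by blast
next
  case False
  then have ee: "e \<in> edges n" and s: "e \<subseteq> verts n" using e FPL_D(1)[OF F] by (auto simp: external_edges_def)
  have ne: "e \<notin> ext_edge n ` Occ" using False O ext_edge_external by blast
  from ee show ?thesis
  proof (cases rule: edges_cases)
    case (vt x y) then show ?thesis using internal[of "(x, y)" "(x, Suc y)"] s ne by (auto simp: vt_def)
  next
    case (hz x y) then show ?thesis using internal[of "(x, y)" "(Suc x, y)"] s ne by (auto simp: hz_def)
  qed
qed

lemma inn_unique_edge:
  assumes "k < 4 * n" "v \<in> verts n" "v \<in> ext_edge n k" shows "v = inn n k"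
  using assms out_verts by (auto simp: ext_edge_eq)

text \<open>
Handshake: each vertex of \<open>C\<close> has degree 2, and an internal edge has both or none of its ends
in \<open>C\<close>, so the external edges contribute an even number.
\<close>
lemma even_exts:
  assumes F: "F \<in> FPL n Occ" and O: "Occ \<subseteq> {..<4 * n}" and C: "C \<subseteq> verts n"
    and closed: "\<And>u v. u \<in> C \<Longrightarrow> v \<in> verts n \<Longrightarrow> {u, v} \<in> F \<Longrightarrow> v \<in> C"
  shows "even (card {k \<in> Occ. inn n k \<in> C})"
proof -
  let ?X = "ext_edge n ` Occ"
  have fin: "finite F" and fO: "finite Occ" using FPL_D(3)[OF F] O finite_subset by auto
  have XF: "?X \<subseteq> F" using F by (auto simp: FPL_def)
  have ev: "even (card {v \<in> C. v \<in> e})" if "e \<in> F - ?X" for e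
  proof -
    have "e \<in> F" using that by blast
    from F O this obtain u v where uv: "e = {u, v}" "u \<in> verts n" "v \<in> verts n" "u \<noteq> v"
    proof (cases rule: FPL_edge_cases)
      case (external k) then show thesis using that \<open>e \<in> F - ?X\<close> by blast
    qed
    have "u \<in> C \<longleftrightarrow> v \<in> C" using closed uv that by (metis DiffD1 insert_commute)
    then have "{v \<in> C. v \<in> e} = {} \<or> {v \<in> C. v \<in> e} = {u, v}" using uv by auto
    then show ?thesis
    proof
      assume "{v \<in> C. v \<in> e} = {}" then show ?thesis by (simp only: card.empty) simp
    next
      assume "{v \<in> C. v \<in> e} = {u, v}" then show ?thesis using uv(4) by (simp only:) simp
    qed
  qed
  have inj: "inj_on (ext_edge n) Occ" using ext_edge_inj O by (meson inj_onI lessThan_iff subsetD)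
  have one: "card {v \<in> C. v \<in> ext_edge n k} = of_bool (inn n k \<in> C)" if "k \<in> Occ" for k
  proof -
    have k: "k < 4 * n" using that O by auto
    have "{v \<in> C. v \<in> ext_edge n k} = (if inn n k \<in> C then {inn n k} else {})"
    proof -
      have "v = inn n k" if "v \<in> C" "v \<in> ext_edge n k" for v
        using inn_unique_edge[OF k, of v] C that by blast
      moreover have "inn n k \<in> ext_edge n k" by (simp add: ext_edge_eq)
      ultimately show ?thesis by (simp only: split: if_split) blast
    qed
    then show ?thesis by simp
  qed
  have "(\<Sum>e\<in>?X. card {v \<in> C. v \<in> e}) = (\<Sum>k\<in>Occ. card {v \<in> C. v \<in> ext_edge n k})"
    using inj by (simp add: sum.reindex)
  also have "\<dots> = (\<Sum>k\<in>Occ. of_bool (inn n k \<in> C))" using one by (rule sum.cong[OF refl])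
  also have "\<dots> = (\<Sum>k\<in>Occ. if inn n k \<in> C then 1 else 0)" by (rule sum.cong) auto
  also have "\<dots> = card {k \<in> Occ. inn n k \<in> C}"
    using sum.inter_filter[OF fO, of "\<lambda>_. 1::nat" "\<lambda>k. inn n k \<in> C"] by simp
  finally have "2 * card C = (\<Sum>e\<in>F - ?X. card {v \<in> C. v \<in> e}) + card {k \<in> Occ. inn n k \<in> C}"
    using degree_sum[OF F C] sum.subset_diff[OF XF fin, of "\<lambda>e. card {v \<in> C. v \<in> e}"] by simp
  moreover have "even (\<Sum>e\<in>F - ?X. card {v \<in> C. v \<in> e})" using ev by (rule dvd_sum)
  moreover have "even k" if "2 * m = s + k" "even s" for m s k :: nat using that by presburger
  ultimately show ?thesis by blast
qed

text \<open>
This replaces following a path to its other end: a component cannot contain exactly one occupied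
external edge.
\<close>
lemma partner_exists:
  assumes F: "F \<in> FPL n Occ" and O: "Occ \<subseteq> {..<4 * n}" and k: "k \<in> Occ"
  obtains l where "l \<in> Occ" "l \<noteq> k" "conn F (inn n k) (inn n l)"
proof -
  let ?C = "{v \<in> verts n. conn F (inn n k) v}"
  have "even (card {l \<in> Occ. inn n l \<in> ?C})"
  proof (rule even_exts[OF F O])
    fix u v assume uv: "u \<in> ?C" "v \<in> verts n" "{u, v} \<in> F"
    then have "conn F (inn n k) u" by blast
    from rtranclp_trans[OF this conn_edge[OF uv(3)]] show "v \<in> ?C" using uv by blast
  qed auto
  moreover have "{l \<in> Occ. inn n l \<in> ?C} \<noteq> {k}"
  proof
    assume "{l \<in> Occ. inn n l \<in> ?C} = {k}"
    with calculation show False by (simp only:) simp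
  qed
  moreover have "k \<in> {l \<in> Occ. inn n l \<in> ?C}" using k O by auto
  ultimately obtain l where "l \<in> Occ" "l \<noteq> k" "conn F (inn n k) (inn n l)" by blast
  then show thesis by (rule that)
qed

lemma independent_degree:
  assumes F: "F \<in> FPL n Occ" and Q: "Q \<subseteq> verts n"
    and ind: "\<And>u v e. u \<in> Q \<Longrightarrow> v \<in> Q \<Longrightarrow> e \<in> F \<Longrightarrow> u \<in> e \<Longrightarrow> v \<in> e \<Longrightarrow> u = v"
  shows "2 * card Q = card {e \<in> F. \<exists>v\<in>Q. v \<in> e}"
proof -
  have "(\<Sum>e\<in>F. card {v \<in> Q. v \<in> e}) = (\<Sum>e\<in>F. if \<exists>v\<in>Q. v \<in> e then 1 else 0)"
  proof (rule sum.cong)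
    fix e assume "e \<in> F"
    show "card {v \<in> Q. v \<in> e} = (if \<exists>v\<in>Q. v \<in> e then 1 else 0)"
    proof (cases "\<exists>v\<in>Q. v \<in> e")
      case True
      then obtain v where "v \<in> Q" "v \<in> e" by blast
      then have "{v \<in> Q. v \<in> e} = {v}" using ind \<open>e \<in> F\<close> by blast
      then show ?thesis using True by simp
    next
      case False
      then have "{v \<in> Q. v \<in> e} = {}" by blast
      then show ?thesis using False by (simp only: card.empty if_False)
    qed
  qed simp
  also have "\<dots> = card {e \<in> F. \<exists>v\<in>Q. v \<in> e}"
    using sum.inter_filter[OF FPL_D(3)[OF F], of "\<lambda>_. 1::nat" "\<lambda>e. \<exists>v\<in>Q. v \<in> e"] by simp
  finally show ?thesis using degree_sum[OF F Q] by simp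
qed

lemma crossing_edge:
  assumes "conn F a b" "a \<in> R" "b \<notin> R"
  obtains u v where "{u, v} \<in> F" "u \<in> R" "v \<notin> R" "conn F a u" "conn F a v"
proof -
  from assms(1) have "b \<notin> R \<longrightarrow> (\<exists>u v. {u, v} \<in> F \<and> u \<in> R \<and> v \<notin> R \<and> conn F a u \<and> conn F a v)"
  proof (induction rule: rtranclp_induct)
    case base then show ?case using assms(2) by simp
  next
    case (step y z)
    then show ?case by (metis joined_def rtranclp.rtrancl_into_rtrancl)
  qed
  then show thesis using assms(3) that by blast
qed

text \<open>
\<open>P\<close> colours the vertices black and white in the manner of a chessboard, and \<open>\<mu>\<close> matches the white
vertices of \<open>S\<close> with black ones. \<open>F\<close> leaves \<open>S\<close> only from black vertices, and every unmatched
black vertex carries an occupied external edge. Suppose the edge from \<open>w\<close> to \<open>\<mu> w\<close> is missing and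
remove its two ends from \<open>S\<close>, which gives \<open>R\<close>. Counting the edges of \<open>F\<close> at the black and at the
white vertices of \<open>R\<close> shows that \<open>R\<close> has at most as many leaving edges as occupied external
edges. Paths that start at different external edges of \<open>R\<close> are disjoint and end outside \<open>S\<close>, so
each uses a leaving edge of its own, and every leaving edge is used in this way. Each of the two
edges at \<open>w\<close> is external or leaves \<open>R\<close>, so they belong to the paths from two different external
edges of \<open>S\<close>, and these would be linked through \<open>w\<close>.
\<close>
lemma frozen_edge:
  fixes \<mu> :: "point \<Rightarrow> point" and P :: "point \<Rightarrow> bool"
  assumes F: "F \<in> FPL n Occ" and O: "Occ \<subseteq> {..<4 * n}" and S: "S \<subseteq> verts n"
    and bip: "\<And>u v. {u, v} \<in> F \<Longrightarrow> u \<in> verts n \<Longrightarrow> v \<in> verts n \<Longrightarrow> P u \<noteq> P v"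
    and mu: "\<And>v. v \<in> S \<Longrightarrow> \<not> P v \<Longrightarrow> \<mu> v \<in> S \<and> P (\<mu> v)"
    and unmatched: "\<And>v. v \<in> S \<Longrightarrow> P v \<Longrightarrow> v \<notin> \<mu> ` {v \<in> S. \<not> P v} \<Longrightarrow> \<exists>k\<in>Occ. inn n k = v"
    and bnd: "\<And>u v. u \<in> S \<Longrightarrow> v \<in> verts n - S \<Longrightarrow> {u, v} \<in> F \<Longrightarrow> P u"
    and unlinked: "\<And>k l. k \<in> Occ \<Longrightarrow> l \<in> Occ \<Longrightarrow> inn n k \<in> S \<Longrightarrow> inn n l \<in> S \<Longrightarrow> k \<noteq> l \<Longrightarrow>
      \<not> conn F (inn n k) (inn n l)"
    and w: "w \<in> S" "\<not> P w"
    and wn: "\<And>v. v \<in> verts n \<Longrightarrow> {w, v} \<in> F \<Longrightarrow> v \<in> S"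
    and an: "\<And>v. v \<in> S \<Longrightarrow> {\<mu> w, v} \<in> F \<Longrightarrow> v = w"
  shows "{w, \<mu> w} \<in> F"
proof (rule ccontr)
  assume nf: "{w, \<mu> w} \<notin> F"
  define R where "R = S - {w, \<mu> w}"
  define E where "E = {e \<in> F. \<exists>u v. e = {u, v} \<and> u \<in> R \<and> v \<in> verts n - R}"
  define Xb where "Xb = {k \<in> Occ. inn n k \<in> R \<and> P (inn n k)}"
  define Xw where "Xw = {k \<in> Occ. inn n k \<in> R \<and> \<not> P (inn n k)}"
  define Rb where "Rb = {v \<in> R. P v}"
  define Rw where "Rw = {v \<in> R. \<not> P v}"
  define EB where "EB = {e \<in> F. \<exists>v\<in>Rb. v \<in> e}"
  define EW where "EW = {e \<in> F. \<exists>v\<in>Rw. v \<in> e}"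
  have RS: "R \<subseteq> S" and Rv: "R \<subseteq> verts n" using S by (auto simp: R_def)
  have fR: "finite R" using Rv finite_verts finite_subset by blast
  have fF: "finite F" using FPL_D(3)[OF F] .
  have fO: "finite Occ" using O finite_subset by blast
  have mw: "\<mu> w \<in> S" "P (\<mu> w)" using mu w by auto
  have inj: "inj_on (ext_edge n) Occ" using ext_edge_inj O by (meson inj_onI lessThan_iff subsetD)
  have indep: "u = v" if "u \<in> verts n" "v \<in> verts n" "P u = P v" "e \<in> F" "u \<in> e" "v \<in> e" for u v e
  proof -
    from F O \<open>e \<in> F\<close> show ?thesis
    proof (cases rule: FPL_edge_cases)
      case (internal a b) then show ?thesis using bip[of a b] that by auto
    next
      case (external k) then show ?thesis using inn_unique_edge[of k n u] inn_unique_edge[of k n v] O that by auto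
    qed
  qed
  have cB: "2 * card Rb = card EB" unfolding EB_def
  proof (rule independent_degree[OF F])
    show "Rb \<subseteq> verts n" using Rv unfolding Rb_def by blast
    fix u v e assume "u \<in> Rb" "v \<in> Rb" "e \<in> F" "u \<in> e" "v \<in> e"
    then show "u = v" using indep[of u v e] Rv unfolding Rb_def by blast
  qed
  have cW: "2 * card Rw = card EW" unfolding EW_def
  proof (rule independent_degree[OF F])
    show "Rw \<subseteq> verts n" using Rv unfolding Rw_def by blast
    fix u v e assume "u \<in> Rw" "v \<in> Rw" "e \<in> F" "u \<in> e" "v \<in> e"
    then show "u = v" using indep[of u v e] Rv unfolding Rw_def by blast
  qed
  have Eblack: "P u" if "{u, v} \<in> F" "u \<in> R" "v \<in> verts n - R" for u v
  proof (cases "v \<in> S")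
    case False then show ?thesis using bnd[of u v] that RS by auto
  next
    case True
    then have "v = w \<or> v = \<mu> w" using that by (auto simp: R_def)
    then show ?thesis
    proof
      assume "v = w" then show ?thesis using bip[of u v] that w Rv by auto
    next
      assume "v = \<mu> w"
      then have "u = w" using an[of u] that RS by (auto simp: insert_commute)
      then show ?thesis using that by (auto simp: R_def)
    qed
  qed
  have E_EB: "E \<subseteq> EB"
  proof
    fix e assume "e \<in> E"
    then obtain u v where "e \<in> F" "e = {u, v}" "u \<in> R" "v \<in> verts n - R" unfolding E_def by blast
    then show "e \<in> EB" using Eblack[of u v] by (auto simp: EB_def Rb_def)
  qed
  have E_EW: "E \<inter> EW = {}"
  proof -
    have False if ee: "e \<in> E" "e \<in> EW" for e
    proof -
      obtain u v where "e \<in> F" "e = {u, v}" "u \<in> R" "v \<in> verts n - R" using ee(1) unfolding E_def by blast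
      moreover then have "P u" using Eblack[of u v] by blast
      ultimately show False using ee(2) unfolding EW_def Rw_def by blast
    qed
    then show ?thesis by blast
  qed
  have Xb_EB: "ext_edge n ` Xb \<subseteq> EB"
    using F by (auto simp: EB_def Xb_def Rb_def FPL_def ext_edge_eq)
  have ext_one: "v = inn n k" if "k \<in> Occ" "v \<in> verts n" "v \<in> ext_edge n k" for k v
    using that inn_unique_edge[of k n v] O by auto
  have Xb_E: "ext_edge n ` Xb \<inter> E = {}"
  proof -
    have False if "k \<in> Xb" "ext_edge n k = {u, v}" "u \<in> R" "v \<in> verts n - R" for k u v
      using that ext_one[of k u] ext_one[of k v] Rv by (auto simp: Xb_def)
    then show ?thesis unfolding E_def by blast
  qed
  have Xb_EW: "ext_edge n ` Xb \<inter> EW = {}"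
  proof -
    have False if "k \<in> Xb" "v \<in> Rw" "v \<in> ext_edge n k" for k v
      using that ext_one[of k v] Rv by (auto simp: Xb_def Rw_def)
    then show ?thesis unfolding EW_def by blast
  qed
  have EW_sub: "EW \<subseteq> (EB \<inter> EW) \<union> ext_edge n ` Xw"
  proof
    fix e assume e: "e \<in> EW"
    then obtain v where v: "e \<in> F" "v \<in> Rw" "v \<in> e" by (auto simp: EW_def)
    from F O v(1) show "e \<in> (EB \<inter> EW) \<union> ext_edge n ` Xw"
    proof (cases rule: FPL_edge_cases)
      case (external k)
      then have "v = inn n k" using ext_one[of k v] v Rv by (auto simp: Rw_def)
      then show ?thesis using external v by (auto simp: Xw_def Rw_def)
    next
      case (internal a b)
      then obtain u where u: "e = {v, u}" "u \<in> verts n" using v(3) internal(1-3) by (metis insertE insert_commute singletonD)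
      have "\<not> P v" "v \<in> R" using v by (auto simp: Rw_def)
      then have "P u" using bip[of v u] u v Rv by auto
      moreover have "u \<in> R" using Eblack[of v u] u v \<open>\<not> P v\<close> \<open>v \<in> R\<close> by auto
      ultimately have "e \<in> EB" using u v(1) by (auto simp: EB_def Rb_def)
      then show ?thesis using e by simp
    qed
  qed
  have fEB: "finite EB" "finite EW" "finite E" using fF by (auto simp: EB_def EW_def E_def)
  have fX: "finite Xb" "finite Xw" using fO by (auto simp: Xb_def Xw_def)
  have cXb: "card (ext_edge n ` Xb) = card Xb" and cXw: "card (ext_edge n ` Xw) = card Xw"
    using inj by (auto intro!: card_image inj_on_subset[OF inj] simp: Xb_def Xw_def)
  have "card EW \<le> card (EB \<inter> EW) + card Xw"
    using card_mono[OF _ EW_sub] card_Un_le[of "EB \<inter> EW" "ext_edge n ` Xw"] fEB fX cXw by simp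
  moreover have "card E + card (ext_edge n ` Xb) + card (EB \<inter> EW) \<le> card EB"
  proof -
    have "card (E \<union> ext_edge n ` Xb \<union> (EB \<inter> EW)) = card E + card (ext_edge n ` Xb) + card (EB \<inter> EW)"
      using E_EW Xb_E Xb_EW fEB fX by (subst card_Un_disjoint, auto)+
    moreover have "card (E \<union> ext_edge n ` Xb \<union> (EB \<inter> EW)) \<le> card EB"
      by (rule card_mono[OF fEB(1)]) (use E_EB Xb_EB in auto)
    ultimately show ?thesis by simp
  qed
  moreover have "card Rb \<le> card Rw + card Xb"
  proof -
    have "Rb \<subseteq> \<mu> ` Rw \<union> inn n ` Xb"
    proof
      fix v assume v: "v \<in> Rb"
      then have vS: "v \<in> S" "P v" "v \<in> R" using RS by (auto simp: Rb_def)
      show "v \<in> \<mu> ` Rw \<union> inn n ` Xb"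
      proof (cases "v \<in> \<mu> ` {v \<in> S. \<not> P v}")
        case True
        then obtain u where u: "u \<in> S" "\<not> P u" "v = \<mu> u" by auto
        then have "u \<noteq> w" "u \<noteq> \<mu> w" using vS(3) mw by (auto simp: R_def)
        then show ?thesis using u by (auto simp: Rw_def R_def)
      next
        case False
        then obtain k where "k \<in> Occ" "inn n k = v" using unmatched vS by blast
        then show ?thesis using vS by (auto simp: Xb_def)
      qed
    qed
    then have "card Rb \<le> card (\<mu> ` Rw \<union> inn n ` Xb)"
      by (rule card_mono[rotated]) (use fX fR in \<open>auto simp: Rw_def\<close>)
    also have "\<dots> \<le> card (\<mu> ` Rw) + card (inn n ` Xb)" by (rule card_Un_le)
    also have "\<dots> \<le> card Rw + card Xb"
      using fX fR by (intro add_mono card_image_le) (auto simp: Rw_def)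
    finally show ?thesis .
  qed
  ultimately have cE: "card E \<le> card Xb + card Xw" using cB cW cXb by linarith
  define X where "X = {k \<in> Occ. inn n k \<in> R}"
  have XX: "X = Xb \<union> Xw" "Xb \<inter> Xw = {}" by (auto simp: X_def Xb_def Xw_def)
  have cX: "card E \<le> card X" using cE card_Un_disjoint[OF fX XX(2)] XX(1) by simp
  have exit: "\<exists>e\<in>E. \<forall>u\<in>e. conn F (inn n k) u" if k: "k \<in> X" for k
  proof -
    have kO: "k \<in> Occ" "inn n k \<in> R" using k by (auto simp: X_def)
    obtain l where l: "l \<in> Occ" "l \<noteq> k" "conn F (inn n k) (inn n l)" using partner_exists[OF F O kO(1)] by blast
    have lS: "inn n l \<notin> S" using unlinked[of k l] kO l RS by auto
    \<comment> \<open>Outer ends attached to \<open>R\<close> are included, so that the crossing edge is internal.\<close>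
    define R' where "R' = R \<union> {out n m | m. m < 4 * n \<and> inn n m \<in> R}"
    have lv: "inn n l \<in> verts n" using l O by auto
    have kR: "inn n k \<in> R'" using kO unfolding R'_def by blast
    have lR: "inn n l \<notin> R'" using lS RS lv out_verts by (auto simp: R'_def)
    obtain u v where uv: "{u, v} \<in> F" "u \<in> R'" "v \<notin> R'" "conn F (inn n k) u" "conn F (inn n k) v"
      by (rule crossing_edge[OF l(3) kR lR])
    have ee: "{u, v} \<in> edges n" using uv(1) FPL_D(1)[OF F] by auto
    have uR: "u \<in> R"
    proof (rule ccontr)
      assume "u \<notin> R"
      then obtain m where m: "m < 4 * n" "u = out n m" "inn n m \<in> R" using uv(2) by (auto simp: R'_def)
      then have "{u, v} = ext_edge n m" using edge_at_out[OF m(1) ee] by simp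
      then have "v = inn n m" using m inn_verts[OF m(1)] out_verts[OF m(1)] by (auto simp: ext_edge_eq doubleton_eq_iff)
      then show False using uv(3) m by (auto simp: R'_def)
    qed
    have "v \<in> verts n"
    proof (rule ccontr)
      assume "v \<notin> verts n"
      then obtain m where "m < 4 * n" "v = out n m" "u = inn n m"
        using outside_point[of v u n] ee by (auto simp: insert_commute)
      then show False using uv(3) uR by (auto simp: R'_def)
    qed
    moreover have "v \<notin> R" using uv(3) unfolding R'_def by blast
    ultimately have "v \<in> verts n - R" by blast
    then have "{u, v} \<in> E" using uv(1) uR unfolding E_def by blast
    moreover have "\<forall>x\<in>{u, v}. conn F (inn n k) x" using uv(4,5) by simp
    ultimately show ?thesis by (rule bexI[rotated])
  qed
  then obtain \<phi> where phi: "\<And>k. k \<in> X \<Longrightarrow> \<phi> k \<in> E" "\<And>k u. k \<in> X \<Longrightarrow> u \<in> \<phi> k \<Longrightarrow> conn F (inn n k) u"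
    by metis
  have "inj_on \<phi> X"
  proof
    fix k l assume kl: "k \<in> X" "l \<in> X" "\<phi> k = \<phi> l"
    obtain u where "u \<in> \<phi> k" using phi(1)[OF kl(1)] by (auto simp: E_def)
    then have "conn F (inn n k) u" "conn F (inn n l) u" using phi(2) kl by auto
    then have "conn F (inn n k) (inn n l)" using conn_sym by (meson rtranclp_trans)
    then show "k = l" using unlinked[of k l] kl RS by (auto simp: X_def)
  qed
  then have surj: "\<phi> ` X = E"
    using phi(1) cX fEB(3) by (intro card_seteq) (auto simp: card_image)
  have key: "\<exists>k\<in>Occ. inn n k \<in> S \<and> conn F (inn n k) w \<and> ((inn n k = w \<and> e = ext_edge n k) \<or> (k \<in> X \<and> \<phi> k = e))"
    if e: "e \<in> F" "w \<in> e" for e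
  proof -
    have wv: "w \<in> verts n" using w S by auto
    from F O e(1) show ?thesis
    proof (cases rule: FPL_edge_cases)
      case (external k)
      then show ?thesis using ext_one[of k w] wv e w by auto
    next
      case (internal a b)
      then obtain v where v: "e = {w, v}" "v \<in> verts n" "v \<noteq> w" using e(2) internal(1-4)
        by (metis insertE insert_commute singletonD)
      have "v \<in> S" using wn[of v] v e by simp
      moreover have "v \<noteq> \<mu> w" using nf v e by auto
      ultimately have "v \<in> R" using v by (auto simp: R_def)
      moreover have "e = {v, w}" "w \<in> verts n - R" using v wv by (auto simp: R_def)
      ultimately have "e \<in> E" using e(1) unfolding E_def by blast
      then obtain k where "k \<in> X" "\<phi> k = e" using surj by auto
      then show ?thesis using phi(2)[of k w] e RS by (auto simp: X_def)
    qed
  qed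
  have "card {e \<in> F. w \<in> e} = 2" using FPL_D(2)[OF F] w S by blast
  then obtain e1 e2 where e12: "{e \<in> F. w \<in> e} = {e1, e2}" "e1 \<noteq> e2" by (auto simp: card_2_iff)
  then have m12: "e1 \<in> F" "w \<in> e1" "e2 \<in> F" "w \<in> e2" by blast+
  obtain k1 where k1: "k1 \<in> Occ" "inn n k1 \<in> S" "conn F (inn n k1) w"
      "(inn n k1 = w \<and> e1 = ext_edge n k1) \<or> (k1 \<in> X \<and> \<phi> k1 = e1)"
    using key[OF m12(1,2)] by blast
  obtain k2 where k2: "k2 \<in> Occ" "inn n k2 \<in> S" "conn F (inn n k2) w"
      "(inn n k2 = w \<and> e2 = ext_edge n k2) \<or> (k2 \<in> X \<and> \<phi> k2 = e2)"
    using key[OF m12(3,4)] by blast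
  have wR: "w \<notin> R" by (simp add: R_def)
  have "k1 \<noteq> k2"
  proof
    assume "k1 = k2"
    then show False using k1(4) k2(4) e12(2) wR by (auto simp: X_def)
  qed
  moreover have "conn F (inn n k1) (inn n k2)" using k1 k2 conn_sym by (meson rtranclp_trans)
  ultimately show False using unlinked k1 k2 by blast
qed

section \<open>Plane partitions as frozen corner sums\<close>

text \<open>
The passage between a height and the predicate of the levels below it: the height of a column is
read off by counting, and compared with a level by testing that level.
\<close>
lemma down_card:
  fixes Q :: "nat \<Rightarrow> bool"
  assumes "\<And>k. 1 \<le> k \<Longrightarrow> Suc k \<le> m \<Longrightarrow> Q (Suc k) \<Longrightarrow> Q k" and k: "1 \<le> k" "k \<le> m"
  shows "k \<le> card {i \<in> {1..m}. Q i} \<longleftrightarrow> Q k"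
proof
  have down: "Q i" if "Q k'" "i \<le> k'" "1 \<le> i" "k' \<le> m" for i k'
    using that(2,1,3,4)
  proof (induction i rule: inc_induct)
    case (step i) then show ?case using assms(1)[of i] by simp
  qed
  show "Q k" if "k \<le> card {i \<in> {1..m}. Q i}"
  proof (rule ccontr)
    assume "\<not> Q k"
    then have "{i \<in> {1..m}. Q i} \<subseteq> {1..<k}" using down k by (auto simp: not_less[symmetric]) (meson leI)
    then have "card {i \<in> {1..m}. Q i} \<le> k - 1" using card_mono[of "{1..<k}"] by fastforce
    then show False using that k by simp
  qed
  show "k \<le> card {i \<in> {1..m}. Q i}" if "Q k"
  proof -
    have "{1..k} \<subseteq> {i \<in> {1..m}. Q i}" using down[OF that] k by auto
    then have "card {1..k} \<le> card {i \<in> {1..m}. Q i}" by (intro card_mono) auto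
    then show ?thesis by simp
  qed
qed

lemma le_by_levels:
  fixes x y :: int
  assumes "x \<le> int m" "0 \<le> y" "\<And>k. 1 \<le> k \<Longrightarrow> k \<le> m \<Longrightarrow> int k \<le> x \<Longrightarrow> int k \<le> y"
  shows "x \<le> y"
  using assms(3)[of "nat x"] assms(1,2) by (cases "x \<le> 0") auto

text \<open>
The normal position: \<open>A\<close>, \<open>B\<close>, \<open>C\<close> have the indices \<open>4 * n + c - b\<close>, \<open>n + a\<close>, \<open>3 * n - a\<close>. Thus \<open>B\<close>
lies on the right side and \<open>C\<close> on the bottom side, at the two ends of the diagonal \<open>x = y + a\<close>, and
\<open>A\<close> lies on the left side (at the first position of the top side if \<open>b = c\<close>), where the antidiagonal
\<open>x + y = a + 2 * c\<close> ends; for \<open>c > b\<close> it would move along the top side.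
\<close>
locale box =
  fixes a b c n :: nat
  assumes pos: "0 < a" "0 < c" and cb: "c \<le> b" and n: "n = a + b + c"
begin

text \<open>
Heights are indexed by plaquettes, \<open>(i, j)\<close> standing for the one with lower left corner \<open>(i, j)\<close>;
index \<open>0\<close> and index \<open>n\<close> give the incomplete plaquettes along the perimeter. The conditions
characterise the corner-sum matrices of alternating sign matrices.
\<close>
definition csum_ok :: "(nat \<Rightarrow> nat \<Rightarrow> int) \<Rightarrow> bool" where
  "csum_ok T \<longleftrightarrow>
    (\<forall>i j. i < n \<and> j \<le> n \<longrightarrow> T i j \<le> T (Suc i) j \<and> T (Suc i) j \<le> T i j + 1) \<and>
    (\<forall>i j. i \<le> n \<and> j < n \<longrightarrow> T i (Suc j) \<le> T i j \<and> T i j \<le> T i (Suc j) + 1) \<and>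
    (\<forall>j\<le>n. T 0 j = 0) \<and> (\<forall>i\<le>n. T i n = 0) \<and> (\<forall>i\<le>n. T i 0 = int i) \<and> (\<forall>j\<le>n. T n j = int n - int j)"

text \<open>
The edges between the paired plaquettes are occupied: the diagonal through \<open>B\<close> and \<open>C\<close> and the
antidiagonal through \<open>A\<close> cut the square into three regions, with vertical frozen edges in the upper
one and horizontal frozen edges in the left one. In the region cut off by the diagonal \<open>i = j + a\<close>
all heights, and so all edges, are determined.
\<close>
definition frozen :: "(nat \<Rightarrow> nat \<Rightarrow> int) \<Rightarrow> bool" where
  "frozen T \<longleftrightarrow>
    (\<forall>i j. odd (i + j + a) \<and> i < j + a \<and> a + 2 * c < i + j \<and> i < n \<and> j \<le> n \<longrightarrow> T (Suc i) j = T i j) \<and>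
    (\<forall>i j. odd (i + j + a) \<and> i < j + a \<and> i + j < a + 2 * c \<and> i \<le> n \<and> j < n \<longrightarrow> T i (Suc j) = T i j) \<and>
    (\<forall>i j. j + a \<le> i \<and> i \<le> n \<longrightarrow> T i j = int i - int j)"

text \<open>
The cubes \<open>(k, j, l)\<close> under the diagram of the plane partition, for \<open>j\<close> and \<open>l\<close> ranging over all
integers: positions below the box count as filled and positions beyond it as empty. This makes the
boundary values of the heights special cases of the general formula.
\<close>
definition solid :: "(nat \<Rightarrow> nat \<Rightarrow> nat) \<Rightarrow> nat \<Rightarrow> int \<Rightarrow> int \<Rightarrow> bool" where
  "solid \<pi> k j l \<longleftrightarrow> j \<le> int b \<and> l \<le> int c \<and> (j \<le> 0 \<or> l \<le> 0 \<or> l \<le> int (\<pi> k (nat j)))"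

text \<open>
The cubes with indices \<open>(k, u + k - a, v + k - a)\<close> lie on a line of direction $(1,1,1)$, so
\<open>(u, v)\<close> is a coordinate on the plane of projection. Since the solid is closed under decreasing
coordinates, the filled cubes on the line form an initial segment.
\<close>
definition depth :: "(nat \<Rightarrow> nat \<Rightarrow> nat) \<Rightarrow> int \<Rightarrow> int \<Rightarrow> int" where
  "depth \<pi> u v = int (card {k \<in> {1..a}. solid \<pi> k (u + int k - int a) (v + int k - int a)})"

text \<open>
The pair \<open>(uu x y, vv x y)\<close> is the point of the projection that the plaquette \<open>(x, y)\<close> represents.
The rounding in the division identifies the two plaquettes on either side of a frozen edge.
\<close>
definition uu :: "nat \<Rightarrow> nat \<Rightarrow> int" where
  "uu x y = (if a + 2 * c \<le> x + y then int y - int c else (int a - int x + int y + 1) div 2)"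
definition vv :: "nat \<Rightarrow> nat \<Rightarrow> int" where
  "vv x y = (if a + 2 * c \<le> x + y then (int a - int x + int y) div 2 else int a + int c - int x)"

definition csum_of :: "(nat \<Rightarrow> nat \<Rightarrow> nat) \<Rightarrow> nat \<Rightarrow> nat \<Rightarrow> int" where
  "csum_of \<pi> x y = (if y + a \<le> x then int x - int y else depth \<pi> (uu x y) (vv x y))"

lemma solid_mono:
  assumes p: "\<pi> \<in> plane_partitions a b c" and s: "solid \<pi> k j l" and k: "1 \<le> k'" "k' \<le> k" "k \<le> a"
    and jl: "j' \<le> j" "l' \<le> l"
  shows "solid \<pi> k' j' l'"
proof (cases "j' \<le> 0 \<or> l' \<le> 0")
  case True then show ?thesis using s jl by (auto simp: solid_def)
next
  case False
  then have jj: "nat j' \<in> {1..b}" "nat j \<in> {1..b}" "nat j' \<le> nat j" and l: "l \<le> int (\<pi> k (nat j))"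
    using s jl by (auto simp: solid_def)
  have "\<pi> k (nat j) \<le> \<pi> k (nat j')" "\<pi> k (nat j') \<le> \<pi> k' (nat j')"
    using p jj k unfolding plane_partitions_def by auto
  then show ?thesis using l s jl by (auto simp: solid_def)
qed

lemma depth_iff:
  assumes p: "\<pi> \<in> plane_partitions a b c" and k: "1 \<le> k" "k \<le> a"
  shows "int k \<le> depth \<pi> u v \<longleftrightarrow> solid \<pi> k (u + int k - int a) (v + int k - int a)"
proof -
  have "k \<le> card {k \<in> {1..a}. solid \<pi> k (u + int k - int a) (v + int k - int a)} \<longleftrightarrow>
    solid \<pi> k (u + int k - int a) (v + int k - int a)"
    by (rule down_card) (use k solid_mono[OF p] in auto)
  then show ?thesis by (simp add: depth_def)
qed

lemma depth_bounds: "0 \<le> depth \<pi> u v" "depth \<pi> u v \<le> int a"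
proof -
  have "card {k \<in> {1..a}. solid \<pi> k (u + int k - int a) (v + int k - int a)} \<le> card {1..a}"
    by (rule card_mono) auto
  then show "depth \<pi> u v \<le> int a" by (simp add: depth_def)
qed (simp add: depth_def)

lemma depth_antimono:
  assumes p: "\<pi> \<in> plane_partitions a b c" and "u \<le> u'" "v \<le> v'"
  shows "depth \<pi> u' v' \<le> depth \<pi> u v"
proof (rule le_by_levels[OF depth_bounds(2) depth_bounds(1)])
  fix k assume k: "1 \<le> k" "k \<le> a" "int k \<le> depth \<pi> u' v'"
  show "int k \<le> depth \<pi> u v"
    using k(3) unfolding depth_iff[OF p k(1,2)]
    by (rule solid_mono[OF p]) (use k assms in auto)
qed

lemma depth_diag:
  assumes p: "\<pi> \<in> plane_partitions a b c"
  shows "depth \<pi> u v \<le> depth \<pi> (u + 1) (v + 1) + 1"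
proof (rule le_by_levels[OF depth_bounds(2)])
  show "0 \<le> depth \<pi> (u + 1) (v + 1) + 1" using depth_bounds(1)[of \<pi> "u+1" "v+1"] by simp
  fix k assume k: "1 \<le> k" "k \<le> a" "int k \<le> depth \<pi> u v"
  show "int k \<le> depth \<pi> (u + 1) (v + 1) + 1"
  proof (cases "k = 1")
    case True then show ?thesis using depth_bounds(1)[of \<pi> "u+1" "v+1"] by simp
  next
    case False
    then obtain m where m: "k = Suc m" "1 \<le> m" using k by (cases k) auto
    have "solid \<pi> k (u + int k - int a) (v + int k - int a)" using k depth_iff[OF p] by blast
    then have "solid \<pi> m (u + 1 + int m - int a) (v + 1 + int m - int a)"
      by (rule solid_mono[OF p]) (use m k in auto)
    then have "int m \<le> depth \<pi> (u + 1) (v + 1)" using depth_iff[OF p, of m] m k by auto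
    then show ?thesis using m by simp
  qed
qed

lemma depth_step:
  assumes p: "\<pi> \<in> plane_partitions a b c" and "u - 1 \<le> u'" "u' \<le> u" "v - 1 \<le> v'" "v' \<le> v"
  shows "depth \<pi> u v \<le> depth \<pi> u' v'" "depth \<pi> u' v' \<le> depth \<pi> u v + 1"
  using depth_antimono[OF p assms(3,5)] depth_antimono[OF p assms(2,4)] depth_diag[OF p, of "u - 1" "v - 1"]
  by auto

lemma depth_eqI:
  assumes p: "\<pi> \<in> plane_partitions a b c" and "0 \<le> x" "x \<le> int a"
    and "\<And>k. 1 \<le> k \<Longrightarrow> k \<le> a \<Longrightarrow> solid \<pi> k (u + int k - int a) (v + int k - int a) \<longleftrightarrow> int k \<le> x"
  shows "depth \<pi> u v = x"
proof (rule antisym)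
  show "depth \<pi> u v \<le> x"
    by (rule le_by_levels[OF depth_bounds(2)]) (use assms depth_iff[OF p] in auto)
  show "x \<le> depth \<pi> u v"
    by (rule le_by_levels[OF assms(3) depth_bounds(1)]) (use assms depth_iff[OF p] in auto)
qed

text \<open>
On the diagonal \<open>x = y + a\<close> both clauses of the definition of \<open>csum_of\<close> agree.
\<close>
lemma csum_of_line:
  assumes p: "\<pi> \<in> plane_partitions a b c" and "x = y + a" "x \<le> n"
  shows "depth \<pi> (uu x y) (vv x y) = int a"
  by (rule depth_eqI[OF p]) (use assms n in \<open>auto simp: solid_def uu_def vv_def\<close>)

lemma csum_of_eq:
  assumes p: "\<pi> \<in> plane_partitions a b c" and "x \<le> n" "x \<le> y + a"
  shows "csum_of \<pi> x y = depth \<pi> (uu x y) (vv x y)"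
  using csum_of_line[OF p, of x y] assms by (auto simp: csum_of_def)

text \<open>
Stepping to a neighbouring plaquette moves the projection by 0 or 1 in each coordinate, in the same
sense; with \<open>depth_step\<close> this bounds the increments of the heights.
\<close>
lemma uv_right: "uu x y - 1 \<le> uu (Suc x) y" "uu (Suc x) y \<le> uu x y"
    "vv x y - 1 \<le> vv (Suc x) y" "vv (Suc x) y \<le> vv x y"
  unfolding uu_def vv_def by (simp_all split: if_split) presburger+

lemma uv_up: "uu x (Suc y) - 1 \<le> uu x y" "uu x y \<le> uu x (Suc y)"
    "vv x (Suc y) - 1 \<le> vv x y" "vv x y \<le> vv x (Suc y)"
  unfolding uu_def vv_def by (simp_all split: if_split) presburger+

lemma csum_of_left:
  assumes p: "\<pi> \<in> plane_partitions a b c" and "y \<le> n"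
  shows "csum_of \<pi> 0 y = 0"
proof -
  have "vv 0 y \<ge> int a + int c" unfolding vv_def by auto
  then have "depth \<pi> (uu 0 y) (vv 0 y) = 0"
    by (intro depth_eqI[OF p]) (auto simp: solid_def)
  then show ?thesis using pos by (simp add: csum_of_def)
qed

lemma csum_of_top:
  assumes p: "\<pi> \<in> plane_partitions a b c" and "x \<le> n"
  shows "csum_of \<pi> x n = 0"
proof (cases "x = 0")
  case True then show ?thesis using csum_of_left[OF p] by simp
next
  case False
  then have "uu x n = int a + int b" using n cb by (auto simp: uu_def)
  then have "depth \<pi> (uu x n) (vv x n) = 0"
    by (intro depth_eqI[OF p]) (auto simp: solid_def)
  then show ?thesis using assms pos by (simp add: csum_of_def)
qed

lemma csum_of_bottom:
  assumes p: "\<pi> \<in> plane_partitions a b c" and "x \<le> n"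
  shows "csum_of \<pi> x 0 = int x"
proof (cases "a \<le> x")
  case True then show ?thesis by (simp add: csum_of_def)
next
  case False
  then have "vv x 0 = int a + int c - int x" "uu x 0 = (int a - int x + 1) div 2" using pos by (auto simp: vv_def uu_def)
  moreover have "(int a - int x + 1) div 2 \<le> int a - int x" using False by presburger
  ultimately have "depth \<pi> (uu x 0) (vv x 0) = int x"
    using False by (intro depth_eqI[OF p]) (auto simp: solid_def)
  then show ?thesis using False by (simp add: csum_of_def)
qed

lemma csum_of_right:
  assumes p: "\<pi> \<in> plane_partitions a b c" and "y \<le> n"
  shows "csum_of \<pi> n y = int n - int y"
proof (cases "y + a \<le> n")
  case True then show ?thesis by (simp add: csum_of_def)
next
  case False
  then have "uu n y = int y - int c" "vv n y = (int a - int n + int y) div 2" using n cb by (auto simp: vv_def uu_def)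
  moreover have "(int a - int n + int y) div 2 \<le> int a - int n + int y" using False by presburger
  ultimately have "depth \<pi> (uu n y) (vv n y) = int n - int y"
    using False assms n by (intro depth_eqI[OF p]) (auto simp: solid_def)
  then show ?thesis using False by (simp add: csum_of_def)
qed

lemma csum_of_ok:
  assumes p: "\<pi> \<in> plane_partitions a b c"
  shows "csum_ok (csum_of \<pi>)"
proof -
  have 1: "csum_of \<pi> x y \<le> csum_of \<pi> (Suc x) y \<and> csum_of \<pi> (Suc x) y \<le> csum_of \<pi> x y + 1" if "x < n" for x y
  proof (cases "y + a \<le> x")
    case True then show ?thesis by (simp add: csum_of_def)
  next
    case False
    then show ?thesis using csum_of_eq[OF p, of x y] csum_of_eq[OF p, of "Suc x" y] that
        depth_step[OF p uv_right, of x y] by auto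
  qed
  have 2: "csum_of \<pi> x (Suc y) \<le> csum_of \<pi> x y \<and> csum_of \<pi> x y \<le> csum_of \<pi> x (Suc y) + 1" if "x \<le> n" for x y
  proof (cases "Suc y + a \<le> x")
    case True then show ?thesis by (simp add: csum_of_def)
  next
    case False
    show ?thesis
    proof (cases "x = y + a")
      case True
      then show ?thesis using csum_of_eq[OF p, of x y] csum_of_eq[OF p, of x "Suc y"] that
        depth_step[OF p uv_up, of x y] by auto
    next
      case False
      then show ?thesis using \<open>\<not> Suc y + a \<le> x\<close> csum_of_eq[OF p, of x y] csum_of_eq[OF p, of x "Suc y"] that
        depth_step[OF p uv_up, of x y] by auto
    qed
  qed
  show ?thesis unfolding csum_ok_def
    using 1 2 csum_of_left[OF p] csum_of_top[OF p] csum_of_bottom[OF p] csum_of_right[OF p] by blast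
qed

lemma uv_pair_right:
  assumes "odd (x + y + a)" "a + 2 * c < x + y"
  shows "uu (Suc x) y = uu x y" "vv (Suc x) y = vv x y"
proof -
  have "odd (int a - int x + int y)" using assms(1) by presburger
  then have "(int a - (1 + int x) + int y) div 2 = (int a - int x + int y) div 2" by presburger
  then show "uu (Suc x) y = uu x y" "vv (Suc x) y = vv x y" using assms by (auto simp: uu_def vv_def)
qed

lemma uv_pair_up:
  assumes "odd (x + y + a)" "x + y < a + 2 * c"
  shows "uu x (Suc y) = uu x y" "vv x (Suc y) = vv x y"
proof -
  have o: "odd (int a - int x + int y)" using assms(1) by presburger
  have e: "Suc (x + y) = a + 2 * c \<or> Suc (x + y) < a + 2 * c" using assms by linarith
  have "(int a - int x + (1 + int y) + 1) div 2 = (int a - int x + int y + 1) div 2" using o by presburger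
  moreover have "(int a - int x + int y + 1) div 2 = int y + 1 - int c" "(int a - int x + (1 + int y)) div 2 = int a + int c - int x"
    if "Suc (x + y) = a + 2 * c" using that by presburger+
  ultimately show "uu x (Suc y) = uu x y" "vv x (Suc y) = vv x y" using assms e by (auto simp: uu_def vv_def)
qed

lemma csum_of_frozen:
  assumes p: "\<pi> \<in> plane_partitions a b c"
  shows "frozen (csum_of \<pi>)"
proof -
  have "csum_of \<pi> (Suc i) j = csum_of \<pi> i j" if "odd (i + j + a)" "i < j + a" "a + 2 * c < i + j" "i < n" for i j
    using csum_of_eq[OF p, of i j] csum_of_eq[OF p, of "Suc i" j] uv_pair_right[of i j] that by simp
  moreover have "csum_of \<pi> i (Suc j) = csum_of \<pi> i j" if "odd (i + j + a)" "i < j + a" "i + j < a + 2 * c" "i \<le> n" for i j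
    using csum_of_eq[OF p, of i j] csum_of_eq[OF p, of i "Suc j"] uv_pair_up[of i j] that by simp
  ultimately show ?thesis unfolding frozen_def by (auto simp: csum_of_def)
qed

text \<open>
The plaquette \<open>(px i j l, py i j l)\<close> is the one of even parity that represents the line through the
cube \<open>(i, j, l)\<close>; see \<open>uv_pxy\<close>. The distinction of cases is the one between the two sides of the
antidiagonal through \<open>A\<close>.
\<close>
definition px :: "nat \<Rightarrow> nat \<Rightarrow> nat \<Rightarrow> nat" where
  "px i j l = (if l \<le> j then c + i + j - 2 * l else c + i - l)"
definition py :: "nat \<Rightarrow> nat \<Rightarrow> nat \<Rightarrow> nat" where
  "py i j l = (if l \<le> j then a + c + j - i else a + c + 2 * j - i - l)"
definition pp_of :: "(nat \<Rightarrow> nat \<Rightarrow> int) \<Rightarrow> nat \<Rightarrow> nat \<Rightarrow> nat" where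
  "pp_of T i j = (if i \<in> {1..a} \<and> j \<in> {1..b} then card {l \<in> {1..c}. int i \<le> T (px i j l) (py i j l)} else 0)"

lemma uv_pxy:
  assumes "1 \<le> i" "i \<le> a" "1 \<le> j" "j \<le> b" "1 \<le> l" "l \<le> c"
  shows "uu (px i j l) (py i j l) = int a + int j - int i" "vv (px i j l) (py i j l) = int a + int l - int i"
    "px i j l < py i j l + a" "px i j l \<le> n" "py i j l \<le> n"
    "even (px i j l + py i j l + a)"
proof -
  have q: "px i j l + py i j l = (if l \<le> j then a + 2 * c + 2 * (j - l) else a + 2 * c - 2 * (l - j))"
    using assms by (auto simp: px_def py_def)
  have "int (px i j l + py i j l) = int a + 2 * int c + 2 * int j - 2 * int l"
    using assms by (auto simp: px_def py_def of_nat_diff)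
  then show "even (px i j l + py i j l + a)" by presburger
  have d: "int a - int (px i j l) + int (py i j l) = (if l \<le> j then 2 * (int a + int l - int i) else 2 * (int a + int j - int i))"
    using assms by (auto simp: px_def py_def of_nat_diff)
  show "uu (px i j l) (py i j l) = int a + int j - int i" "vv (px i j l) (py i j l) = int a + int l - int i"
    unfolding uu_def vv_def d q using assms by (auto simp: px_def py_def of_nat_diff)
  show "px i j l < py i j l + a" "px i j l \<le> n" "py i j l \<le> n"
    using assms n by (auto simp: px_def py_def)
qed

lemma pp_of_csum_of:
  assumes p: "\<pi> \<in> plane_partitions a b c"
  shows "pp_of (csum_of \<pi>) = \<pi>"
proof (intro ext)
  fix i j
  show "pp_of (csum_of \<pi>) i j = \<pi> i j"
  proof (cases "i \<in> {1..a} \<and> j \<in> {1..b}")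
    case False then show ?thesis using p by (auto simp: pp_of_def plane_partitions_def)
  next
    case True
    then have c: "\<pi> i j \<le> c" using p by (auto simp: plane_partitions_def)
    have "int i \<le> csum_of \<pi> (px i j l) (py i j l) \<longleftrightarrow> l \<le> \<pi> i j" if "l \<in> {1..c}" for l
      using True that uv_pxy[of i j l] depth_iff[OF p, of i] by (auto simp: csum_of_def solid_def)
    then have "{l \<in> {1..c}. int i \<le> csum_of \<pi> (px i j l) (py i j l)} = {1..\<pi> i j}" using c by auto
    then show ?thesis using True by (simp add: pp_of_def)
  qed
qed

context
  fixes T :: "nat \<Rightarrow> nat \<Rightarrow> int"
  assumes ok: "csum_ok T" and fr: "frozen T"
begin

lemma T_right: "i < n \<Longrightarrow> j \<le> n \<Longrightarrow> T i j \<le> T (Suc i) j" "i < n \<Longrightarrow> j \<le> n \<Longrightarrow> T (Suc i) j \<le> T i j + 1"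
  and T_up: "i \<le> n \<Longrightarrow> j < n \<Longrightarrow> T i (Suc j) \<le> T i j" "i \<le> n \<Longrightarrow> j < n \<Longrightarrow> T i j \<le> T i (Suc j) + 1"
  and T_bd: "j \<le> n \<Longrightarrow> T 0 j = 0" "i \<le> n \<Longrightarrow> T i n = 0" "i \<le> n \<Longrightarrow> T i 0 = int i" "j \<le> n \<Longrightarrow> T n j = int n - int j"
  using ok unfolding csum_ok_def by blast+

lemma T_V: "odd (i + j + a) \<Longrightarrow> i < j + a \<Longrightarrow> a + 2 * c < i + j \<Longrightarrow> i < n \<Longrightarrow> j \<le> n \<Longrightarrow> T (Suc i) j = T i j"
  and T_H: "odd (i + j + a) \<Longrightarrow> i < j + a \<Longrightarrow> i + j < a + 2 * c \<Longrightarrow> i \<le> n \<Longrightarrow> j < n \<Longrightarrow> T i (Suc j) = T i j"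
  and T_S: "j + a \<le> i \<Longrightarrow> i \<le> n \<Longrightarrow> T i j = int i - int j"
  using fr unfolding frozen_def by blast+

lemma T_mono_x:
  assumes "x \<le> x'" "x' \<le> n" "y \<le> n" shows "T x y \<le> T x' y"
  using assms
proof (induction x' rule: dec_induct)
  case (step m) then show ?case using T_right(1)[of m y] by simp
qed simp

lemma T_le_x: "x \<le> n \<Longrightarrow> y \<le> n \<Longrightarrow> T x y \<le> int x"
proof (induction x)
  case (Suc x) then show ?case using T_right(2)[of x y] by simp
qed (simp add: T_bd)

lemma T_nonneg: "x \<le> n \<Longrightarrow> y \<le> n \<Longrightarrow> 0 \<le> T x y"
  using T_mono_x[of 0 x y] T_bd by simp

lemma T_le_y:
  assumes "x \<le> n" "y \<le> n" shows "T x y \<le> int n - int y"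
  using T_mono_x[of x n y] T_bd(4) assms by simp

lemma T_le_a:
  assumes "x \<le> n" "y \<le> n" "x \<le> y + a" shows "T x y \<le> int a"
proof (cases "y + a \<le> n")
  case True then show ?thesis using T_mono_x[of x "y + a" y] T_S[of y "y + a"] assms by simp
next
  case False then show ?thesis using T_le_y[of x y] assms by simp
qed

text \<open>
Crossing a frozen edge costs nothing, so a diagonal step is bounded by one elementary inequality.
This and the following lemma turn the increments of \<open>T\<close> into the monotonicity of the pile of
cubes.
\<close>
lemma T_diag_step:
  assumes "even (x + y + a)" "a + 2 * c \<le> x + y" "x \<le> y + a" "x < n" "y < n"
  shows "T (Suc x) (Suc y) \<le> T x y"
proof -
  have "T (Suc x) (Suc y) = T x (Suc y)" using T_V[of x "Suc y"] assms by auto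
  then show ?thesis using T_up(1)[of x y] assms by simp
qed

lemma T_antidiag_step:
  assumes "even (x + Suc y + a)" "x + 2 \<le> Suc y + a" "x < n" "y < n"
  shows "T (Suc x) y \<le> T x (Suc y) + 1"
proof (cases "a + 2 * c < x + y")
  case True
  then have "T (Suc x) y = T x y" using T_V[of x y] assms by auto
  then show ?thesis using T_up(2)[of x y] assms by simp
next
  case False
  then have "x + y < a + 2 * c" using assms(1) by presburger
  then have "T x (Suc y) = T x y" using T_H[of x y] assms by auto
  then show ?thesis using T_right(2)[of x y] assms by simp
qed

lemma T_diag:
  assumes "even (x + y + a)" "a + 2 * c \<le> x + y" "x \<le> y + a" "x + s \<le> n" "y + s \<le> n"
  shows "T (x + s) (y + s) \<le> T x y"
  using assms(4,5)
proof (induction s)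
  case (Suc s)
  have "T (Suc (x + s)) (Suc (y + s)) \<le> T (x + s) (y + s)"
    by (rule T_diag_step) (use Suc.prems assms(1-3) in auto)
  then show ?case using Suc by simp
qed simp

lemma T_antidiag:
  assumes "even (x + y + s + a)" "x + s \<le> y + a" "x + s \<le> n" "y + s \<le> n"
  shows "T (x + s) y \<le> T x (y + s) + int s"
  using assms
proof (induction s arbitrary: y)
  case (Suc s)
  have "T (Suc (x + s)) y \<le> T (x + s) (Suc y) + 1"
    by (rule T_antidiag_step) (use Suc.prems in auto)
  moreover have "T (x + s) (Suc y) \<le> T x (Suc y + s) + int s"
    by (rule Suc.IH) (use Suc.prems in auto)
  ultimately show ?case by simp
qed simp

text \<open>
The cubes \<open>(i, j, l)\<close> with \<open>i \<le> T (px i j l) (py i j l)\<close> are closed under decreasing each of the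
three indices; in each case the two plaquettes are joined by a straight line of two steps or by a
diagonal or antidiagonal step across one frozen edge.
\<close>
lemma cube_down_l:
  assumes "1 \<le> i" "i \<le> a" "1 \<le> j" "j \<le> b" "1 \<le> l" "Suc l \<le> c"
    and "int i \<le> T (px i j (Suc l)) (py i j (Suc l))"
  shows "int i \<le> T (px i j l) (py i j l)"
proof (cases "Suc l \<le> j")
  case True
  then have "px i j (Suc l) \<le> px i j l" "py i j (Suc l) = py i j l" using assms by (auto simp: px_def py_def)
  then show ?thesis using T_mono_x[of "px i j (Suc l)" "px i j l" "py i j l"] uv_pxy[of i j l] assms by simp
next
  case False
  define x where "x = px i j (Suc l)"
  define y where "y = py i j (Suc l)"
  have xy: "px i j l = Suc x" "py i j l = Suc y" using assms False by (auto simp: px_def py_def x_def y_def)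
  have p: "even (Suc x + Suc y + a)" "Suc x \<le> n" "Suc y \<le> n" "Suc x < Suc y + a"
    using uv_pxy[of i j l] assms unfolding xy by auto
  have "x + y + 2 \<le> a + 2 * c" using assms False unfolding x_def y_def by (auto simp: px_def py_def)
  moreover have "Suc x < y + a" using p(1,4) by presburger
  ultimately have "T (Suc x) (Suc y) = T (Suc x) y" using T_H[of "Suc x" y] p by auto
  moreover have "T x y \<le> T (Suc x) y" using T_right(1)[of x y] p by simp
  ultimately show ?thesis using assms(7) unfolding xy x_def[symmetric] y_def[symmetric] by simp
qed

lemma cube_down_j:
  assumes "1 \<le> i" "i \<le> a" "1 \<le> j" "Suc j \<le> b" "1 \<le> l" "l \<le> c"
    and "int i \<le> T (px i (Suc j) l) (py i (Suc j) l)"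
  shows "int i \<le> T (px i j l) (py i j l)"
proof -
  define x where "x = px i j l"
  define y where "y = py i j l"
  have p: "even (x + y + a)" "x \<le> n" "y \<le> n" "x < y + a"
    using uv_pxy[of i j l] assms unfolding x_def y_def by auto
  have p': "px i (Suc j) l \<le> n" "py i (Suc j) l \<le> n" using uv_pxy[of i "Suc j" l] assms by auto
  show ?thesis
  proof (cases "l \<le> j")
    case True
    then have xy: "px i (Suc j) l = Suc x" "py i (Suc j) l = Suc y" using assms by (auto simp: px_def py_def x_def y_def)
    have "a + 2 * c \<le> x + y" using assms True unfolding x_def y_def by (auto simp: px_def py_def)
    then have "T (Suc x) (Suc y) \<le> T x y" using p p' unfolding xy by (intro T_diag_step) auto
    then show ?thesis using assms(7) unfolding xy x_def[symmetric] y_def[symmetric] by simp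
  next
    case False
    then have xy: "px i (Suc j) l = x" "py i (Suc j) l = Suc (Suc y)"
      using assms by (auto simp: px_def py_def x_def y_def)
    have "T x (Suc (Suc y)) \<le> T x y" using T_up(1)[of x y] T_up(1)[of x "Suc y"] p p' unfolding xy by simp
    then show ?thesis using assms(7) unfolding xy x_def[symmetric] y_def[symmetric] by simp
  qed
qed

lemma cube_down_i:
  assumes "1 \<le> i" "Suc i \<le> a" "1 \<le> j" "j \<le> b" "1 \<le> l" "l \<le> c"
    and "int (Suc i) \<le> T (px (Suc i) j l) (py (Suc i) j l)"
  shows "int i \<le> T (px i j l) (py i j l)"
proof -
  define x where "x = px i j l"
  define y where "y = py (Suc i) j l"
  have xy: "px (Suc i) j l = Suc x" "py i j l = Suc y" using assms by (auto simp: px_def py_def x_def y_def)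
  have p: "even (x + Suc y + a)" "x < n" "y < n" "Suc x < y + a"
    using uv_pxy[of i j l] uv_pxy[of "Suc i" j l] assms unfolding xy x_def[symmetric] y_def[symmetric] by auto
  then have "T (Suc x) y \<le> T x (Suc y) + 1" by (intro T_antidiag_step) auto
  then show ?thesis using assms(7) unfolding xy x_def[symmetric] y_def[symmetric] by simp
qed

lemma pp_of_in: "pp_of T \<in> plane_partitions a b c"
proof -
  have le: "pp_of T i j \<le> c" for i j
  proof -
    have "card {l \<in> {1..c}. int i \<le> T (px i j l) (py i j l)} \<le> card {1..c}" by (rule card_mono) auto
    then show ?thesis by (simp add: pp_of_def)
  qed
  have j: "pp_of T i (Suc j) \<le> pp_of T i j" if "i \<in> {1..a}" "1 \<le> j" "Suc j \<le> b" for i j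
  proof -
    have "{l \<in> {1..c}. int i \<le> T (px i (Suc j) l) (py i (Suc j) l)} \<subseteq> {l \<in> {1..c}. int i \<le> T (px i j l) (py i j l)}"
      using cube_down_j[of i j] that by auto
    then show ?thesis using that by (auto simp: pp_of_def intro!: card_mono)
  qed
  have i: "pp_of T (Suc i) j \<le> pp_of T i j" if "j \<in> {1..b}" "1 \<le> i" "Suc i \<le> a" for i j
  proof -
    have "{l \<in> {1..c}. int (Suc i) \<le> T (px (Suc i) j l) (py (Suc i) j l)} \<subseteq> {l \<in> {1..c}. int i \<le> T (px i j l) (py i j l)}"
      using cube_down_i[of i j] that by auto
    then show ?thesis using that by (auto simp: pp_of_def intro!: card_mono)
  qed
  have jj: "pp_of T i j' \<le> pp_of T i j" if "j \<le> j'" "i \<in> {1..a}" "1 \<le> j" "j' \<le> b" for i j j'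
    using that
  proof (induction j' rule: dec_induct)
    case (step m) then show ?case using j[of i m] by simp
  qed simp
  have ii: "pp_of T i' j \<le> pp_of T i j" if "i \<le> i'" "j \<in> {1..b}" "1 \<le> i" "i' \<le> a" for i i' j
    using that
  proof (induction i' rule: dec_induct)
    case (step m) then show ?case using i[of j m] by simp
  qed simp
  have z: "pp_of T i j = 0" if "i \<notin> {1..a} \<or> j \<notin> {1..b}" for i j using that by (auto simp: pp_of_def)
  show ?thesis unfolding plane_partitions_def mem_Collect_eq using le jj ii z by auto
qed

text \<open>
The heights agree with the depths of the plane partition read off from them. For a cube inside the
box this is the definition of \<open>pp_of\<close>. A line position beyond the box must be empty and one below it
filled: there the height is compared with a boundary value, either directly or by walking along a
diagonal or antidiagonal until the perimeter or the determined corner region is reached.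
\<close>
lemma T_level:
  assumes e: "even (x + y + a)" and xy: "x \<le> y + a" "x \<le> n" "y \<le> n" and k: "1 \<le> k" "k \<le> a"
  shows "int k \<le> T x y \<longleftrightarrow> solid (pp_of T) k (uu x y + int k - int a) (vv x y + int k - int a)"
proof -
  define j where "j = uu x y + int k - int a"
  define l where "l = vv x y + int k - int a"
  obtain q where q: "y + a = x + 2 * q"
  proof -
    have "even (y + a - x)" using e xy by presburger
    then obtain r where "y + a - x = 2 * r" by (elim evenE)
    then show ?thesis using that[of r] xy(1) by linarith
  qed
  have uv: "uu x y = (if a + 2 * c \<le> x + y then int y - int c else int q)"
    "vv x y = (if a + 2 * c \<le> x + y then int q else int a + int c - int x)"
  proof -
    have d: "int a - int x + int y = 2 * int q" using q by linarith
    show "uu x y = (if a + 2 * c \<le> x + y then int y - int c else int q)"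
      "vv x y = (if a + 2 * c \<le> x + y then int q else int a + int c - int x)"
      unfolding uu_def vv_def d by auto
  qed
  consider (ob) "int b < j" | (oc) "j \<le> int b" "int c < l"
    | (in0) "j \<le> int b" "l \<le> int c" "j \<le> 0 \<or> l \<le> 0" | (in1) "1 \<le> j" "j \<le> int b" "1 \<le> l" "l \<le> int c"
    by linarith
  then have "int k \<le> T x y \<longleftrightarrow> solid (pp_of T) k j l"
  proof cases
    case ob
    have "T x y < int k"
    proof (cases "a + 2 * c \<le> x + y")
      case True then show ?thesis using ob T_le_y[of x y] xy n uv by (simp add: j_def)
    next
      case False
      then have "int q < int a + int c - int x" using q by linarith
      moreover have "int b < int q + int k - int a" using False ob uv by (simp add: j_def)
      ultimately have "int x < int k" using cb by linarith
      then show ?thesis using T_le_x[of x y] xy by simp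
    qed
    then show ?thesis using ob by (simp add: solid_def)
  next
    case oc
    have "T x y < int k"
    proof (cases "a + 2 * c \<le> x + y")
      case False then show ?thesis using oc T_le_x[of x y] xy uv by (simp add: l_def)
    next
      case True
      obtain s where s: "x + y = a + 2 * c + 2 * s"
      proof -
        have "even (x + y - (a + 2 * c))" using e True by presburger
        then obtain r where "x + y - (a + 2 * c) = 2 * r" by (elim evenE)
        then show ?thesis using that[of r] True by linarith
      qed
      define t where "t = min s x"
      have t: "t \<le> x" "t \<le> s" "t \<le> y" using s q xy by (auto simp: t_def)
      obtain x' y' where x': "x = x' + t" and y': "y = y' + t" using t by (metis le_add_diff_inverse2)
      have "T (x' + t) (y' + t) \<le> T x' y'"
        by (rule T_diag) (use e s t xy x' y' in auto)
      then have "T x y \<le> T (x - t) (y - t)" unfolding x' y' by simp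
      also have "\<dots> \<le> int (x - t)" by (rule T_le_x) (use xy in auto)
      also have "\<dots> < int k"
      proof (cases "s \<le> x")
        case False then show ?thesis using k by (simp add: t_def)
      next
        case st: True
        have "int q + int k - int a > int c" using oc True uv by (simp add: l_def)
        moreover have "int (x - t) = int x - int s" using st by (simp add: t_def of_nat_diff)
        moreover have "int x - int s = int a + int c - int q" using s q by linarith
        ultimately show ?thesis by linarith
      qed
      finally show ?thesis .
    qed
    then show ?thesis using oc by (simp add: solid_def)
  next
    case in0
    have "int k \<le> T x y"
    proof (cases "a + 2 * c \<le> x + y")
      case True
      have "int q + int k \<le> int a" using in0 uv True q by (auto simp: l_def j_def)
      define t where "t = min q (n - x)"
      have t: "t \<le> q" "t \<le> n - x" "t \<le> y" using q xy True by (auto simp: t_def)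
      obtain y' where y': "y = y' + t" using t by (metis le_add_diff_inverse2)
      have "T (x + t) y' \<le> T x (y' + t) + int t"
        by (rule T_antidiag) (use e q t xy y' in auto)
      then have le: "T (x + t) (y - t) \<le> T x y + int t" unfolding y' by simp
      show ?thesis
      proof (cases "q \<le> n - x")
        case qn: True
        have "T (x + q) (y - q) = int (x + q) - int (y - q)" by (rule T_S) (use q qn xy True in auto)
        moreover have "int (x + q) - int (y - q) = int a" using q True by (simp add: of_nat_diff)
        ultimately show ?thesis using le \<open>int q + int k \<le> int a\<close> qn by (simp add: t_def)
      next
        case False
        then have t: "t = n - x" by (simp add: t_def)
        have ty: "t \<le> y" using False q True t by linarith
        have "T (x + t) (y - t) = int n - int (y - t)" using T_bd(4)[of "y - t"] t xy by simp
        then have "int n - int y \<le> T x y" using le ty by (simp add: of_nat_diff)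
        moreover have "int k \<le> int n - int y" using in0 uv True n by (simp add: j_def)
        ultimately show ?thesis by simp
      qed
    next
      case False
      have qa: "int q + int k \<le> int a" using in0 uv False q by (auto simp: l_def j_def)
      have xn: "x + q \<le> n" using q False n by linarith
      define t where "t = min q y"
      have t: "t \<le> q" "t \<le> y" by (auto simp: t_def)
      obtain y' where y': "y = y' + t" using t by (metis le_add_diff_inverse2)
      have "T (x + t) y' \<le> T x (y' + t) + int t"
        by (rule T_antidiag) (use e q t xy xn y' in auto)
      then have le: "T (x + t) (y - t) \<le> T x y + int t" unfolding y' by simp
      show ?thesis
      proof (cases "q \<le> y")
        case qn: True
        have "T (x + q) (y - q) = int (x + q) - int (y - q)" by (rule T_S) (use q qn xn in auto)
        moreover have "int (x + q) - int (y - q) = int a" using q qn by (simp add: of_nat_diff)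
        ultimately show ?thesis using le qa qn by (simp add: t_def)
      next
        case nq: False
        then have "T (x + y) 0 \<le> T x y + int y" using le by (simp add: t_def)
        moreover have "T (x + y) 0 = int (x + y)" using T_bd(3)[of "x + y"] nq xn by simp
        moreover have "int k \<le> int x" using in0 uv False by (simp add: l_def)
        ultimately show ?thesis by simp
      qed
    qed
    then show ?thesis using in0 unfolding solid_def by blast
  next
    case in1
    define j' where "j' = nat j"
    define l' where "l' = nat l"
    have jl: "j = int j'" "l = int l'" "1 \<le> j'" "j' \<le> b" "1 \<le> l'" "l' \<le> c"
      using in1 by (auto simp: j'_def l'_def)
    have P: "px k j' l' = x \<and> py k j' l' = y"
    proof (cases "a + 2 * c \<le> x + y")
      case True
      then have j: "int j' = int y - int c + int k - int a" "int l' = int q + int k - int a"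
        using jl uv by (simp_all add: j_def l_def)
      then have "l' \<le> j'" using True q by linarith
      then have "int (px k j' l') = int c + int k + int j' - 2 * int l'" "int (py k j' l') = int a + int c + int j' - int k"
        using jl k by (auto simp: px_def py_def of_nat_diff)
      then show ?thesis using j q by linarith
    next
      case False
      then have j: "int j' = int q + int k - int a" "int l' = int a + int c - int x + int k - int a"
        using jl uv by (simp_all add: j_def l_def)
      then have "\<not> l' \<le> j'" using False q by linarith
      then have "int (px k j' l') = int c + int k - int l'" "int (py k j' l') = int a + int c + 2 * int j' - int k - int l'"
        using jl k by (auto simp: px_def py_def of_nat_diff)
      then show ?thesis using j q by linarith
    qed
    have "l' \<le> card {l \<in> {1..c}. int k \<le> T (px k j' l) (py k j' l)} \<longleftrightarrow> int k \<le> T (px k j' l') (py k j' l')"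
      by (rule down_card) (use cube_down_l[of k j'] jl k in auto)
    then have "int k \<le> T x y \<longleftrightarrow> l' \<le> pp_of T k j'" using P jl k by (simp add: pp_of_def)
    then show ?thesis using in1 jl by (simp add: solid_def)
  qed
  then show ?thesis by (simp add: j_def l_def)
qed

lemma csum_of_pp_of:
  assumes "x \<le> n" "y \<le> n"
  shows "csum_of (pp_of T) x y = T x y"
proof -
  note p = pp_of_in
  have ev: "csum_of (pp_of T) x y = T x y" if "even (x + y + a)" "x \<le> y + a" "x \<le> n" "y \<le> n" for x y
  proof -
    have "depth (pp_of T) (uu x y) (vv x y) = T x y"
      by (rule depth_eqI[OF p]) (use that T_nonneg T_le_a T_level in auto)
    then show ?thesis using csum_of_eq[OF p] that by simp
  qed
  consider "y + a \<le> x" | "x < y + a" "even (x + y + a)" | "x < y + a" "odd (x + y + a)" by linarith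
  then show ?thesis
  proof cases
    case 1 then show ?thesis using T_S[of y x] assms by (simp add: csum_of_def)
  next
    case 2 then show ?thesis using ev assms by simp
  next
    case 3
    note o = csum_of_frozen[OF p, unfolded frozen_def]
    consider "x = n" | "x < n" "a + 2 * c < x + y" | "x + y < a + 2 * c"
    proof -
      have "x + y \<noteq> a + 2 * c" using 3 by presburger
      then show ?thesis using that assms by linarith
    qed
    then show ?thesis
    proof cases
      case 1 then show ?thesis using csum_of_right[OF p] T_bd(4) assms by simp
    next
      case 2
      then have "T (Suc x) y = T x y" using T_V[of x y] 3 assms by simp
      moreover have "csum_of (pp_of T) (Suc x) y = csum_of (pp_of T) x y" using o 2 3 assms by blast
      moreover have "csum_of (pp_of T) (Suc x) y = T (Suc x) y" by (rule ev) (use 2 3 assms in auto)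
      ultimately show ?thesis by simp
    next
      case c3: 3
      have yn: "y < n" using c3 n cb pos by linarith
      then have "T x (Suc y) = T x y" using T_H[of x y] 3 c3 assms by simp
      moreover have "csum_of (pp_of T) x (Suc y) = csum_of (pp_of T) x y" using o c3 3 assms yn by blast
      moreover have "csum_of (pp_of T) x (Suc y) = T x (Suc y)" by (rule ev) (use c3 3 assms yn in auto)
      ultimately show ?thesis by simp
    qed
  qed
qed

end

end

section \<open>Corner sums of fully packed loops\<close>

context box
begin

text \<open>
The choice of external edges that leaves \<open>A\<close>, \<open>B\<close>, \<open>C\<close> unoccupied.
\<close>
definition occ :: "nat set" where "occ = {k. k < 4 * n \<and> odd (k + b + c)}"

lemma occ_iff: "k < 4 * n \<Longrightarrow> k \<in> occ \<longleftrightarrow> odd (k + b + c)"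
  unfolding occ_def by blast

lemma occ_sub: "occ \<subseteq> {..<4 * n}" by (auto simp: occ_def)

text \<open>
Along a row, edges of one parity are counted when occupied and those of the other parity when
unoccupied. With this alternation a vertex of degree 2 becomes a conservation law.
\<close>
definition csum :: "point set set \<Rightarrow> nat \<Rightarrow> nat \<Rightarrow> int" where
  "csum F i j = (\<Sum>x\<in>{1..i}. of_bool (even (x + j + a) \<longleftrightarrow> vt x j \<notin> F))"

lemma csum_0 [simp]: "csum F 0 j = 0" by (simp add: csum_def)
lemma csum_Suc: "csum F (Suc i) j = csum F i j + of_bool (even (Suc i + j + a) \<longleftrightarrow> vt (Suc i) j \<notin> F)"
  by (simp add: csum_def del: even_add even_Suc)

lemma occ_parity:
  shows "1 \<le> x \<Longrightarrow> odd (x - 1 + b + c) \<longleftrightarrow> even (x + n + a)"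
    and "y \<le> n \<Longrightarrow> odd (2 * n - y + b + c) \<longleftrightarrow> odd (n + y + a)"
    and "x \<le> n \<Longrightarrow> odd (3 * n - x + b + c) \<longleftrightarrow> odd (x + a)"
    and "1 \<le> y \<Longrightarrow> odd (3 * n + y - 1 + b + c) \<longleftrightarrow> even (y + a)"
proof -
  have en: "even n \<longleftrightarrow> (even a \<longleftrightarrow> (even b \<longleftrightarrow> even c))" using n by auto
  show "odd (x - 1 + b + c) \<longleftrightarrow> even (x + n + a)" if "1 \<le> x"
    using that en by (cases x) auto
  show "odd (2 * n - y + b + c) \<longleftrightarrow> odd (n + y + a)" if "y \<le> n"
  proof -
    have "even (2 * n - y) \<longleftrightarrow> even y" using that by simp
    then show ?thesis using en by auto
  qed
  show "odd (3 * n - x + b + c) \<longleftrightarrow> odd (x + a)" if "x \<le> n"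
  proof -
    have "even (3 * n - x) \<longleftrightarrow> (even n \<longleftrightarrow> even x)" using that by simp
    then show ?thesis using en by auto
  qed
  show "odd (3 * n + y - 1 + b + c) \<longleftrightarrow> even (y + a)" if "1 \<le> y"
    using that en by (cases y) auto
qed

lemma occ_sides:
  assumes F: "F \<in> FPL n occ"
  shows "1 \<le> x \<Longrightarrow> x \<le> n \<Longrightarrow> vt x n \<in> F \<longleftrightarrow> even (x + n + a)"
    "1 \<le> x \<Longrightarrow> x \<le> n \<Longrightarrow> vt x 0 \<in> F \<longleftrightarrow> odd (x + a)"
    "1 \<le> y \<Longrightarrow> y \<le> n \<Longrightarrow> hz 0 y \<in> F \<longleftrightarrow> even (y + a)"
    "1 \<le> y \<Longrightarrow> y \<le> n \<Longrightarrow> hz n y \<in> F \<longleftrightarrow> odd (n + y + a)"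
proof -
  note f = FPL_D(4)[OF F _ occ_sub]
  show "vt x n \<in> F \<longleftrightarrow> even (x + n + a)" if x: "1 \<le> x" "x \<le> n"
  proof -
    have "vt x n \<in> F \<longleftrightarrow> x - 1 \<in> occ" using f[of "x - 1"] ext_edge_top[OF x] x by simp
    also have "\<dots> \<longleftrightarrow> odd (x - 1 + b + c)" by (rule occ_iff) (use x in linarith)
    also have "\<dots> \<longleftrightarrow> even (x + n + a)" using x by (intro occ_parity)
    finally show ?thesis .
  qed
  show "vt x 0 \<in> F \<longleftrightarrow> odd (x + a)" if x: "1 \<le> x" "x \<le> n"
  proof -
    have "vt x 0 \<in> F \<longleftrightarrow> 3 * n - x \<in> occ" using f[of "3 * n - x"] ext_edge_bottom[OF x] x by simp
    also have "\<dots> \<longleftrightarrow> odd (3 * n - x + b + c)" by (rule occ_iff) (use x in linarith)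
    also have "\<dots> \<longleftrightarrow> odd (x + a)" using x by (intro occ_parity)
    finally show ?thesis .
  qed
  show "hz 0 y \<in> F \<longleftrightarrow> even (y + a)" if x: "1 \<le> y" "y \<le> n"
  proof -
    have "hz 0 y \<in> F \<longleftrightarrow> 3 * n + y - 1 \<in> occ" using f[of "3 * n + y - 1"] ext_edge_left[OF x] x by simp
    also have "\<dots> \<longleftrightarrow> odd (3 * n + y - 1 + b + c)" by (rule occ_iff) (use x in linarith)
    also have "\<dots> \<longleftrightarrow> even (y + a)" using x by (intro occ_parity)
    finally show ?thesis .
  qed
  show "hz n y \<in> F \<longleftrightarrow> odd (n + y + a)" if x: "1 \<le> y" "y \<le> n"
  proof -
    have "hz n y \<in> F \<longleftrightarrow> 2 * n - y \<in> occ" using f[of "2 * n - y"] ext_edge_right[OF x] x by simp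
    also have "\<dots> \<longleftrightarrow> odd (2 * n - y + b + c)" by (rule occ_iff) (use x in linarith)
    also have "\<dots> \<longleftrightarrow> odd (n + y + a)" using x by (intro occ_parity)
    finally show ?thesis .
  qed
qed

text \<open>
The height is defined by crossing vertical edges only; degree 2 at the vertices makes the
corresponding rule for horizontal edges follow by induction along the row.
\<close>
lemma csum_down:
  assumes F: "F \<in> FPL n occ" and "i \<le> n" "j < n"
  shows "csum F i j = csum F i (Suc j) + of_bool (even (i + Suc j + a) \<longleftrightarrow> hz i (Suc j) \<notin> F)"
  using assms(2)
proof (induction i)
  case 0
  have "hz 0 (Suc j) \<in> F \<longleftrightarrow> even (Suc j + a)" using occ_sides(3)[OF F, of "Suc j"] assms(3) by simp
  then show ?case by simp
next
  case (Suc i)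
  have deg: "of_bool (vt (Suc i) (Suc j) \<in> F) + of_bool (vt (Suc i) j \<in> F) +
    of_bool (hz (Suc i) (Suc j) \<in> F) + of_bool (hz i (Suc j) \<in> F) = (2::nat)"
    using degree_eq[OF FPL_D(1)[OF F], of i j] FPL_D(2)[OF F, of "(Suc i, Suc j)"] Suc.prems assms(3)
    by (simp add: mem_verts)
  have "csum F i j = csum F i (Suc j) + of_bool (even (i + Suc j + a) \<longleftrightarrow> hz i (Suc j) \<notin> F)"
    using Suc by simp
  then show ?case using deg
    by (cases "even (i + j + a)"; cases "vt (Suc i) (Suc j) \<in> F"; cases "vt (Suc i) j \<in> F";
        cases "hz (Suc i) (Suc j) \<in> F"; cases "hz i (Suc j) \<in> F") (simp_all add: csum_Suc)
qed

lemma csum_csum_ok: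
  assumes F: "F \<in> FPL n occ"
  shows "csum_ok (csum F)"
proof -
  have t: "csum F i n = 0" if "i \<le> n" for i
    using that by (induction i) (use occ_sides(1)[OF F] in \<open>auto simp: csum_Suc\<close>)
  have bo: "csum F i 0 = int i" if "i \<le> n" for i
    using that by (induction i) (use occ_sides(2)[OF F] in \<open>auto simp: csum_Suc\<close>)
  have r: "csum F n j = int n - int j" if "j \<le> n" for j
    using that
  proof (induction j)
    case 0 then show ?case using bo by simp
  next
    case (Suc j) then show ?case using csum_down[OF F, of n j] occ_sides(4)[OF F, of "Suc j"] by auto
  qed
  show ?thesis unfolding csum_ok_def using t bo r csum_down[OF F] by (auto simp: csum_Suc)
qed

lemma vt_csum:
  "vt (Suc i) j \<in> F \<longleftrightarrow> (even (Suc i + j + a) \<longleftrightarrow> csum F (Suc i) j = csum F i j)"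
  by (auto simp: csum_Suc)

lemma hz_csum:
  assumes F: "F \<in> FPL n occ" and "i \<le> n" "j < n"
  shows "hz i (Suc j) \<in> F \<longleftrightarrow> (even (i + Suc j + a) \<longleftrightarrow> csum F i (Suc j) = csum F i j)"
  using csum_down[OF assms] by auto

lemma csum_inj:
  assumes F: "F \<in> FPL n occ" and F': "F' \<in> FPL n occ"
    and eq: "\<And>i j. i \<le> n \<Longrightarrow> j \<le> n \<Longrightarrow> csum F i j = csum F' i j"
  shows "F = F'"
proof -
  have "e \<in> F \<longleftrightarrow> e \<in> F'" if "e \<in> edges n" for e
    using that
  proof (cases rule: edges_cases)
    case (vt x y)
    then obtain i where "x = Suc i" by (cases x) auto
    then show ?thesis using vt eq[of i y] eq[of x y] by (simp add: vt_csum)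
  next
    case (hz x y)
    then obtain j where "y = Suc j" by (cases y) auto
    then show ?thesis using hz eq[of x j] eq[of x y] hz_csum[OF F, of x j] hz_csum[OF F', of x j] by simp
  qed
  then show ?thesis using FPL_D(1)[OF F] FPL_D(1)[OF F'] by blast
qed

definition edges_of :: "(nat \<Rightarrow> nat \<Rightarrow> int) \<Rightarrow> point set set" where
  "edges_of T = {vt x y | x y. 1 \<le> x \<and> x \<le> n \<and> y \<le> n \<and> (even (x + y + a) \<longleftrightarrow> T x y = T (x - 1) y)} \<union>
    {hz x y | x y. x \<le> n \<and> 1 \<le> y \<and> y \<le> n \<and> (even (x + y + a) \<longleftrightarrow> T x y = T x (y - 1))}"

lemma vt_edges_of: "vt x y \<in> edges_of T \<longleftrightarrow> 1 \<le> x \<and> x \<le> n \<and> y \<le> n \<and> (even (x + y + a) \<longleftrightarrow> T x y = T (x - 1) y)"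
  by (auto simp: edges_of_def)
lemma hz_edges_of: "hz x y \<in> edges_of T \<longleftrightarrow> x \<le> n \<and> 1 \<le> y \<and> y \<le> n \<and> (even (x + y + a) \<longleftrightarrow> T x y = T x (y - 1))"
  by (auto simp: edges_of_def)

lemma edges_of_FPL:
  assumes ok: "csum_ok T" shows "edges_of T \<in> FPL n occ"
proof -
  have R: "T i j \<le> T (Suc i) j" "T (Suc i) j \<le> T i j + 1" if "i < n" "j \<le> n" for i j
    using ok that unfolding csum_ok_def by blast+
  have D: "T i (Suc j) \<le> T i j" "T i j \<le> T i (Suc j) + 1" if "i \<le> n" "j < n" for i j
    using ok that unfolding csum_ok_def by blast+
  have B: "T 0 j = 0" "T j n = 0" "T j 0 = int j" "T n j = int n - int j" if "j \<le> n" for j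
    using ok that unfolding csum_ok_def by blast+
  have sub: "edges_of T \<subseteq> edges n" by (auto simp: edges_of_def)
  have deg: "card {e \<in> edges_of T. v \<in> e} = 2" if v: "v \<in> verts n" for v
  proof -
    obtain i j where ij: "v = (Suc i, Suc j)" "i < n" "j < n"
    proof -
      obtain x y where xy: "v = (x, y)" by (cases v)
      then have "1 \<le> x" "x \<le> n" "1 \<le> y" "y \<le> n" using v by (simp_all add: mem_verts)
      then show ?thesis using that[of "x - 1" "y - 1"] xy by auto
    qed
    define p q r s where d: "p = T i j" "q = T (Suc i) j" "r = T i (Suc j)" "s = T (Suc i) (Suc j)"
    have c: "p \<le> q" "q \<le> p + 1" "r \<le> s" "s \<le> r + 1" "r \<le> p" "p \<le> r + 1" "s \<le> q" "q \<le> s + 1"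
      using R[of i j] R[of i "Suc j"] D[of i j] D[of "Suc i" j] ij by (auto simp: d)
    have "card {e \<in> edges_of T. v \<in> e} =
      of_bool (even (Suc i + Suc j + a) \<longleftrightarrow> s = r) + of_bool (even (Suc i + j + a) \<longleftrightarrow> q = p) +
      of_bool (even (Suc i + Suc j + a) \<longleftrightarrow> s = q) + of_bool (even (i + Suc j + a) \<longleftrightarrow> r = p)"
      unfolding ij(1) degree_eq[OF sub] using ij by (simp add: vt_edges_of hz_edges_of d)
    also have "\<dots> = 2" using c by (cases "even (i + j + a)") (auto simp: of_bool_def)
    finally show ?thesis .
  qed
  have ext: "ext_edge n k \<in> edges_of T \<longleftrightarrow> k \<in> occ" if k: "k < 4 * n" for k
    using k
  proof (cases rule: index_cases)
    case (top x)
    have "ext_edge n k = vt x n" using top ext_edge_top by simp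
    then have "ext_edge n k \<in> edges_of T \<longleftrightarrow> even (x + n + a)" using top B(2)[of x] B(2)[of "x - 1"] by (simp add: vt_edges_of)
    also have "\<dots> \<longleftrightarrow> odd (x - 1 + b + c)" using top by (intro occ_parity[symmetric])
    finally show ?thesis using occ_iff[OF k] unfolding top(3) by blast
  next
    case (right y)
    have "ext_edge n k = hz n y" using right ext_edge_right by simp
    then have "ext_edge n k \<in> edges_of T \<longleftrightarrow> odd (n + y + a)"
      using right B(4)[of y] B(4)[of "y - 1"] by (simp add: hz_edges_of of_nat_diff)
    also have "\<dots> \<longleftrightarrow> odd (2 * n - y + b + c)" using right by (intro occ_parity[symmetric])
    finally show ?thesis using occ_iff[OF k] unfolding right(3) by blast
  next
    case (bottom x)
    have "ext_edge n k = vt x 0" using bottom ext_edge_bottom by simp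
    then have "ext_edge n k \<in> edges_of T \<longleftrightarrow> odd (x + a)"
      using bottom B(3)[of x] B(3)[of "x - 1"] by (simp add: vt_edges_of of_nat_diff)
    also have "\<dots> \<longleftrightarrow> odd (3 * n - x + b + c)" using bottom by (intro occ_parity[symmetric])
    finally show ?thesis using occ_iff[OF k] unfolding bottom(3) by blast
  next
    case (left y)
    have "ext_edge n k = hz 0 y" using left ext_edge_left by simp
    then have "ext_edge n k \<in> edges_of T \<longleftrightarrow> even (y + a)"
      using left B(1)[of y] B(1)[of "y - 1"] by (simp add: hz_edges_of)
    also have "\<dots> \<longleftrightarrow> odd (3 * n + y - 1 + b + c)" using left by (intro occ_parity[symmetric])
    finally show ?thesis using occ_iff[OF k] unfolding left(3) by blast
  qed
  have "edges_of T \<inter> external_edges n = ext_edge n ` occ"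
    unfolding external_edges_eq using ext occ_sub by auto
  then show ?thesis using sub deg by (simp add: FPL_def)
qed

lemma csum_edges_of:
  assumes ok: "csum_ok T" and "i \<le> n" "j \<le> n"
  shows "csum (edges_of T) i j = T i j"
  using assms(2)
proof (induction i)
  case 0 then show ?case using ok assms(3) by (simp add: csum_ok_def)
next
  case (Suc i)
  have "T i j \<le> T (Suc i) j" "T (Suc i) j \<le> T i j + 1" using ok Suc.prems assms(3) unfolding csum_ok_def by simp_all
  then show ?case using Suc assms(3) by (auto simp: csum_Suc vt_edges_of of_bool_def)
qed

lemma frozen_cong:
  assumes "\<And>i j. i \<le> n \<Longrightarrow> j \<le> n \<Longrightarrow> T i j = T' i j" "frozen T" shows "frozen T'"
  unfolding frozen_def
proof (intro conjI allI impI)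
  fix i j
  assume "odd (i + j + a) \<and> i < j + a \<and> a + 2 * c < i + j \<and> i < n \<and> j \<le> n"
  then show "T' (Suc i) j = T' i j" using assms(1)[of i j] assms(1)[of "Suc i" j] assms(2) unfolding frozen_def by simp
next
  fix i j
  assume "odd (i + j + a) \<and> i < j + a \<and> i + j < a + 2 * c \<and> i \<le> n \<and> j < n"
  then show "T' i (Suc j) = T' i j" using assms(1)[of i j] assms(1)[of i "Suc j"] assms(2) unfolding frozen_def by simp
next
  fix i j
  assume "j + a \<le> i \<and> i \<le> n"
  then show "T' i j = int i - int j" using assms(1)[of i j] assms(2) unfolding frozen_def by simp
qed

text \<open>
Injectivity uses that the heights determine the configuration and are recovered from the plane
partition; surjectivity that every frozen height function comes from a configuration.
\<close>
theorem frozen_FPL_bij: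
  "bij_betw (\<lambda>F. pp_of (csum F)) {F \<in> FPL n occ. frozen (csum F)} (plane_partitions a b c)"
proof (rule bij_betw_imageI)
  show "inj_on (\<lambda>F. pp_of (csum F)) {F \<in> FPL n occ. frozen (csum F)}"
  proof (rule inj_onI)
    fix F F' assume F: "F \<in> {F \<in> FPL n occ. frozen (csum F)}" and F': "F' \<in> {F \<in> FPL n occ. frozen (csum F)}"
      and eq: "pp_of (csum F) = pp_of (csum F')"
    show "F = F'"
    proof (rule csum_inj)
      fix i j assume ij: "i \<le> n" "j \<le> n"
      have "csum F i j = csum_of (pp_of (csum F)) i j"
        using csum_of_pp_of[OF csum_csum_ok _ ij, of F] F by simp
      moreover have "csum F' i j = csum_of (pp_of (csum F')) i j"
        using csum_of_pp_of[OF csum_csum_ok _ ij, of F'] F' by simp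
      ultimately show "csum F i j = csum F' i j" using eq by simp
    qed (use F F' in auto)
  qed
  show "(\<lambda>F. pp_of (csum F)) ` {F \<in> FPL n occ. frozen (csum F)} = plane_partitions a b c"
  proof
    show "(\<lambda>F. pp_of (csum F)) ` {F \<in> FPL n occ. frozen (csum F)} \<subseteq> plane_partitions a b c"
      using pp_of_in csum_csum_ok by auto
    show "plane_partitions a b c \<subseteq> (\<lambda>F. pp_of (csum F)) ` {F \<in> FPL n occ. frozen (csum F)}"
    proof
      fix \<pi> assume p: "\<pi> \<in> plane_partitions a b c"
      define F where "F = edges_of (csum_of \<pi>)"
      have F: "F \<in> FPL n occ" unfolding F_def by (rule edges_of_FPL[OF csum_of_ok[OF p]])
      have eq: "csum F i j = csum_of \<pi> i j" if "i \<le> n" "j \<le> n" for i j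
        unfolding F_def by (rule csum_edges_of[OF csum_of_ok[OF p] that])
      have fr: "frozen (csum F)" by (rule frozen_cong[OF _ csum_of_frozen[OF p]]) (simp add: eq)
      have "pp_of (csum F) i j = pp_of (csum_of \<pi>) i j" for i j
        using uv_pxy[of i j] eq by (auto simp: pp_of_def intro!: arg_cong[of _ _ card])
      then have "pp_of (csum F) = \<pi>" using pp_of_csum_of[OF p] by auto
      then show "\<pi> \<in> (\<lambda>F. pp_of (csum F)) ` {F \<in> FPL n occ. frozen (csum F)}" using F fr by auto
    qed
  qed
qed

end

section \<open>Nested arches force edges\<close>

text \<open>
The counting argument in coordinates, for a region \<open>Q\<close> and a matching given separately on the two
coordinates. \<open>Z\<close> is an arc of the perimeter that contains all occupied external edges of the region
and of which no two are linked.
\<close>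
lemma frozen_edge_xy:
  assumes F: "F \<in> FPL n Occ" and O: "Occ \<subseteq> {..<4 * n}"
    and Q: "\<And>x y. Q x y \<Longrightarrow> 1 \<le> x \<and> x \<le> n \<and> 1 \<le> y \<and> y \<le> n"
    and mu: "\<And>x y. Q x y \<Longrightarrow> odd (x + y + e) \<Longrightarrow> Q (mx x) (my y) \<and> even (mx x + my y + e)"
    and inj: "\<And>x y x' y'. Q x y \<Longrightarrow> Q x' y' \<Longrightarrow> mx x = mx x' \<Longrightarrow> my y = my y' \<Longrightarrow> x = x' \<and> y = y'"
    and unmatched: "\<And>x y. Q x y \<Longrightarrow> even (x + y + e) \<Longrightarrow>
      (\<And>x' y'. Q x' y' \<Longrightarrow> odd (x' + y' + e) \<Longrightarrow> \<not> (x = mx x' \<and> y = my y')) \<Longrightarrow> \<exists>k\<in>Occ. inn n k = (x, y)"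
    and nb: "\<And>x y. Q x y \<Longrightarrow> odd (x + y + e) \<Longrightarrow>
      (x < n \<longrightarrow> Q (Suc x) y) \<and> (y < n \<longrightarrow> Q x (Suc y)) \<and> (1 < x \<longrightarrow> Q (x - 1) y) \<and> (1 < y \<longrightarrow> Q x (y - 1))"
    and w: "Q wx wy" "odd (wx + wy + e)"
    and an: "\<And>x y. Q x y \<Longrightarrow> adjacent (mx wx, my wy) (x, y) \<Longrightarrow> x = wx \<and> y = wy"
    and Z: "\<And>k x y. k \<in> Occ \<Longrightarrow> inn n k = (x, y) \<Longrightarrow> Q x y \<Longrightarrow> Z k"
    and U: "\<And>k l. k \<in> Occ \<Longrightarrow> l \<in> Occ \<Longrightarrow> Z k \<Longrightarrow> Z l \<Longrightarrow> k \<noteq> l \<Longrightarrow> \<not> conn F (inn n k) (inn n l)"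
  shows "{(wx, wy), (mx wx, my wy)} \<in> F"
proof -
  define S where "S = {(x, y). Q x y}"
  define P where "P = (\<lambda>(x, y). even (x + y + e))"
  define \<mu> where "\<mu> = (\<lambda>(x, y). (mx x, my y))"
  have Sm: "(x, y) \<in> S \<longleftrightarrow> Q x y" for x y by (simp add: S_def)
  have Pm: "P (x, y) \<longleftrightarrow> even (x + y + e)" for x y by (simp add: P_def)
  have Mm: "\<mu> (x, y) = (mx x, my y)" for x y by (simp add: \<mu>_def)
  have adj: "(x = x' \<and> (y' = Suc y \<or> y = Suc y')) \<or> (y = y' \<and> (x' = Suc x \<or> x = Suc x'))"
    if "{(x, y), (x', y')} \<in> F" for x y x' y'
    using adjacent_verts[of x y x' y' n] that FPL_D(1)[OF F] by blast
  have near: "Q x' y'" if "Q x y" "odd (x + y + e)" "{(x, y), (x', y')} \<in> F" "(x', y') \<in> verts n" for x y x' y'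
  proof -
    have v: "1 \<le> x'" "x' \<le> n" "1 \<le> y'" "y' \<le> n" using that(4) by (simp_all add: mem_verts)
    from adj[OF that(3)] show ?thesis
    proof (elim disjE conjE)
      assume "x = x'" "y' = Suc y" then show ?thesis using nb[OF that(1,2)] v by simp
    next
      assume "x = x'" "y = Suc y'" then show ?thesis using nb[OF that(1,2)] v by simp
    next
      assume "y = y'" "x' = Suc x" then show ?thesis using nb[OF that(1,2)] v by simp
    next
      assume "y = y'" "x = Suc x'" then show ?thesis using nb[OF that(1,2)] v by simp
    qed
  qed
  have "{(wx, wy), \<mu> (wx, wy)} \<in> F"
  proof (rule frozen_edge[OF F O, of S P \<mu> "(wx, wy)"])
    show "S \<subseteq> verts n"
    proof
      fix v assume "v \<in> S" then show "v \<in> verts n" using Q by (cases v) (simp add: Sm mem_verts)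
    qed
  next
    fix u v assume uv: "{u, v} \<in> F"
    obtain x y x' y' where "u = (x, y)" "v = (x', y')" by (metis surj_pair)
    then show "P u \<noteq> P v" using adj[of x y x' y'] uv by (auto simp: Pm)
  next
    fix v assume "v \<in> S" "\<not> P v"
    then show "\<mu> v \<in> S \<and> P (\<mu> v)" using mu by (cases v) (simp add: Sm Pm Mm)
  next
    fix v assume v: "v \<in> S" "P v" "v \<notin> \<mu> ` {v \<in> S. \<not> P v}"
    obtain x y where xy: "v = (x, y)" by (cases v)
    have "\<not> (x = mx x' \<and> y = my y')" if "Q x' y'" "odd (x' + y' + e)" for x' y'
    proof
      assume "x = mx x' \<and> y = my y'"
      then have "v = \<mu> (x', y')" using xy by (simp add: Mm)
      moreover have "(x', y') \<in> {v \<in> S. \<not> P v}" using that by (simp add: Sm Pm)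
      ultimately show False using v(3) by blast
    qed
    then show "\<exists>k\<in>Occ. inn n k = v" using unmatched[of x y] v xy by (simp add: Sm Pm)
  next
    fix u v assume uv: "u \<in> S" "v \<in> verts n - S" "{u, v} \<in> F"
    obtain x y x' y' where xy: "u = (x, y)" "v = (x', y')" by (metis surj_pair)
    show "P u"
    proof (rule ccontr)
      assume "\<not> P u"
      then have "Q x' y'" using near[of x y x' y'] uv xy by (simp add: Sm Pm)
      then show False using uv xy by (simp add: Sm)
    qed
  next
    fix k l assume kl: "k \<in> Occ" "l \<in> Occ" "inn n k \<in> S" "inn n l \<in> S" "k \<noteq> l"
    obtain x y x' y' where xy: "inn n k = (x, y)" "inn n l = (x', y')" by (metis surj_pair)
    have "Z k" "Z l" using Z[OF kl(1) xy(1)] Z[OF kl(2) xy(2)] kl xy by (simp_all add: Sm)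
    then show "\<not> conn F (inn n k) (inn n l)" using U kl by blast
  next
    show "(wx, wy) \<in> S" "\<not> P (wx, wy)" using w by (simp_all add: Sm Pm)
  next
    fix v assume v: "v \<in> verts n" "{(wx, wy), v} \<in> F"
    obtain x y where xy: "v = (x, y)" by (cases v)
    show "v \<in> S" using near[OF w, of x y] v xy by (simp add: Sm)
  next
    fix v assume v: "v \<in> S" "{\<mu> (wx, wy), v} \<in> F"
    obtain x y where xy: "v = (x, y)" by (cases v)
    have "adjacent (mx wx, my wy) (x, y)" using adj[of "mx wx" "my wy" x y] v xy by (auto simp: Mm)
    then show "v = (wx, wy)" using an[of x y] v xy by (simp add: Sm)
  qed
  then show ?thesis by (simp add: Mm)
qed

context box
begin

text \<open>
For \<open>c < b\<close> the arc from \<open>A\<close> to \<open>B\<close> runs past the index \<open>4 * n - 1\<close>, whence the disjunction.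
\<close>
definition arcAB :: "nat \<Rightarrow> bool" where "arcAB k \<longleftrightarrow> k < n + a \<or> 4 * n + c < k + b"
definition arcBC :: "nat \<Rightarrow> bool" where "arcBC k \<longleftrightarrow> n + a < k \<and> k + a < 3 * n"
definition arcCA :: "nat \<Rightarrow> bool" where "arcCA k \<longleftrightarrow> 3 * n < k + a \<and> k + b < 4 * n + c"

lemma inn_eq:
  assumes "k \<in> occ" "inn n k = (x, y)"
  obtains (top) "k = x - 1" "y = n" "1 \<le> x" "x \<le> n" "even (x + n + a)"
    | (right) "k = 2 * n - y" "x = n" "1 \<le> y" "y \<le> n" "odd (n + y + a)"
    | (bottom) "k = 3 * n - x" "y = 1" "1 \<le> x" "x \<le> n" "odd (x + a)"
    | (left) "k = 3 * n + y - 1" "x = 1" "1 \<le> y" "y \<le> n" "even (y + a)"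
proof -
  have k: "k < 4 * n" "odd (k + b + c)" using assms by (auto simp: occ_def)
  from k(1) show ?thesis
  proof (cases rule: index_cases)
    case (top x')
    then have "x' = x" "y = n" using assms(2) inn_top[of x' n] by auto
    moreover have "even (x' + n + a)" using top k(2) occ_parity(1)[of x'] by (simp del: even_add even_diff_nat)
    ultimately show ?thesis using that(1) top by simp
  next
    case (right y')
    then have "y' = y" "x = n" using assms(2) inn_right[of y' n] by auto
    moreover have "odd (n + y' + a)" using right k(2) occ_parity(2)[of y'] by (simp del: even_add even_diff_nat)
    ultimately show ?thesis using that(2) right by simp
  next
    case (bottom x')
    then have "x' = x" "y = 1" using assms(2) inn_bottom[of x' n] by auto
    moreover have "odd (x' + a)" using bottom k(2) occ_parity(3)[of x'] by (simp del: even_add even_diff_nat)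
    ultimately show ?thesis using that(3) bottom by simp
  next
    case (left y')
    then have "y' = y" "x = 1" using assms(2) inn_left[of y' n] by auto
    moreover have "even (y' + a)" using left k(2) occ_parity(4)[of y'] by (simp del: even_add even_diff_nat)
    ultimately show ?thesis using that(4) left by simp
  qed
qed

lemma top_occ: "1 \<le> x \<Longrightarrow> x \<le> n \<Longrightarrow> even (x + n + a) \<Longrightarrow> \<exists>k\<in>occ. inn n k = (x, n)"
proof (rule bexI[of _ "x - 1"])
  assume x: "1 \<le> x" "x \<le> n" "even (x + n + a)"
  show "inn n (x - 1) = (x, n)" using x inn_top by blast
  show "x - 1 \<in> occ" using x occ_parity(1)[of x] occ_iff[of "x - 1"] by linarith
qed

lemma bottom_occ: "1 \<le> x \<Longrightarrow> x \<le> n \<Longrightarrow> odd (x + a) \<Longrightarrow> \<exists>k\<in>occ. inn n k = (x, 1)"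
proof (rule bexI[of _ "3 * n - x"])
  assume x: "1 \<le> x" "x \<le> n" "odd (x + a)"
  show "inn n (3 * n - x) = (x, 1)" using x inn_bottom by blast
  show "3 * n - x \<in> occ" using x occ_parity(3)[of x] occ_iff[of "3 * n - x"] by linarith
qed

lemma left_occ: "1 \<le> y \<Longrightarrow> y \<le> n \<Longrightarrow> even (y + a) \<Longrightarrow> \<exists>k\<in>occ. inn n k = (1, y)"
proof (rule bexI[of _ "3 * n + y - 1"])
  assume x: "1 \<le> y" "y \<le> n" "even (y + a)"
  show "inn n (3 * n + y - 1) = (1, y)" using x inn_left by blast
  show "3 * n + y - 1 \<in> occ" using x occ_parity(4)[of y] occ_iff[of "3 * n + y - 1"] by linarith
qed

context
  fixes F :: "point set set"
  assumes F: "F \<in> FPL n occ"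
begin

text \<open>
The counting argument for the cone of vertices that opens upwards from the edge, with each vertex
matched to its lower neighbour. The cone meets the perimeter only in the arc from \<open>A\<close> to \<open>B\<close>.
The two lemmas that follow use the cones opening to the left and downwards.
\<close>
lemma vertical_frozen:
  assumes U: "\<And>k l. k \<in> occ \<Longrightarrow> l \<in> occ \<Longrightarrow> arcAB k \<Longrightarrow> arcAB l \<Longrightarrow> k \<noteq> l \<Longrightarrow> \<not> conn F (inn n k) (inn n l)"
    and ij: "odd (i + j + a)" "i < j + a" "a + 2 * c < i + j" "i < n" "j \<le> n"
  shows "vt (Suc i) j \<in> F"
proof (cases "j = n")
  case True then show ?thesis using occ_sides(1)[OF F, of "Suc i"] ij by simp
next
  case False
  then have jn: "j < n" "c < j" using ij by auto
  define Q where "Q x y \<longleftrightarrow> 1 \<le> x \<and> x \<le> n \<and> 1 \<le> y \<and> y \<le> n \<and> Suc i + j \<le> x + y \<and> x + j \<le> y + Suc i" for x y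
  have str: "Suc (Suc i + j) \<le> x + y \<and> Suc (x + j) \<le> y + Suc i" if "Q x y" "odd (x + y + a)" for x y
  proof -
    have "Suc i + j \<noteq> x + y" "x + j \<noteq> y + Suc i" using that(2) ij(1) by presburger+
    then show ?thesis using that(1) by (auto simp: Q_def)
  qed
  have "{(Suc i, Suc j), (id (Suc i), Suc j - 1)} \<in> F"
  proof (rule frozen_edge_xy[OF F occ_sub, where Q = Q and e = a and mx = id and my = "\<lambda>y. y - 1" and Z = arcAB])
    fix x y assume q: "Q x y" "odd (x + y + a)"
    show "Q (id x) (y - 1) \<and> even (id x + (y - 1) + a)" using str[OF q] q jn by (auto simp: Q_def)
    show "(x < n \<longrightarrow> Q (Suc x) y) \<and> (y < n \<longrightarrow> Q x (Suc y)) \<and> (1 < x \<longrightarrow> Q (x - 1) y) \<and> (1 < y \<longrightarrow> Q x (y - 1))"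
      using str[OF q] q(1) by (auto simp: Q_def)
  next
    fix x y assume q: "Q x y" "even (x + y + a)"
      and nm: "\<And>x' y'. Q x' y' \<Longrightarrow> odd (x' + y' + a) \<Longrightarrow> \<not> (x = id x' \<and> y = y' - 1)"
    have "y = n"
    proof (rule ccontr)
      assume "y \<noteq> n"
      then have "Q x (Suc y)" using q(1) by (auto simp: Q_def)
      then show False using nm[of x "Suc y"] q(2) by simp
    qed
    then show "\<exists>k\<in>occ. inn n k = (x, y)" using top_occ[of x] q by (simp add: Q_def)
  next
    fix x y assume "Q x y" "adjacent (id (Suc i), Suc j - 1) (x, y)"
    then show "x = Suc i \<and> y = Suc j" by (auto simp: Q_def)
  next
    fix k x y assume k: "k \<in> occ" "inn n k = (x, y)" and q: "Q x y"
    have par: "odd (k + b + c)" using k by (simp add: occ_def)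
    from k show "arcAB k"
    proof (cases rule: inn_eq)
      case top then show ?thesis using pos unfolding arcAB_def by linarith
    next
      case right
      then have "k \<le> n + a" using q ij by (auto simp: Q_def)
      moreover have "k \<noteq> n + a" using par n by auto
      ultimately show ?thesis by (simp add: arcAB_def)
    next
      case bottom then show ?thesis using q jn pos unfolding Q_def by linarith
    next
      case left
      then have "4 * n + c \<le> k + b" using q ij n by (auto simp: Q_def)
      moreover have "4 * n + c \<noteq> k + b" using par by presburger
      ultimately show ?thesis by (simp add: arcAB_def)
    qed
  qed (use U ij jn in \<open>auto simp: Q_def\<close>)
  then show ?thesis by (simp add: vt_def insert_commute)
qed

lemma horizontal_frozen:
  assumes U: "\<And>k l. k \<in> occ \<Longrightarrow> l \<in> occ \<Longrightarrow> arcCA k \<Longrightarrow> arcCA l \<Longrightarrow> k \<noteq> l \<Longrightarrow> \<not> conn F (inn n k) (inn n l)"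
    and ij: "odd (i + j + a)" "i < j + a" "i + j < a + 2 * c" "i \<le> n" "j < n"
  shows "hz i (Suc j) \<in> F"
proof (cases "i = 0")
  case True then show ?thesis using occ_sides(3)[OF F, of "Suc j"] ij by simp
next
  case False
  have iac: "i < a + c" using ij by linarith
  then have "i < n" "Suc i < n" using n cb pos by auto
  define Q where "Q x y \<longleftrightarrow> 1 \<le> x \<and> x \<le> n \<and> 1 \<le> y \<and> y \<le> n \<and> x + y \<le> i + j + 2 \<and> x + j \<le> y + i" for x y
  have str: "Suc (x + y) \<le> i + j + 2 \<and> Suc (x + j) \<le> y + i" if "Q x y" "odd (x + y + Suc a)" for x y
  proof -
    have "x + y \<noteq> i + j + 2" "x + j \<noteq> y + i" using that(2) ij(1) by presburger+
    then show ?thesis using that(1) by (auto simp: Q_def)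
  qed
  have "{(i, Suc j), (Suc i, id (Suc j))} \<in> F"
  proof (rule frozen_edge_xy[OF F occ_sub, where Q = Q and e = "Suc a" and mx = Suc and my = id and Z = arcCA])
    fix x y assume q: "Q x y" "odd (x + y + Suc a)"
    show "Q (Suc x) (id y) \<and> even (Suc x + id y + Suc a)" using str[OF q] q \<open>i < n\<close> by (auto simp: Q_def)
    show "(x < n \<longrightarrow> Q (Suc x) y) \<and> (y < n \<longrightarrow> Q x (Suc y)) \<and> (1 < x \<longrightarrow> Q (x - 1) y) \<and> (1 < y \<longrightarrow> Q x (y - 1))"
      using str[OF q] q(1) by (auto simp: Q_def)
  next
    fix x y assume q: "Q x y" "even (x + y + Suc a)"
      and nm: "\<And>x' y'. Q x' y' \<Longrightarrow> odd (x' + y' + Suc a) \<Longrightarrow> \<not> (x = Suc x' \<and> y = id y')"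
    have "x = 1"
    proof (rule ccontr)
      assume "x \<noteq> 1"
      then have x: "Q (x - 1) y" "x = Suc (x - 1)" using q(1) by (auto simp: Q_def)
      moreover have "odd (x - 1 + y + Suc a)" using q(2) x(2) by presburger
      ultimately show False using nm[of "x - 1" y] by simp
    qed
    then show "\<exists>k\<in>occ. inn n k = (x, y)" using left_occ[of y] q by (simp add: Q_def)
  next
    fix x y assume "Q x y" "adjacent (Suc i, id (Suc j)) (x, y)"
    then show "x = i \<and> y = Suc j" by (auto simp: Q_def)
  next
    fix k x y assume k: "k \<in> occ" "inn n k = (x, y)" and q: "Q x y"
    have par: "odd (k + b + c)" using k by (simp add: occ_def)
    from k show "arcCA k"
    proof (cases rule: inn_eq)
      case top
      then have "b = c \<and> x = 1" using q ij n cb by (auto simp: Q_def)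
      then show ?thesis using top par by simp
    next
      case right then show ?thesis using q \<open>Suc i < n\<close> by (auto simp: Q_def)
    next
      case bottom
      then have "3 * n \<le> k + a" using q ij by (auto simp: Q_def)
      moreover have "3 * n \<noteq> k + a" using par n by presburger
      ultimately show ?thesis using bottom n unfolding arcCA_def by linarith
    next
      case left then show ?thesis using q ij n pos unfolding Q_def arcCA_def by linarith
    qed
  qed (use U ij False \<open>i < n\<close> in \<open>auto simp: Q_def\<close>)
  then show ?thesis by (simp add: hz_def)
qed

lemma corner_frozen:
  assumes U: "\<And>k l. k \<in> occ \<Longrightarrow> l \<in> occ \<Longrightarrow> arcBC k \<Longrightarrow> arcBC l \<Longrightarrow> k \<noteq> l \<Longrightarrow> \<not> conn F (inn n k) (inn n l)"
    and ij: "odd (i + j + a)" "j + a < i" "1 \<le> j" "i \<le> n"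
  shows "vt i j \<in> F"
proof -
  define Q where "Q x y \<longleftrightarrow> 1 \<le> x \<and> x \<le> n \<and> 1 \<le> y \<and> y \<le> n \<and> x + y \<le> i + j + 1 \<and> y + i \<le> x + j + 1" for x y
  have str: "x + y \<le> i + j \<and> y + i \<le> x + j" if "Q x y" "odd (x + y + a)" for x y
  proof -
    have "x + y \<noteq> i + j + 1" "y + i \<noteq> x + j + 1" using that(2) ij(1) by presburger+
    then show ?thesis using that(1) by (auto simp: Q_def)
  qed
  have "{(i, j), (id i, Suc j)} \<in> F"
  proof (rule frozen_edge_xy[OF F occ_sub, where Q = Q and e = a and mx = id and my = Suc and Z = arcBC])
    fix x y assume q: "Q x y" "odd (x + y + a)"
    show "Q (id x) (Suc y) \<and> even (id x + Suc y + a)" using str[OF q] q ij by (auto simp: Q_def)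
    show "(x < n \<longrightarrow> Q (Suc x) y) \<and> (y < n \<longrightarrow> Q x (Suc y)) \<and> (1 < x \<longrightarrow> Q (x - 1) y) \<and> (1 < y \<longrightarrow> Q x (y - 1))"
      using str[OF q] q(1) by (auto simp: Q_def)
  next
    fix x y assume q: "Q x y" "even (x + y + a)"
      and nm: "\<And>x' y'. Q x' y' \<Longrightarrow> odd (x' + y' + a) \<Longrightarrow> \<not> (x = id x' \<and> y = Suc y')"
    have "y = 1"
    proof (rule ccontr)
      assume "y \<noteq> 1"
      then have y: "Q x (y - 1)" "y = Suc (y - 1)" using q(1) by (auto simp: Q_def)
      moreover have "odd (x + (y - 1) + a)" using q(2) y(2) by presburger
      ultimately show False using nm[of x "y - 1"] by simp
    qed
    then show "\<exists>k\<in>occ. inn n k = (x, y)" using bottom_occ[of x] q by (simp add: Q_def)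
  next
    fix x y assume "Q x y" "adjacent (id i, Suc j) (x, y)"
    then show "x = i \<and> y = j" by (auto simp: Q_def)
  next
    fix k x y assume k: "k \<in> occ" "inn n k = (x, y)" and q: "Q x y"
    have par: "odd (k + b + c)" using k by (simp add: occ_def)
    from k show "arcBC k"
    proof (cases rule: inn_eq)
      case top then show ?thesis using q ij pos by (auto simp: Q_def)
    next
      case right
      then have "n + a \<le> k" "k < 2 * n" using q ij by (auto simp: Q_def)
      moreover have "k \<noteq> n + a" using par n by auto
      ultimately show ?thesis using n unfolding arcBC_def by linarith
    next
      case bottom
      then show ?thesis using q ij n pos unfolding Q_def arcBC_def by linarith
    next
      case left then show ?thesis using q ij pos by (auto simp: Q_def)
    qed
  qed (use U ij in \<open>auto simp: Q_def\<close>)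
  then show ?thesis by (simp add: vt_def)
qed

text \<open>
In the corner region only every other vertical edge is given by the counting argument. The heights
there follow by induction from the right side: a frozen edge fixes the height to its left, and any
other height is squeezed between bounds from its right and its upper neighbour.
\<close>
theorem unlinked_frozen:
  assumes AB: "\<And>k l. k \<in> occ \<Longrightarrow> l \<in> occ \<Longrightarrow> arcAB k \<Longrightarrow> arcAB l \<Longrightarrow> k \<noteq> l \<Longrightarrow> \<not> conn F (inn n k) (inn n l)"
    and BC: "\<And>k l. k \<in> occ \<Longrightarrow> l \<in> occ \<Longrightarrow> arcBC k \<Longrightarrow> arcBC l \<Longrightarrow> k \<noteq> l \<Longrightarrow> \<not> conn F (inn n k) (inn n l)"
    and CA: "\<And>k l. k \<in> occ \<Longrightarrow> l \<in> occ \<Longrightarrow> arcCA k \<Longrightarrow> arcCA l \<Longrightarrow> k \<noteq> l \<Longrightarrow> \<not> conn F (inn n k) (inn n l)"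
  shows "frozen (csum F)"
proof -
  have ok: "csum_ok (csum F)" by (rule csum_csum_ok[OF F])
  have corner: "\<forall>j. j + a \<le> i \<longrightarrow> csum F i j = int i - int j" if "i \<le> n" for i
    using that
  proof (induction i rule: inc_induct)
    case base then show ?case using ok by (simp add: csum_ok_def)
  next
    case (step i)
    show ?case
    proof (intro allI impI)
      fix j assume j: "j + a \<le> i"
      have IH: "csum F (Suc i) j' = int (Suc i) - int j'" if "j' + a \<le> Suc i" for j' using step.IH that by blast
      consider "j = 0" | "1 \<le> j" "odd (Suc i + j + a)" | "1 \<le> j" "even (Suc i + j + a)" by linarith
      then show "csum F i j = int i - int j"
      proof cases
        case 1 then show ?thesis using ok step.hyps by (simp add: csum_ok_def)
      next
        case 2
        then have "vt (Suc i) j \<in> F" using corner_frozen[OF BC, of "Suc i" j] j step.hyps by simp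
        then show ?thesis using IH[of j] j 2 by (simp add: csum_Suc)
      next
        case 3
        have ji: "j + a < i"
        proof -
          have "j + a \<noteq> i" using 3(2) by presburger
          then show ?thesis using j by simp
        qed
        then have "vt (Suc i) (Suc j) \<in> F" using corner_frozen[OF BC, of "Suc i" "Suc j"] 3 step.hyps by simp
        then have "csum F i (Suc j) = int i - int j - 1" using IH[of "Suc j"] ji 3 by (simp add: csum_Suc)
        moreover have "csum F i j \<le> csum F i (Suc j) + 1" using ok ji step.hyps unfolding csum_ok_def by auto
        moreover have "csum F (Suc i) j \<le> csum F i j + 1" using ok ji step.hyps unfolding csum_ok_def by auto
        ultimately show ?thesis using IH[of j] j by simp
      qed
    qed
  qed
  show ?thesis unfolding frozen_def
  proof (intro conjI allI impI)
    fix i j assume "odd (i + j + a) \<and> i < j + a \<and> a + 2 * c < i + j \<and> i < n \<and> j \<le> n"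
    then show "csum F (Suc i) j = csum F i j" using vertical_frozen[OF AB, of i j] by (simp add: vt_csum)
  next
    fix i j assume "odd (i + j + a) \<and> i < j + a \<and> i + j < a + 2 * c \<and> i \<le> n \<and> j < n"
    then show "csum F i (Suc j) = csum F i j" using horizontal_frozen[OF CA, of i j] hz_csum[OF F, of i j] by simp
  next
    fix i j assume "j + a \<le> i \<and> i \<le> n"
    then show "csum F i j = int i - int j" using corner by blast
  qed
qed

end

end

section \<open>A label constant along paths\<close>

context box
begin

text \<open>
Renumbering in the corner region between \<open>B\<close> and \<open>C\<close>, with values above \<open>a\<close> on the paths around
\<open>B\<close> and negative values on the paths around \<open>C\<close>; \<open>hlab\<close> is its analogue in the left region, with
values from 1 to \<open>a\<close> on the paths around \<open>A\<close>.
\<close>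
definition slab :: "int \<Rightarrow> int" where
  "slab m = (if int c < m then m - int c + int a else m - int c - 1)"
definition hlab :: "int \<Rightarrow> int" where
  "hlab r = (if r \<le> int a then r else int a - r)"

text \<open>
A label constant along the paths of a frozen configuration. In each of the three regions the paths
run through a pattern of frozen edges, and crossing from one frozen edge to the next changes the
position along the diagonal and the height by amounts that cancel. The renumberings make the three
expressions agree across the borders of the regions. The values \<open>1, \<dots>, a\<close> belong to the arches
around \<open>A\<close>, the values \<open>a + 1, \<dots>, a + b\<close> to those around \<open>B\<close>, and \<open>- c, \<dots>, - 1\<close> to those
around \<open>C\<close>.
\<close>
definition lab :: "point set set \<Rightarrow> nat \<Rightarrow> nat \<Rightarrow> int" where
  "lab F x y = (let q = (int x + int y - int a) div 2 in
    if even (x + y + a) then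
      (if y + a \<le> x then slab q else if int c < q then csum F (x - 1) y + q - int c
       else hlab (csum F x y - q + int c + 1))
    else
      (if y + a \<le> x then slab (q + 1) else if int c < q then csum F (x - 1) (y - 1) + q - int c
       else hlab (csum F (x - 1) y - q + int c + 1)))"

lemma lab_even:
  assumes "int x + int y = int a + 2 * q"
  shows "lab F x y = (if y + a \<le> x then slab q else if int c < q then csum F (x - 1) y + q - int c
       else hlab (csum F x y - q + int c + 1))"
proof -
  have "even (x + y + a)" using assms by presburger
  moreover have "(int x + int y - int a) div 2 = q" using assms by simp
  ultimately show ?thesis unfolding lab_def Let_def by simp
qed

lemma lab_odd:
  assumes "int x + int y = int a + 2 * q + 1"
  shows "lab F x y = (if y + a \<le> x then slab (q + 1) else if int c < q then csum F (x - 1) (y - 1) + q - int c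
       else hlab (csum F (x - 1) y - q + int c + 1))"
proof -
  have "odd (x + y + a)" using assms by presburger
  moreover have "(int x + int y - int a) div 2 = q" using assms by simp
  ultimately show ?thesis unfolding lab_def Let_def by simp
qed

text \<open>
The value of \<open>lab\<close> at the inner end of an occupied external edge, as a function of its index alone;
the four cases follow the arcs, the first and the last being the two parts of the arc from \<open>A\<close> to
\<open>B\<close>.
\<close>
definition elab :: "nat \<Rightarrow> int" where
  "elab k = (if k < n + a then (int k + 1 + int b - int c) div 2
     else if k + a < 3 * n then slab ((3 * int n - int a - int k + 1) div 2)
     else if k + b < 4 * n + c then hlab ((4 * int n - int b + int c - int k + 1) div 2)
     else (int k + 1 + int b - int c - 4 * int n) div 2)"

lemma half: "m = 2 * k \<Longrightarrow> m div 2 = k" for m k :: int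
  by simp

context
  fixes F :: "point set set"
  assumes F: "F \<in> FPL n occ" and fr: "frozen (csum F)"
begin

abbreviation "T \<equiv> csum F"

lemmas ok = csum_csum_ok[OF F]
lemmas V = T_V[OF ok fr] and H = T_H[OF ok fr] and S = T_S[OF ok fr]
lemmas right = T_right[OF ok fr] and up = T_up[OF ok fr] and bd = T_bd[OF ok fr] and le_a = T_le_a[OF ok fr]

lemma lab_vt:
  assumes e: "vt x y \<in> F" and xy: "1 \<le> x" "x \<le> n" "1 \<le> y" "y < n"
  shows "lab F x y = lab F x (Suc y)"
proof -
  obtain x' where x': "x = Suc x'" using xy by (cases x) auto
  obtain y' where y': "y = Suc y'" using xy by (cases y) auto
  have pred: "x - 1 = x'" "y - 1 = y'" using x' y' by simp_all
  have sq: "T x' y \<le> T x y" "T x y \<le> T x' y + 1" "T x' (Suc y) \<le> T x (Suc y)" "T x (Suc y) \<le> T x' (Suc y) + 1"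
    "T x' y' \<le> T x y'" "T x y' \<le> T x' y' + 1" "T x (Suc y) \<le> T x y" "T x y \<le> T x (Suc y) + 1"
    "T x' (Suc y) \<le> T x' y" "T x' y \<le> T x' (Suc y) + 1" "T x y \<le> T x y'" "T x y' \<le> T x y + 1"
    "T x' y \<le> T x' y'" "T x' y' \<le> T x' y + 1"
    using right[of x' y] right[of x' "Suc y"] right[of x' y'] up[of x y] up[of x' y] up[of x y'] up[of x' y'] xy x' y' by auto
  show ?thesis
  proof (cases "even (x + y + a)")
    case True
    have eq: "T x y = T x' y" using e True x' vt_csum[of x' y F] by simp
    have "even (int x + int y - int a)" using True by simp
    then obtain q where "int x + int y - int a = 2 * q" by (elim evenE)
    then have q: "int x + int y = int a + 2 * q" "int x + int (Suc y) = int a + 2 * q + 1" by linarith+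
    note L = lab_even[OF q(1), of F, unfolded pred] lab_odd[OF q(2), of F, unfolded pred]
    consider (ss) "Suc y + a \<le> x" | (sv) "x = y + a" | (nv) "x < y + a" "int c < q" | (nh) "x < y + a" "q \<le> int c" by linarith
    then show ?thesis
    proof cases
      case ss
      then have False using S[of y x] S[of y x'] eq xy x' by simp
      then show ?thesis ..
    next
      case sv
      have "T x y = int a" using S[of y x] sv xy by simp
      moreover have "q = int y" using q sv by linarith
      moreover have "odd (x' + y + a)" using True x' by simp
      then have "T x' (Suc y) = T x' y" if "q \<le> int c"
        by (rule H) (use sv x' xy that q in linarith)+
      ultimately show ?thesis using L sv eq by (auto simp: slab_def hlab_def)
    next
      case nv then show ?thesis using L by simp
    next
      case nh
      have "T x' (Suc y) = T x' y" by (rule H) (use nh x' xy True q in auto)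
      then show ?thesis using L nh eq x' by simp
    qed
  next
    case False
    have eq: "T x y = T x' y + 1" using e False x' vt_csum[of x' y F] sq by simp
    have "odd (int x + int y - int a)" using False by simp
    then obtain q where "int x + int y - int a = 2 * q + 1" by (elim oddE)
    then have q: "int x + int y = int a + 2 * q + 1" "int x + int (Suc y) = int a + 2 * (q + 1)" by simp_all
    note L = lab_odd[OF q(1), of F, unfolded pred] lab_even[OF q(2), of F, unfolded pred]
    have "x \<noteq> y + a" using False by auto
    then consider (s) "Suc y + a \<le> x" | (nv) "x < y + a" "int c < q" | (nq) "x < y + a" "q = int c" | (nh) "x < y + a" "q < int c" by linarith
    then show ?thesis
    proof cases
      case s then show ?thesis using L by simp
    next
      case nv
      have "T (Suc x') y' = T x' y'" by (rule V) (use nv x' y' xy False q in auto)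
      moreover have "T (Suc x') (Suc y) = T x' (Suc y)" by (rule V) (use nv x' y' xy False q in auto)
      ultimately show ?thesis using L nv eq sq x' y' by simp
    next
      case nq
      have "T (Suc x') (Suc y) = T x' (Suc y)" by (rule V) (use nq x' y' xy False q in auto)
      moreover have "T x y \<le> int a" by (rule le_a) (use nq xy in auto)
      ultimately show ?thesis using L nq eq sq x' y' by (simp add: hlab_def)
    next
      case nh
      have "T x (Suc y) = T x y" by (rule H) (use nh x' y' xy False q in auto)
      then show ?thesis using L nh eq sq x' y' by (simp add: algebra_simps)
    qed
  qed
qed

lemma lab_hz:
  assumes e: "hz x y \<in> F" and xy: "1 \<le> x" "x < n" "1 \<le> y" "y \<le> n"
  shows "lab F x y = lab F (Suc x) y"
proof -
  obtain x' where x': "x = Suc x'" using xy by (cases x) auto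
  obtain y' where y': "y = Suc y'" using xy by (cases y) auto
  have pred: "x - 1 = x'" "y - 1 = y'" using x' y' by simp_all
  have sq: "T x' y \<le> T x y" "T x y \<le> T x' y + 1" "T x' y' \<le> T x y'" "T x y' \<le> T x' y' + 1"
    "T x y \<le> T (Suc x) y" "T (Suc x) y \<le> T x y + 1" "T x y' \<le> T (Suc x) y'" "T (Suc x) y' \<le> T x y' + 1"
    "T x y \<le> T x y'" "T x y' \<le> T x y + 1" "T x' y \<le> T x' y'" "T x' y' \<le> T x' y + 1"
    using right[of x' y] right[of x' y'] right[of x y] right[of x y'] up[of x y'] up[of x' y'] xy x' y' by auto
  show ?thesis
  proof (cases "even (x + y + a)")
    case True
    have eq: "T x y = T x y'" using e True y' hz_csum[OF F, of x y'] xy by simp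
    have "even (int x + int y - int a)" using True by simp
    then obtain q where "int x + int y - int a = 2 * q" by (elim evenE)
    then have q: "int x + int y = int a + 2 * q" "int (Suc x) + int y = int a + 2 * q + 1" by linarith+
    note L = lab_even[OF q(1), of F, unfolded pred] lab_odd[OF q(2), of F, unfolded pred]
    have "Suc x \<noteq> y + a" using True by presburger
    then consider (s) "y + a \<le> x" | (nv) "Suc x < y + a" "int c < q" | (nh) "Suc x < y + a" "q \<le> int c" by linarith
    then show ?thesis
    proof cases
      case s
      then have False using S[of y x] S[of y' x] eq xy y' by simp
      then show ?thesis ..
    next
      case nv
      have "T (Suc x') y = T x' y" by (rule V) (use nv x' y' xy True q in auto)
      then show ?thesis using L nv eq x' y' by simp
    next
      case nh then show ?thesis using L by simp
    qed
  next
    case False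
    have eq: "T x y' = T x y + 1" using e False y' hz_csum[OF F, of x y'] xy sq by simp
    have "odd (int x + int y - int a)" using False by simp
    then obtain q where "int x + int y - int a = 2 * q + 1" by (elim oddE)
    then have q: "int x + int y = int a + 2 * q + 1" "int (Suc x) + int y = int a + 2 * (q + 1)" by simp_all
    note L = lab_odd[OF q(1), of F, unfolded pred] lab_even[OF q(2), of F, unfolded pred]
    have par: "Suc (Suc x) \<noteq> y + a" using False by presburger
    have left: "T x' y = T x y" if "x < y + a" "q \<le> int c"
    proof -
      have "T x' (Suc y') = T x' y'" by (rule H) (use that x' y' xy False q in auto)
      then show ?thesis using sq eq y' by simp
    qed
    consider (s) "y + a \<le> x" | (ls) "Suc x = y + a" | (nv) "Suc x < y + a" "int c < q" | (nq) "Suc x < y + a" "q = int c"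
      | (nh) "Suc x < y + a" "q < int c" by linarith
    then show ?thesis
    proof cases
      case s then show ?thesis using L by simp
    next
      case ls
      have a1: "T x y' = int a" using S[of y' x] ls y' xy by simp
      have "int (Suc x) = int (y + a)" using ls by (simp only:)
      then have qy: "q = int y - 1" using q(2) by simp
      show ?thesis
      proof (cases "int c \<le> q")
        case True
        have "T (Suc x) y = T x y" by (rule V) (use True ls x' y' xy False q in auto)
        moreover have "T (Suc x) y = int a" using S[of y "Suc x"] ls xy by simp
        ultimately have False using a1 eq by simp
        then show ?thesis ..
      next
        case f: False
        then show ?thesis using L ls left a1 eq qy x' by (simp add: hlab_def slab_def)
      qed
    next
      case nv
      have "T (Suc x') y' = T x' y'" by (rule V) (use nv x' y' xy False q in auto)
      then show ?thesis using L nv eq x' y' by simp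
    next
      case nq
      have "T x y' \<le> int a" by (rule le_a) (use nq xy y' in auto)
      then show ?thesis using L nq eq left x' y' by (simp add: hlab_def)
    next
      case nh
      have "Suc x < y' + a" using nh par y' by linarith
      then have "T (Suc x) (Suc y') = T (Suc x) y'" by (intro H) (use nh x' y' xy False q in auto)
      then have "T (Suc x) y = T x y + 1" using sq eq y' by simp
      then show ?thesis using L nh left by (simp add: algebra_simps)
    qed
  qed
qed

lemma lab_conn:
  assumes c: "conn F (x, y) (x', y')" and v: "(x, y) \<in> verts n" "(x', y') \<in> verts n"
  shows "lab F x' y' = lab F x y"
proof -
  define g where "g = (\<lambda>(x, y). lab F x y)"
  have gm: "g (x, y) = lab F x y" for x y by (simp add: g_def)
  have "g (x', y') = g (x, y)"
    by (rule conn_constant[OF FPL_D(1)[OF F] c v]) (unfold gm, (rule lab_vt lab_hz; assumption)+)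
  then show ?thesis by (simp only: gm)
qed

lemma lab_ext:
  assumes k: "k \<in> occ" and i: "inn n k = (x, y)"
  shows "lab F x y = elab k"
  using k i
proof (cases rule: inn_eq)
  case top
  have "even (int x + int n - int a)" using top by simp
  then obtain q where "int x + int n - int a = 2 * q" by (elim evenE)
  then have q: "int x + int y = int a + 2 * q" using top by linarith
  have "T (x - 1) n = 0" using bd(2)[of "x - 1"] top by simp
  moreover have "int c < q" "\<not> y + a \<le> x" using q top n cb pos by linarith+
  ultimately have "lab F x y = q - int c" using lab_even[OF q] top by simp
  moreover have "(int k + 1 + int b - int c) div 2 = (q - int c)"
      by (rule half) (use q top n in \<open>simp add: of_nat_diff\<close>)
  moreover have "k < n + a" using top by auto
  ultimately show ?thesis by (simp add: elab_def)
next
  case right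
  have "odd (int n + int y - int a)" using right by simp
  then obtain q where "int n + int y - int a = 2 * q + 1" by (elim oddE)
  then have q: "int x + int y = int a + 2 * q + 1" using right by linarith
  show ?thesis
  proof (cases "y + a \<le> n")
    case True
    then have "lab F x y = slab (q + 1)" using lab_odd[OF q] right by simp
    moreover have "(3 * int n - int a - int k + 1) div 2 = (q + 1)"
      by (rule half) (use q right in \<open>simp add: of_nat_diff\<close>)
    moreover have "\<not> k < n + a" "k + a < 3 * n" using right True n pos by linarith+
    ultimately show ?thesis by (simp add: elab_def)
  next
    case False
    obtain n' y' where s: "n = Suc n'" "y = Suc y'" using right by (cases n; cases y) auto
    have "T (Suc n') y' = T n' y'" by (rule V) (use right False s n cb pos in auto)
    moreover have "T n y' = int n - int y'" using bd(4)[of y'] right s by simp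
    moreover have "int c < q" using q right False n cb pos by linarith
    ultimately have "lab F x y = int n - int y + 1 + q - int c" using lab_odd[OF q] right False s by simp
    moreover have "(int k + 1 + int b - int c) div 2 = (int n - int y + 1 + q - int c)"
      by (rule half) (use q right n in \<open>simp add: of_nat_diff\<close>)
    moreover have "k < n + a" using right False by linarith
    ultimately show ?thesis by (simp add: elab_def)
  qed
next
  case bottom
  have "even (int x + 1 - int a)" using bottom by simp
  then obtain q where "int x + 1 - int a = 2 * q" by (elim evenE)
  then have q: "int x + int y = int a + 2 * q" using bottom by linarith
  have xa: "x \<noteq> a" using bottom by auto
  show ?thesis
  proof (cases "1 + a \<le> x")
    case True
    then have "lab F x y = slab q" using lab_even[OF q] bottom by simp
    moreover have "(3 * int n - int a - int k + 1) div 2 = q"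
      by (rule half) (use q bottom in \<open>simp add: of_nat_diff\<close>)
    moreover have "\<not> k < n + a" "k + a < 3 * n" using bottom True n pos by linarith+
    ultimately show ?thesis by (simp add: elab_def)
  next
    case False
    have "T x (Suc 0) = T x 0" by (rule H) (use bottom False xa pos in auto)
    moreover have "T x 0 = int x" using bd(3)[of x] bottom by simp
    moreover have "q \<le> int c" using q bottom False by linarith
    ultimately have "lab F x y = hlab (int x - q + int c + 1)" using lab_even[OF q] bottom False by simp
    moreover have "(4 * int n - int b + int c - int k + 1) div 2 = (int x - q + int c + 1)"
      by (rule half) (use q bottom n in \<open>simp add: of_nat_diff\<close>)
    moreover have "\<not> k < n + a" "\<not> k + a < 3 * n" "k + b < 4 * n + c" using bottom False xa n pos by linarith+
    ultimately show ?thesis by (simp add: elab_def)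
  qed
next
  case left
  have "even (int y - int a)" using left by simp
  then obtain q where "int y - int a = 2 * q" by (elim evenE)
  then have q: "int x + int y = int a + 2 * q + 1" using left by linarith
  have ns: "\<not> y + a \<le> x" using left pos by linarith
  have k1: "\<not> k < n + a" "\<not> k + a < 3 * n" using left n pos by linarith+
  show ?thesis
  proof (cases "int c < q")
    case True
    have "T 0 (y - 1) = 0" by simp
    then have "lab F x y = q - int c" using lab_odd[OF q] left ns True by simp
    moreover have "(int k + 1 + int b - int c - 4 * int n) div 2 = (q - int c)"
      by (rule half) (use q left n in \<open>simp add: of_nat_diff\<close>)
    moreover have "\<not> k + b < 4 * n + c" using True q left n by linarith
    ultimately show ?thesis using k1 by (simp add: elab_def)
  next
    case False
    have "T 0 y = 0" by simp
    then have "lab F x y = hlab (- q + int c + 1)" using lab_odd[OF q] left ns False by simp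
    moreover have "(4 * int n - int b + int c - int k + 1) div 2 = (- q + int c + 1)"
      by (rule half) (use q left n in \<open>simp add: of_nat_diff\<close>)
    moreover have "k + b < 4 * n + c" using False q left n by linarith
    ultimately show ?thesis using k1 by (simp add: elab_def)
  qed
qed

lemma elab_conn:
  assumes "k \<in> occ" "l \<in> occ" "conn F (inn n k) (inn n l)"
  shows "elab k = elab l"
proof -
  obtain x y x' y' where xy: "inn n k = (x, y)" "inn n l = (x', y')" by (metis surj_pair)
  have "inn n k \<in> verts n" "inn n l \<in> verts n" using assms occ_sub by auto
  then have "lab F x' y' = lab F x y" by (intro lab_conn) (use assms(3) xy in simp_all)
  then show ?thesis using lab_ext assms xy by metis
qed

end

end

section \<open>The link pattern in normal position\<close>

text \<open>
The nested arches around position \<open>X\<close> for alternating external edges with \<open>X\<close> unoccupied. The summand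
\<open>4 * n\<close> keeps the subtraction on natural numbers from being truncated.
\<close>
definition arches :: "nat \<Rightarrow> nat \<Rightarrow> nat \<Rightarrow> nat set set" where
  "arches n X s = {{(X + 2 * j - 1) mod (4 * n), (X + 4 * n + 1 - 2 * j) mod (4 * n)} | j. j \<in> {1..s}}"

lemma mod_once: "x < 2 * m \<Longrightarrow> x mod m = (if x < m then x else x - m)" for x m :: nat
  by (simp add: mod_if)

context box
begin

definition pattern :: "nat set set" where
  "pattern = arches n (4 * n + c - b) a \<union> arches n (n + a) b \<union> arches n (3 * n - a) c"

lemma arcs:
  assumes "k \<in> occ"
  obtains (AB) "arcAB k" "\<not> arcBC k" "\<not> arcCA k" | (BC) "\<not> arcAB k" "arcBC k" "\<not> arcCA k"
    | (CA) "\<not> arcAB k" "\<not> arcBC k" "arcCA k"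
proof -
  have k: "k < 4 * n" "odd (k + b + c)" using assms by (auto simp: occ_def)
  have "k \<noteq> n + a" using k(2) n by auto
  moreover have "k + a \<noteq> 3 * n"
  proof
    assume "k + a = 3 * n"
    then have "k + b + c + 2 * a = 4 * n" using n by simp
    then have "even (k + b + c + 2 * a)" by simp
    then show False using k(2) by simp
  qed
  moreover have "k + b \<noteq> 4 * n + c"
  proof
    assume "k + b = 4 * n + c"
    then have "k + b + c = 4 * n + 2 * c" by simp
    then have "even (k + b + c)" by simp
    then show False using k(2) by simp
  qed
  ultimately consider "k < n + a" | "n + a < k" "k + a < 3 * n" | "3 * n < k + a" "k + b < 4 * n + c" | "4 * n + c < k + b" by linarith
  then show ?thesis
  proof cases
    case 1 then show ?thesis using that(1) n k unfolding arcAB_def arcBC_def arcCA_def by simp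
  next
    case 2 then show ?thesis using that(2) n k unfolding arcAB_def arcBC_def arcCA_def by simp
  next
    case 3 then show ?thesis using that(3) n k unfolding arcAB_def arcBC_def arcCA_def by simp
  next
    case 4 then show ?thesis using that(1) n k unfolding arcAB_def arcBC_def arcCA_def by simp
  qed
qed

lemma occ_half:
  assumes "k \<in> occ"
  obtains r where "int k + 1 + int b - int c = 2 * r"
proof -
  have "even (int k + 1 + int b - int c)" using assms by (auto simp: occ_def)
  then show ?thesis using that by (elim evenE)
qed

lemma elab_AB:
  assumes k: "k \<in> occ" "arcAB k"
  shows "1 \<le> elab k \<and> elab k \<le> int a + int b \<and>
    (int k + 1 + int b - int c = 2 * elab k \<or> int k + 1 + int b - int c = 2 * elab k + 4 * int n)"
proof -
  have k4: "k < 4 * n" using k by (simp add: occ_def)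
  obtain r where r: "int k + 1 + int b - int c = 2 * r" using occ_half[OF k(1)] .
  show ?thesis
  proof (cases "k < n + a")
    case True
    then have "elab k = r" using r by (simp add: elab_def)
    then show ?thesis using r True n cb by linarith
  next
    case False
    then have f: "4 * n + c < k + b" using k(2) by (simp add: arcAB_def)
    have "(int k + 1 + int b - int c - 4 * int n) div 2 = r - 2 * int n" by (rule half) (use r in simp)
    moreover have "\<not> k + a < 3 * n" "\<not> k + b < 4 * n + c" using f n by linarith+
    ultimately have "elab k = r - 2 * int n" using False by (simp add: elab_def)
    then show ?thesis using r f k4 n cb by linarith
  qed
qed

lemma elab_BC:
  assumes k: "k \<in> occ" "arcBC k"
  obtains m where "elab k = slab m" "3 * int n - int a - int k + 1 = 2 * m" "1 \<le> m" "m \<le> int b + int c"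
proof -
  obtain r where r: "int k + 1 + int b - int c = 2 * r" using occ_half[OF k(1)] .
  define m where "m = int a + 2 * int b + int c + 1 - r"
  have m: "3 * int n - int a - int k + 1 = 2 * m" using r n by (simp add: m_def)
  then have "(3 * int n - int a - int k + 1) div 2 = m" by (rule half)
  then have "elab k = slab m" using k(2) by (simp add: elab_def arcBC_def)
  moreover have "1 \<le> m" "m \<le> int b + int c" using m k(2) n unfolding arcBC_def by linarith+
  ultimately show ?thesis using that m by blast
qed

lemma elab_CA:
  assumes k: "k \<in> occ" "arcCA k"
  obtains m where "elab k = hlab m" "4 * int n - int b + int c - int k + 1 = 2 * m" "1 \<le> m" "m \<le> int a + int c"
proof -
  obtain r where r: "int k + 1 + int b - int c = 2 * r" using occ_half[OF k(1)] .
  define m where "m = 2 * int n + 1 - r"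
  have m: "4 * int n - int b + int c - int k + 1 = 2 * m" using r n by (simp add: m_def)
  then have "(4 * int n - int b + int c - int k + 1) div 2 = m" by (rule half)
  moreover have "\<not> k < n + a" "\<not> k + a < 3 * n" using k(2) n unfolding arcCA_def by linarith+
  ultimately have "elab k = hlab m" using k(2) by (simp add: elab_def arcCA_def)
  moreover have "1 \<le> m" "m \<le> int a + int c" using m k(2) n unfolding arcCA_def by linarith+
  ultimately show ?thesis using that m by blast
qed

lemma elab_inj:
  assumes "k \<in> occ" "l \<in> occ" "elab k = elab l" "arcAB k \<and> arcAB l \<or> arcBC k \<and> arcBC l \<or> arcCA k \<and> arcCA l"
  shows "k = l"
proof -
  have kl: "k < 4 * n" "l < 4 * n" using assms by (simp_all add: occ_def)
  from assms(4) show ?thesis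
  proof (elim disjE conjE)
    assume "arcAB k" "arcAB l"
    then show ?thesis using elab_AB[OF assms(1)] elab_AB[OF assms(2)] assms(3) kl by linarith
  next
    assume "arcBC k" "arcBC l"
    then obtain m m' where "elab k = slab m" "3 * int n - int a - int k + 1 = 2 * m" "1 \<le> m" "m \<le> int b + int c"
      "elab l = slab m'" "3 * int n - int a - int l + 1 = 2 * m'" "1 \<le> m'" "m' \<le> int b + int c"
      using elab_BC assms(1,2) by metis
    then show ?thesis using assms(3) by (auto simp: slab_def split: if_splits)
  next
    assume "arcCA k" "arcCA l"
    then obtain m m' where "elab k = hlab m" "4 * int n - int b + int c - int k + 1 = 2 * m" "1 \<le> m" "m \<le> int a + int c"
      "elab l = hlab m'" "4 * int n - int b + int c - int l + 1 = 2 * m'" "1 \<le> m'" "m' \<le> int a + int c"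
      using elab_CA assms(1,2) by metis
    then show ?thesis using assms(3) by (auto simp: hlab_def split: if_splits)
  qed
qed

lemma elab_range:
  assumes "k \<in> occ"
  shows "arcAB k \<Longrightarrow> 1 \<le> elab k \<and> elab k \<le> int a + int b"
    "arcBC k \<Longrightarrow> (int a < elab k \<and> elab k \<le> int a + int b) \<or> (- int c \<le> elab k \<and> elab k < 0)"
    "arcCA k \<Longrightarrow> (1 \<le> elab k \<and> elab k \<le> int a) \<or> (- int c \<le> elab k \<and> elab k < 0)"
proof -
  show "1 \<le> elab k \<and> elab k \<le> int a + int b" if "arcAB k" using elab_AB[OF assms that] by blast
  show "(int a < elab k \<and> elab k \<le> int a + int b) \<or> (- int c \<le> elab k \<and> elab k < 0)" if "arcBC k"
    by (rule elab_BC[OF assms that]) (auto simp: slab_def)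
  show "(1 \<le> elab k \<and> elab k \<le> int a) \<or> (- int c \<le> elab k \<and> elab k < 0)" if "arcCA k"
    by (rule elab_CA[OF assms that]) (auto simp: hlab_def)
qed

text \<open>
Labels are distinct on each arc, and no label occurs on all three arcs: it would have to be
positive, then greater than \<open>a\<close>, and also at most \<open>a\<close>.
\<close>
lemma elab_two:
  assumes o: "k \<in> occ" "l \<in> occ" "m \<in> occ" and e: "elab k = elab l" "elab k = elab m" and ne: "l \<noteq> k" "m \<noteq> k"
  shows "l = m"
proof (rule ccontr)
  assume lm: "l \<noteq> m"
  note i = elab_inj[OF o(1,2) e(1)] elab_inj[OF o(1,3) e(2)] elab_inj[OF o(2,3) e(1)[symmetric, THEN trans, OF e(2)]]
  note r = elab_range[OF o(1)] elab_range[OF o(2)] elab_range[OF o(3)]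
  have a: "arcAB p \<or> arcBC p \<or> arcCA p" if "p \<in> occ" for p using that by (rule arcs) auto
  have "\<exists>p\<in>{k, l, m}. arcAB p" "\<exists>p\<in>{k, l, m}. arcBC p" "\<exists>p\<in>{k, l, m}. arcCA p"
    using a[OF o(1)] a[OF o(2)] a[OF o(3)] i ne lm by auto
  then have "1 \<le> elab k" "(int a < elab k \<or> elab k < 0)" "(elab k \<le> int a \<or> elab k < 0)"
    using r e by auto
  then show False by linarith
qed

lemma pairA:
  assumes j: "1 \<le> j" "j \<le> a"
  obtains p q where "(4 * n + c - b + 2 * j - 1) mod (4 * n) = p" "(4 * n + c - b + 4 * n + 1 - 2 * j) mod (4 * n) = q"
    "p \<in> occ" "q \<in> occ" "arcAB p" "arcCA q" "elab p = int j" "elab q = int j"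
proof -
  define p where "p = (if 2 * j + c \<le> b then 4 * n + c + 2 * j - 1 - b else 2 * j + c - b - 1)"
  define q where "q = 4 * n + c + 1 - b - 2 * j"
  have b4: "b \<le> 4 * n" using n by simp
  have 1: "(4 * n + c - b + 2 * j - 1) mod (4 * n) = p"
    using j n b4 cb by (subst mod_once) (auto simp: p_def)
  have 2: "(4 * n + c - b + 4 * n + 1 - 2 * j) mod (4 * n) = q"
    using j n b4 cb by (subst mod_once) (auto simp: q_def)
  have ip: "int p + 1 + int b - int c = 2 * int j + (if 2 * j + c \<le> b then 4 * int n else 0)"
    using j n b4 by (auto simp: p_def of_nat_diff)
  have iq: "4 * int n - int b + int c - int q + 1 = 2 * int j" using j n b4 by (simp add: q_def of_nat_diff)
  have lp: "p < 4 * n" and lq: "q < 4 * n" using j n cb by (auto simp: p_def q_def)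
  have ap: "arcAB p" using j n cb unfolding arcAB_def p_def by (cases "2 * j + c \<le> b") auto
  have aq: "arcCA q" using j n cb unfolding arcCA_def q_def by auto
  have op: "p \<in> occ"
  proof -
    have "odd (int p + int b + int c)" using ip by (cases "2 * j + c \<le> b") presburger+
    then have "odd (p + b + c)" by simp
    then show ?thesis using lp by (simp add: occ_def)
  qed
  have oq: "q \<in> occ"
  proof -
    have "odd (int q + int b + int c)" using iq by presburger
    then have "odd (q + b + c)" by simp
    then show ?thesis using lq by (simp add: occ_def)
  qed
  have ep: "elab p = int j"
  proof -
    have "2 * elab p = 2 * int j"
      using elab_AB[OF op ap] ip j n cb by (cases "2 * j + c \<le> b") auto
    then show ?thesis by simp
  qed
  obtain m where m: "elab q = hlab m" "4 * int n - int b + int c - int q + 1 = 2 * m" using elab_CA[OF oq aq] by metis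
  then have "elab q = int j" using iq j by (simp add: hlab_def)
  then show ?thesis using that[OF 1 2 op oq ap aq ep] by blast
qed

lemma pairB:
  assumes j: "1 \<le> j" "j \<le> b"
  obtains p q where "(n + a + 2 * j - 1) mod (4 * n) = p" "(n + a + 4 * n + 1 - 2 * j) mod (4 * n) = q"
    "p \<in> occ" "q \<in> occ" "arcBC p" "arcAB q" "elab p = int a + int b + 1 - int j" "elab q = int a + int b + 1 - int j"
proof -
  define p where "p = n + a + 2 * j - 1"
  define q where "q = (if 2 * j \<le> n + a + 1 then n + a + 1 - 2 * j else 5 * n + a + 1 - 2 * j)"
  have 1: "(n + a + 2 * j - 1) mod (4 * n) = p"
    using j n by (subst mod_once) (auto simp: p_def)
  have 2: "(n + a + 4 * n + 1 - 2 * j) mod (4 * n) = q"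
    using j n by (subst mod_once) (auto simp: q_def)
  have iq: "int q + 1 + int b - int c = 2 * (int a + int b + 1 - int j) + (if 2 * j \<le> n + a + 1 then 0 else 4 * int n)"
    using j n by (auto simp: q_def of_nat_diff)
  have ip: "3 * int n - int a - int p + 1 = 2 * (int b + int c + 1 - int j)" using j n by (simp add: p_def of_nat_diff)
  have lp: "p < 4 * n" and lq: "q < 4 * n" using j n pos by (auto simp: p_def q_def)
  have aq: "arcAB q" using j n pos unfolding arcAB_def q_def by (cases "2 * j \<le> n + a + 1") auto
  have ap: "arcBC p" using j n pos unfolding arcBC_def p_def by auto
  have oq: "q \<in> occ"
  proof -
    have "odd (int q + int b + int c)" using iq by (cases "2 * j \<le> n + a + 1") presburger+
    then have "odd (q + b + c)" by simp
    then show ?thesis using lq by (simp add: occ_def)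
  qed
  have op: "p \<in> occ"
  proof -
    have "int p + int b + int c = 2 * int a + 2 * int b + 2 * int c + 2 * int j - 1" using j n by (simp add: p_def of_nat_diff)
    then have "odd (int p + int b + int c)" by presburger
    then have "odd (p + b + c)" by simp
    then show ?thesis using lp by (simp add: occ_def)
  qed
  have eq: "elab q = int a + int b + 1 - int j"
  proof -
    have "2 * elab q = 2 * (int a + int b + 1 - int j)"
      using elab_AB[OF oq aq] iq j n cb pos by (cases "2 * j \<le> n + a + 1") auto
    then show ?thesis by simp
  qed
  obtain m where m: "elab p = slab m" "3 * int n - int a - int p + 1 = 2 * m" using elab_BC[OF op ap] by metis
  then have "m = int b + int c + 1 - int j" using ip m(2) by simp
  then have "elab p = int a + int b + 1 - int j" using m(1) j by (simp add: slab_def)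
  then show ?thesis using that[OF 1 2 op oq ap aq _ eq] by blast
qed

lemma pairC:
  assumes j: "1 \<le> j" "j \<le> c"
  obtains p q where "(3 * n - a + 2 * j - 1) mod (4 * n) = p" "(3 * n - a + 4 * n + 1 - 2 * j) mod (4 * n) = q"
    "p \<in> occ" "q \<in> occ" "arcCA p" "arcBC q" "elab p = int j - int c - 1" "elab q = int j - int c - 1"
proof -
  define p where "p = 3 * n + 2 * j - a - 1"
  define q where "q = 3 * n + 1 - a - 2 * j"
  have 1: "(3 * n - a + 2 * j - 1) mod (4 * n) = p"
    using j n cb by (subst mod_once) (auto simp: p_def)
  have 2: "(3 * n - a + 4 * n + 1 - 2 * j) mod (4 * n) = q"
    using j n by (subst mod_once) (auto simp: q_def)
  have iq: "3 * int n - int a - int q + 1 = 2 * int j" using j n by (simp add: q_def of_nat_diff)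
  have ip: "4 * int n - int b + int c - int p + 1 = 2 * (int a + int c + 1 - int j)" using j n by (simp add: p_def of_nat_diff)
  have lp: "p < 4 * n" and lq: "q < 4 * n" using j n pos cb by (auto simp: p_def q_def)
  have ap: "arcCA p" using j n pos unfolding arcCA_def p_def by auto
  have aq: "arcBC q" using j n pos cb unfolding arcBC_def q_def by auto
  have op: "p \<in> occ"
  proof -
    have "odd (int p + int b + int c)" using ip by presburger
    then have "odd (p + b + c)" by simp
    then show ?thesis using lp by (simp add: occ_def)
  qed
  have oq: "q \<in> occ"
  proof -
    have "int q + int b + int c = 2 * int a + 4 * int b + 4 * int c + 1 - 2 * int j" using j n by (simp add: q_def of_nat_diff)
    then have "odd (int q + int b + int c)" by presburger
    then have "odd (q + b + c)" by simp
    then show ?thesis using lq by (simp add: occ_def)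
  qed
  obtain m where m: "elab p = hlab m" "4 * int n - int b + int c - int p + 1 = 2 * m" using elab_CA[OF op ap] by metis
  then have "m = int a + int c + 1 - int j" using ip m(2) by simp
  then have ep: "elab p = int j - int c - 1" using m(1) j by (simp add: hlab_def)
  obtain m' where m': "elab q = slab m'" "3 * int n - int a - int q + 1 = 2 * m'" using elab_BC[OF oq aq] by metis
  then have "m' = int j" using iq m'(2) by simp
  then have "elab q = int j - int c - 1" using m'(1) j by (simp add: slab_def)
  then show ?thesis using that[OF 1 2 op oq ap aq ep] by blast
qed

definition same_arc :: "nat \<Rightarrow> nat \<Rightarrow> bool" where
  "same_arc k l \<longleftrightarrow> arcAB k \<and> arcAB l \<or> arcBC k \<and> arcBC l \<or> arcCA k \<and> arcCA l"

lemma arc_exclusive: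
  assumes "k \<in> occ"
  shows "\<not> (arcAB k \<and> arcBC k)" "\<not> (arcAB k \<and> arcCA k)" "\<not> (arcBC k \<and> arcCA k)"
  using assms by (rule arcs; blast)+

lemma pattern_D:
  assumes "e \<in> pattern"
  obtains p q where "e = {p, q}" "p \<in> occ" "q \<in> occ" "elab p = elab q" "\<not> same_arc p q"
proof -
  from assms consider "e \<in> arches n (4 * n + c - b) a" | "e \<in> arches n (n + a) b" | "e \<in> arches n (3 * n - a) c"
    unfolding pattern_def by blast
  then show ?thesis
  proof cases
    case 1
    then obtain j where j: "1 \<le> j" "j \<le> a"
      "e = {(4 * n + c - b + 2 * j - 1) mod (4 * n), (4 * n + c - b + 4 * n + 1 - 2 * j) mod (4 * n)}"
      unfolding arches_def by auto
    obtain p q where pq: "(4 * n + c - b + 2 * j - 1) mod (4 * n) = p" "(4 * n + c - b + 4 * n + 1 - 2 * j) mod (4 * n) = q"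
      "p \<in> occ" "q \<in> occ" "arcAB p" "arcCA q" "elab p = int j" "elab q = int j" by (rule pairA[OF j(1,2)])
    have "\<not> same_arc p q" using arc_exclusive[OF pq(3)] arc_exclusive[OF pq(4)] pq(5,6) unfolding same_arc_def by blast
    then show ?thesis using that[of p q] pq j(3) by simp
  next
    case 2
    then obtain j where j: "1 \<le> j" "j \<le> b"
      "e = {(n + a + 2 * j - 1) mod (4 * n), (n + a + 4 * n + 1 - 2 * j) mod (4 * n)}"
      unfolding arches_def by auto
    obtain p q where pq: "(n + a + 2 * j - 1) mod (4 * n) = p" "(n + a + 4 * n + 1 - 2 * j) mod (4 * n) = q"
      "p \<in> occ" "q \<in> occ" "arcBC p" "arcAB q" "elab p = int a + int b + 1 - int j" "elab q = int a + int b + 1 - int j"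
      by (rule pairB[OF j(1,2)])
    have "\<not> same_arc p q" using arc_exclusive[OF pq(3)] arc_exclusive[OF pq(4)] pq(5,6) unfolding same_arc_def by blast
    then show ?thesis using that[of p q] pq j(3) by simp
  next
    case 3
    then obtain j where j: "1 \<le> j" "j \<le> c"
      "e = {(3 * n - a + 2 * j - 1) mod (4 * n), (3 * n - a + 4 * n + 1 - 2 * j) mod (4 * n)}"
      unfolding arches_def by auto
    obtain p q where pq: "(3 * n - a + 2 * j - 1) mod (4 * n) = p" "(3 * n - a + 4 * n + 1 - 2 * j) mod (4 * n) = q"
      "p \<in> occ" "q \<in> occ" "arcCA p" "arcBC q" "elab p = int j - int c - 1" "elab q = int j - int c - 1"
      by (rule pairC[OF j(1,2)])
    have "\<not> same_arc p q" using arc_exclusive[OF pq(3)] arc_exclusive[OF pq(4)] pq(5,6) unfolding same_arc_def by blast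
    then show ?thesis using that[of p q] pq j(3) by simp
  qed
qed

text \<open>
Every label is the label of an arch, so the two ends of that arch are its only occurrences.
\<close>
lemma pattern_level:
  assumes "k \<in> occ"
  obtains p q where "{p, q} \<in> pattern" "p \<noteq> q" "p \<in> occ" "q \<in> occ" "elab p = elab k" "elab q = elab k"
proof -
  have aa: "{(X + 2 * j - 1) mod (4 * n), (X + 4 * n + 1 - 2 * j) mod (4 * n)} \<in> arches n X s"
    if "1 \<le> j" "j \<le> s" for X j s using that unfolding arches_def by auto
  consider "1 \<le> elab k" "elab k \<le> int a" | "int a < elab k" "elab k \<le> int a + int b" | "- int c \<le> elab k" "elab k < 0"
    using assms elab_range[OF assms] by (elim arcs) linarith+
  then show ?thesis
  proof cases
    case 1
    define j where "j = nat (elab k)"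
    have j: "1 \<le> j" "j \<le> a" "elab k = int j" using 1 by (auto simp: j_def)
    obtain p q where pq: "(4 * n + c - b + 2 * j - 1) mod (4 * n) = p" "(4 * n + c - b + 4 * n + 1 - 2 * j) mod (4 * n) = q"
      "p \<in> occ" "q \<in> occ" "arcAB p" "arcCA q" "elab p = int j" "elab q = int j" by (rule pairA[OF j(1,2)])
    have "p \<noteq> q" using arc_exclusive[OF pq(3)] pq(5,6) by blast
    moreover have "{p, q} \<in> pattern" using aa[OF j(1,2), of "4 * n + c - b"] pq(1,2) unfolding pattern_def by simp
    ultimately show ?thesis using that pq j by simp
  next
    case 2
    define j where "j = nat (int a + int b + 1 - elab k)"
    have j: "1 \<le> j" "j \<le> b" "elab k = int a + int b + 1 - int j" using 2 by (auto simp: j_def)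
    obtain p q where pq: "(n + a + 2 * j - 1) mod (4 * n) = p" "(n + a + 4 * n + 1 - 2 * j) mod (4 * n) = q"
      "p \<in> occ" "q \<in> occ" "arcBC p" "arcAB q" "elab p = int a + int b + 1 - int j" "elab q = int a + int b + 1 - int j"
      by (rule pairB[OF j(1,2)])
    have "p \<noteq> q" using arc_exclusive[OF pq(3)] pq(5,6) by blast
    moreover have "{p, q} \<in> pattern" using aa[OF j(1,2), of "n + a"] pq(1,2) unfolding pattern_def by simp
    ultimately show ?thesis using that pq j by simp
  next
    case 3
    define j where "j = nat (elab k + int c + 1)"
    have j: "1 \<le> j" "j \<le> c" "elab k = int j - int c - 1" using 3 by (auto simp: j_def)
    obtain p q where pq: "(3 * n - a + 2 * j - 1) mod (4 * n) = p" "(3 * n - a + 4 * n + 1 - 2 * j) mod (4 * n) = q"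
      "p \<in> occ" "q \<in> occ" "arcCA p" "arcBC q" "elab p = int j - int c - 1" "elab q = int j - int c - 1"
      by (rule pairC[OF j(1,2)])
    have "p \<noteq> q" using arc_exclusive[OF pq(3)] pq(5,6) by blast
    moreover have "{p, q} \<in> pattern" using aa[OF j(1,2), of "3 * n - a"] pq(1,2) unfolding pattern_def by simp
    ultimately show ?thesis using that pq j by simp
  qed
qed

lemma pattern_iff:
  assumes k: "k \<in> occ" and l: "l \<in> occ" and ne: "k \<noteq> l"
  shows "{k, l} \<in> pattern \<longleftrightarrow> elab k = elab l"
proof
  assume "{k, l} \<in> pattern"
  then obtain p q where "{k, l} = {p, q}" "elab p = elab q" by (rule pattern_D)
  then show "elab k = elab l" by (auto simp: doubleton_eq_iff)
next
  assume e: "elab k = elab l"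
  obtain p q where pq: "{p, q} \<in> pattern" "p \<noteq> q" "p \<in> occ" "q \<in> occ" "elab p = elab k" "elab q = elab k"
    using pattern_level[OF k] by blast
  have "m \<in> {p, q}" if m: "m \<in> occ" "elab m = elab k" for m
  proof (rule ccontr)
    assume "m \<notin> {p, q}"
    then have "p \<noteq> m" "q \<noteq> m" by blast+
    moreover have "elab m = elab p" "elab m = elab q" using m(2) pq(5,6) by simp_all
    ultimately have "p = q" using elab_two[OF m(1) pq(3,4)] by blast
    then show False using pq(2) by blast
  qed
  from this[OF k refl] this[OF l e[symmetric]] have "k \<in> {p, q}" "l \<in> {p, q}" by blast+
  then have "{k, l} = {p, q}" using ne by blast
  then show "{k, l} \<in> pattern" using pq(1) by simp
qed

text \<open>
From left to right only this is used of the pattern: no arch joins two external edges of one arc.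
From right to left, a linked pair has equal labels and so belongs to the pattern; and each end of an
arch is linked to something, which can only be the other end.
\<close>
theorem link_pattern_iff:
  assumes F: "F \<in> FPL n occ"
  shows "link_pattern n F = pattern \<longleftrightarrow> frozen (csum F)"
proof
  note li = linked_iff[OF F occ_sub]
  assume lp: "link_pattern n F = pattern"
  have un: "\<not> conn F (inn n k) (inn n l)" if "k \<in> occ" "l \<in> occ" "same_arc k l" "k \<noteq> l" for k l
  proof
    assume "conn F (inn n k) (inn n l)"
    moreover have kl: "k < 4 * n" "l < 4 * n" using that by (simp_all add: occ_def)
    ultimately have "linked n F k l" using li[OF kl] that by blast
    then have "{k, l} \<in> pattern" using lp kl unfolding link_pattern_def by blast
    then obtain p q where "{k, l} = {p, q}" "\<not> same_arc p q" by (rule pattern_D)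
    then show False using that(3) unfolding same_arc_def doubleton_eq_iff by blast
  qed
  show "frozen (csum F)"
    by (rule unlinked_frozen[OF F]) (use un in \<open>auto simp: same_arc_def\<close>)
next
  note li = linked_iff[OF F occ_sub]
  assume fr: "frozen (csum F)"
  show "link_pattern n F = pattern"
  proof
    show "link_pattern n F \<subseteq> pattern"
    proof
      fix e assume "e \<in> link_pattern n F"
      then obtain k l where kl: "e = {k, l}" "k < 4 * n" "l < 4 * n" "linked n F k l" unfolding link_pattern_def by blast
      then have "k \<noteq> l" "k \<in> occ" "l \<in> occ" "conn F (inn n k) (inn n l)" using li[OF kl(2,3)] by blast+
      then show "e \<in> pattern" using pattern_iff elab_conn[OF F fr] kl(1) by blast
    qed
    show "pattern \<subseteq> link_pattern n F"
    proof
      fix e assume e: "e \<in> pattern"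
      then obtain p q where pq: "e = {p, q}" "p \<in> occ" "q \<in> occ" "elab p = elab q" "\<not> same_arc p q" by (rule pattern_D)
      have pne: "p \<noteq> q"
      proof
        assume "p = q"
        moreover have "same_arc p p" using arcs[OF pq(2)] unfolding same_arc_def by blast
        ultimately show False using pq(5) by simp
      qed
      obtain l where l: "l \<in> occ" "l \<noteq> p" "conn F (inn n p) (inn n l)" by (rule partner_exists[OF F occ_sub pq(2)])
      have "elab p = elab l" using elab_conn[OF F fr] pq(2) l by blast
      then have lq: "l = q" by (rule elab_two[OF pq(2) l(1) pq(3) _ pq(4) l(2) pne[symmetric]])
      have "p < 4 * n" "q < 4 * n" using pq by (simp_all add: occ_def)
      then have "linked n F p q" using li[of p q] l pq(2) lq pne by blast
      then show "e \<in> link_pattern n F" using pq(1) \<open>p < 4 * n\<close> \<open>q < 4 * n\<close> unfolding link_pattern_def by blast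
    qed
  qed
qed

theorem pattern_bij:
  "\<exists>f. bij_betw f {F \<in> FPL n occ. link_pattern n F = pattern} (plane_partitions a b c)"
proof -
  have "{F \<in> FPL n occ. link_pattern n F = pattern} = {F \<in> FPL n occ. frozen (csum F)}"
    using link_pattern_iff by blast
  then show ?thesis using frozen_FPL_bij by auto
qed

end

section \<open>Gyration\<close>

text \<open>
Sides alternately occupied and unoccupied. The incomplete plaquettes along the perimeter never
qualify, so that gyration complements their edges.
\<close>
definition alt_face :: "nat \<Rightarrow> point set set \<Rightarrow> nat \<Rightarrow> nat \<Rightarrow> bool" where
  "alt_face n F i j \<longleftrightarrow> 1 \<le> i \<and> i < n \<and> 1 \<le> j \<and> j < n \<and>
    (vt i j \<in> F \<and> vt (Suc i) j \<in> F \<and> hz i j \<notin> F \<and> hz i (Suc j) \<notin> F \<or>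
     vt i j \<notin> F \<and> vt (Suc i) j \<notin> F \<and> hz i j \<in> F \<and> hz i (Suc j) \<in> F)"

text \<open>
Wieland's gyration on the plaquettes of one parity, given by \<open>r\<close>, followed by complementation: each
edge lies on exactly one plaquette of that parity, the alternating plaquettes are kept and all
others are complemented.
\<close>
definition gyration :: "nat \<Rightarrow> nat \<Rightarrow> point set set \<Rightarrow> point set set" where
  "gyration n r F = {vt x y | x y. 1 \<le> x \<and> x \<le> n \<and> y \<le> n \<and>
      (vt x y \<in> F \<longleftrightarrow> alt_face n F (if even (x + y + r) then x else x - 1) y)} \<union>
    {hz x y | x y. x \<le> n \<and> 1 \<le> y \<and> y \<le> n \<and>
      (hz x y \<in> F \<longleftrightarrow> alt_face n F x (if even (x + y + r) then y else y - 1))}"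

lemma vt_gyration: "vt x y \<in> gyration n r F \<longleftrightarrow> 1 \<le> x \<and> x \<le> n \<and> y \<le> n \<and>
    (vt x y \<in> F \<longleftrightarrow> alt_face n F (if even (x + y + r) then x else x - 1) y)"
  by (auto simp: gyration_def)
lemma hz_gyration: "hz x y \<in> gyration n r F \<longleftrightarrow> x \<le> n \<and> 1 \<le> y \<and> y \<le> n \<and>
    (hz x y \<in> F \<longleftrightarrow> alt_face n F x (if even (x + y + r) then y else y - 1))"
  by (auto simp: gyration_def)

lemma gyration_sub: "gyration n r F \<subseteq> edges n"
  by (auto simp: gyration_def)

lemma gyration_plaquette:
  assumes "even (i + j + r)"
  shows "1 \<le> i \<Longrightarrow> i \<le> n \<Longrightarrow> j \<le> n \<Longrightarrow> vt i j \<in> gyration n r F \<longleftrightarrow> (vt i j \<in> F \<longleftrightarrow> alt_face n F i j)"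
    "i < n \<Longrightarrow> j \<le> n \<Longrightarrow> vt (Suc i) j \<in> gyration n r F \<longleftrightarrow> (vt (Suc i) j \<in> F \<longleftrightarrow> alt_face n F i j)"
    "i \<le> n \<Longrightarrow> 1 \<le> j \<Longrightarrow> j \<le> n \<Longrightarrow> hz i j \<in> gyration n r F \<longleftrightarrow> (hz i j \<in> F \<longleftrightarrow> alt_face n F i j)"
    "i \<le> n \<Longrightarrow> j < n \<Longrightarrow> hz i (Suc j) \<in> gyration n r F \<longleftrightarrow> (hz i (Suc j) \<in> F \<longleftrightarrow> alt_face n F i j)"
  using assms by (simp_all add: vt_gyration hz_gyration)

lemma alt_face_gyration:
  assumes "even (i + j + r)"
  shows "alt_face n (gyration n r F) i j \<longleftrightarrow> alt_face n F i j"
proof (cases "1 \<le> i \<and> i < n \<and> 1 \<le> j \<and> j < n")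
  case False then show ?thesis by (auto simp: alt_face_def)
next
  case True
  then have g: "vt i j \<in> gyration n r F \<longleftrightarrow> (vt i j \<in> F \<longleftrightarrow> alt_face n F i j)"
    "vt (Suc i) j \<in> gyration n r F \<longleftrightarrow> (vt (Suc i) j \<in> F \<longleftrightarrow> alt_face n F i j)"
    "hz i j \<in> gyration n r F \<longleftrightarrow> (hz i j \<in> F \<longleftrightarrow> alt_face n F i j)"
    "hz i (Suc j) \<in> gyration n r F \<longleftrightarrow> (hz i (Suc j) \<in> F \<longleftrightarrow> alt_face n F i j)"
    using gyration_plaquette[OF assms, of n F] by simp_all
  show ?thesis
  proof (cases "alt_face n F i j")
    case a: True
    then show ?thesis unfolding alt_face_def[of n "gyration n r F"] g using a unfolding alt_face_def by simp
  next
    case a: False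
    then show ?thesis unfolding alt_face_def[of n "gyration n r F"] g using a True unfolding alt_face_def by blast
  qed
qed

lemma gyration_gyration:
  assumes "F \<subseteq> edges n" shows "gyration n r (gyration n r F) = F"
proof -
  have "e \<in> gyration n r (gyration n r F) \<longleftrightarrow> e \<in> F" if "e \<in> edges n" for e
    using that
  proof (cases rule: edges_cases)
    case (vt x y)
    define i where "i = (if even (x + y + r) then x else x - 1)"
    have "even (i + y + r)" using vt by (cases x) (auto simp: i_def)
    then have "alt_face n (gyration n r F) i y \<longleftrightarrow> alt_face n F i y" by (rule alt_face_gyration)
    then show ?thesis using vt unfolding vt(1) vt_gyration i_def[symmetric] by blast
  next
    case (hz x y)
    define j where "j = (if even (x + y + r) then y else y - 1)"
    have "even (x + j + r)" using hz by (cases y) (auto simp: j_def)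
    then have "alt_face n (gyration n r F) x j \<longleftrightarrow> alt_face n F x j" by (rule alt_face_gyration)
    then show ?thesis using hz unfolding hz(1) hz_gyration j_def[symmetric] by blast
  qed
  then show ?thesis using assms gyration_sub[of n r "gyration n r F"] by blast
qed

lemma gyration_ext:
  assumes k: "k < 4 * n"
  shows "ext_edge n k \<in> gyration n r F \<longleftrightarrow> ext_edge n k \<notin> F"
  using k
proof (cases rule: index_cases)
  case (top x) then show ?thesis using ext_edge_top[of x n] by (simp add: vt_gyration alt_face_def)
next
  case (right y) then show ?thesis using ext_edge_right[of y n] by (simp add: hz_gyration alt_face_def)
next
  case (bottom x) then show ?thesis using ext_edge_bottom[of x n] by (simp add: vt_gyration alt_face_def)
next
  case (left y) then show ?thesis using ext_edge_left[of y n] by (simp add: hz_gyration alt_face_def)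
qed

lemma alt_face_corner:
  assumes "alt_face n F i j"
  shows "vt i j \<in> F \<longleftrightarrow> hz i j \<notin> F" "vt i j \<in> F \<longleftrightarrow> hz i (Suc j) \<notin> F"
    "vt (Suc i) j \<in> F \<longleftrightarrow> hz i j \<notin> F" "vt (Suc i) j \<in> F \<longleftrightarrow> hz i (Suc j) \<notin> F"
  using assms unfolding alt_face_def by blast+

text \<open>
A vertex lies on two plaquettes of the given parity, with two of its edges on each. In an alternating
plaquette exactly one of the two edges at a corner is occupied, so keeping it or complementing it
gives the same degree; and complementing all four edges at a vertex keeps degree 2.
\<close>
lemma gyration_FPL:
  assumes F: "F \<in> FPL n Occ" and O: "Occ \<subseteq> {..<4 * n}"
  shows "gyration n r F \<in> FPL n ({..<4 * n} - Occ)"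
proof -
  have deg: "card {e \<in> gyration n r F. v \<in> e} = 2" if v: "v \<in> verts n" for v
  proof -
    obtain x y where xy: "v = (Suc x, Suc y)" "x < n" "y < n"
    proof -
      obtain x' y' where xy: "v = (x', y')" by (cases v)
      then have "1 \<le> x'" "x' \<le> n" "1 \<le> y'" "y' \<le> n" using v by (simp_all add: mem_verts)
      then show ?thesis using that[of "x' - 1" "y' - 1"] xy by auto
    qed
    have d: "of_bool (vt (Suc x) (Suc y) \<in> F) + of_bool (vt (Suc x) y \<in> F) +
      of_bool (hz (Suc x) (Suc y) \<in> F) + of_bool (hz x (Suc y) \<in> F) = (2::nat)"
      using degree_eq[OF FPL_D(1)[OF F], of x y] FPL_D(2)[OF F v] xy by simp
    show ?thesis
    proof (cases "even (x + y + r)")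
      case True
      then have p: "even (Suc x + Suc y + r)" by simp
      note g = gyration_plaquette(1,3)[OF p, of n F] gyration_plaquette(2,4)[OF True, of n F]
      show ?thesis unfolding xy(1) degree_eq[OF gyration_sub]
        using g xy d alt_face_corner(1)[of n F "Suc x" "Suc y"] alt_face_corner(4)[of n F x y]
        by (cases "alt_face n F (Suc x) (Suc y)"; cases "alt_face n F x y"; simp add: of_bool_def split: if_splits)
    next
      case False
      then have p: "even (Suc x + y + r)" "even (x + Suc y + r)" by simp_all
      note g = gyration_plaquette(1,4)[OF p(1), of n F] gyration_plaquette(2,3)[OF p(2), of n F]
      show ?thesis unfolding xy(1) degree_eq[OF gyration_sub]
        using g xy d alt_face_corner(2)[of n F "Suc x" y] alt_face_corner(3)[of n F x "Suc y"]
        by (cases "alt_face n F (Suc x) y"; cases "alt_face n F x (Suc y)"; simp add: of_bool_def split: if_splits)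
    qed
  qed
  have "ext_edge n k \<in> gyration n r F \<longleftrightarrow> k \<in> {..<4 * n} - Occ" if "k < 4 * n" for k
    using gyration_ext[OF that, of r F] FPL_D(4)[OF F that O] that by simp
  then have "gyration n r F \<inter> external_edges n = ext_edge n ` ({..<4 * n} - Occ)"
    unfolding external_edges_eq by auto
  then show ?thesis using deg gyration_sub by (simp add: FPL_def)
qed

text \<open>
Gyration moves paths only inside plaquettes: the corners at which a path of \<open>F\<close> enters and leaves
the plaquette \<open>(i, j)\<close> are those at which a path of the new configuration does, so the two paths can
be compared corner by corner. For a set \<open>f\<close> of vertices, \<open>face_ok\<close> says that the part of \<open>F\<close> in the
plaquette seen from its corner \<open>(x, y)\<close> is carried into \<open>f\<close>: if only one side at the corner is
occupied then the corner itself is in \<open>f\<close>, and if both sides are, then the corners where the path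
enters and leaves are. The notion is meant for \<open>f\<close> a union of components of the new
configuration.
\<close>
definition face_ok :: "nat \<Rightarrow> point set set \<Rightarrow> (point \<Rightarrow> bool) \<Rightarrow> nat \<Rightarrow> nat \<Rightarrow> nat \<Rightarrow> nat \<Rightarrow> bool" where
  "face_ok n F f i j x y \<longleftrightarrow> ((vt x j \<in> F) \<noteq> (hz i y \<in> F) \<longrightarrow> f (x, y)) \<and>
    (vt x j \<in> F \<and> hz i y \<in> F \<longrightarrow>
      ((i, j) \<in> verts n \<and> (vt i j \<in> F) \<noteq> (hz i j \<in> F) \<longrightarrow> f (i, j)) \<and>
      ((Suc i, j) \<in> verts n \<and> (vt (Suc i) j \<in> F) \<noteq> (hz i j \<in> F) \<longrightarrow> f (Suc i, j)) \<and>
      ((i, Suc j) \<in> verts n \<and> (vt i j \<in> F) \<noteq> (hz i (Suc j) \<in> F) \<longrightarrow> f (i, Suc j)) \<and>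
      ((Suc i, Suc j) \<in> verts n \<and> (vt (Suc i) j \<in> F) \<noteq> (hz i (Suc j) \<in> F) \<longrightarrow> f (Suc i, Suc j)))"

text \<open>
Both plaquettes of the given parity at a vertex are tested. Along an occupied edge this condition is
invariant, because the edge lies on one of these plaquettes at each of its ends, and the plaquette
through that edge decides.
\<close>
definition vertex_ok :: "nat \<Rightarrow> nat \<Rightarrow> point set set \<Rightarrow> (point \<Rightarrow> bool) \<Rightarrow> nat \<Rightarrow> nat \<Rightarrow> bool" where
  "vertex_ok n r F f x y \<longleftrightarrow> (if even (x + y + r) then face_ok n F f x y x y \<and> face_ok n F f (x - 1) (y - 1) x y
     else face_ok n F f (x - 1) y x y \<and> face_ok n F f x (y - 1) x y)"

text \<open>
The propositional content of the local invariance: \<open>W\<close>, \<open>E\<close>, \<open>S\<close>, \<open>N\<close> are the sides of a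
plaquette, the other letters the values of \<open>f\<close> at its corners, and \<open>c\<close> says that \<open>f\<close> is constant
along the sides occupied after gyration. There is one lemma for each side.
\<close>
lemma square_flip1:
  fixes W E S N sw se nw ne A :: bool
  assumes A: "A \<longleftrightarrow> W \<and> E \<and> \<not> S \<and> \<not> N \<or> \<not> W \<and> \<not> E \<and> S \<and> N"
    and c: "(W \<longleftrightarrow> A) \<longrightarrow> sw = nw" "(E \<longleftrightarrow> A) \<longrightarrow> se = ne" "(S \<longleftrightarrow> A) \<longrightarrow> sw = se" "(N \<longleftrightarrow> A) \<longrightarrow> nw = ne"
  shows "W \<Longrightarrow> ((W \<noteq> S \<longrightarrow> sw) \<and> (W \<and> S \<longrightarrow> ((W \<noteq> S \<longrightarrow> sw) \<and> (E \<noteq> S \<longrightarrow> se) \<and> (W \<noteq> N \<longrightarrow> nw) \<and> (E \<noteq> N \<longrightarrow> ne)))) = ((W \<noteq> N \<longrightarrow> nw) \<and> (W \<and> N \<longrightarrow> ((W \<noteq> S \<longrightarrow> sw) \<and> (E \<noteq> S \<longrightarrow> se) \<and> (W \<noteq> N \<longrightarrow> nw) \<and> (E \<noteq> N \<longrightarrow> ne))))"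
  using A c by argo

lemma square_flip2:
  fixes W E S N sw se nw ne A :: bool
  assumes A: "A \<longleftrightarrow> W \<and> E \<and> \<not> S \<and> \<not> N \<or> \<not> W \<and> \<not> E \<and> S \<and> N"
    and c: "(W \<longleftrightarrow> A) \<longrightarrow> sw = nw" "(E \<longleftrightarrow> A) \<longrightarrow> se = ne" "(S \<longleftrightarrow> A) \<longrightarrow> sw = se" "(N \<longleftrightarrow> A) \<longrightarrow> nw = ne"
  shows "E \<Longrightarrow> ((E \<noteq> S \<longrightarrow> se) \<and> (E \<and> S \<longrightarrow> ((W \<noteq> S \<longrightarrow> sw) \<and> (E \<noteq> S \<longrightarrow> se) \<and> (W \<noteq> N \<longrightarrow> nw) \<and> (E \<noteq> N \<longrightarrow> ne)))) = ((E \<noteq> N \<longrightarrow> ne) \<and> (E \<and> N \<longrightarrow> ((W \<noteq> S \<longrightarrow> sw) \<and> (E \<noteq> S \<longrightarrow> se) \<and> (W \<noteq> N \<longrightarrow> nw) \<and> (E \<noteq> N \<longrightarrow> ne))))"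
  using A c by argo

lemma square_flip3:
  fixes W E S N sw se nw ne A :: bool
  assumes A: "A \<longleftrightarrow> W \<and> E \<and> \<not> S \<and> \<not> N \<or> \<not> W \<and> \<not> E \<and> S \<and> N"
    and c: "(W \<longleftrightarrow> A) \<longrightarrow> sw = nw" "(E \<longleftrightarrow> A) \<longrightarrow> se = ne" "(S \<longleftrightarrow> A) \<longrightarrow> sw = se" "(N \<longleftrightarrow> A) \<longrightarrow> nw = ne"
  shows "S \<Longrightarrow> ((W \<noteq> S \<longrightarrow> sw) \<and> (W \<and> S \<longrightarrow> ((W \<noteq> S \<longrightarrow> sw) \<and> (E \<noteq> S \<longrightarrow> se) \<and> (W \<noteq> N \<longrightarrow> nw) \<and> (E \<noteq> N \<longrightarrow> ne)))) = ((E \<noteq> S \<longrightarrow> se) \<and> (E \<and> S \<longrightarrow> ((W \<noteq> S \<longrightarrow> sw) \<and> (E \<noteq> S \<longrightarrow> se) \<and> (W \<noteq> N \<longrightarrow> nw) \<and> (E \<noteq> N \<longrightarrow> ne))))"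
  using A c by argo

lemma square_flip4:
  fixes W E S N sw se nw ne A :: bool
  assumes A: "A \<longleftrightarrow> W \<and> E \<and> \<not> S \<and> \<not> N \<or> \<not> W \<and> \<not> E \<and> S \<and> N"
    and c: "(W \<longleftrightarrow> A) \<longrightarrow> sw = nw" "(E \<longleftrightarrow> A) \<longrightarrow> se = ne" "(S \<longleftrightarrow> A) \<longrightarrow> sw = se" "(N \<longleftrightarrow> A) \<longrightarrow> nw = ne"
  shows "N \<Longrightarrow> ((W \<noteq> N \<longrightarrow> nw) \<and> (W \<and> N \<longrightarrow> ((W \<noteq> S \<longrightarrow> sw) \<and> (E \<noteq> S \<longrightarrow> se) \<and> (W \<noteq> N \<longrightarrow> nw) \<and> (E \<noteq> N \<longrightarrow> ne)))) = ((E \<noteq> N \<longrightarrow> ne) \<and> (E \<and> N \<longrightarrow> ((W \<noteq> S \<longrightarrow> sw) \<and> (E \<noteq> S \<longrightarrow> se) \<and> (W \<noteq> N \<longrightarrow> nw) \<and> (E \<noteq> N \<longrightarrow> ne))))"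
  using A c by argo

text \<open>
The neighbouring external edge whose inner end lies on the same incomplete plaquette of the given
parity.
\<close>
definition mate :: "nat \<Rightarrow> nat \<Rightarrow> nat \<Rightarrow> nat" where
  "mate n r k = (if even (k + 1 + n + r) then Suc k mod (4 * n) else (k + 4 * n - 1) mod (4 * n))"

lemma mate_next: "even (k + 1 + n + r) \<Longrightarrow> Suc k < 4 * n \<Longrightarrow> mate n r k = Suc k"
  by (simp add: mate_def)
lemma mate_prev:
  assumes "odd (k + 1 + n + r)" "1 \<le> k" "k < 4 * n" shows "mate n r k = k - 1"
proof -
  have "k + 4 * n - 1 = k - 1 + 4 * n" using assms by simp
  then have "(k + 4 * n - 1) mod (4 * n) = (k - 1 + 4 * n) mod (4 * n)" by (simp only:)
  also have "\<dots> = (k - 1) mod (4 * n)" by (rule mod_add_self2)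
  also have "\<dots> = k - 1" using assms by (intro mod_less) linarith
  finally have "(k + 4 * n - 1) mod (4 * n) = k - 1" .
  then show ?thesis using assms(1) by (simp only: mate_def if_False)
qed

context
  fixes n r :: nat and Occ :: "nat set" and F :: "point set set" and f :: "point \<Rightarrow> bool"
  assumes F: "F \<in> FPL n Occ" and O: "Occ \<subseteq> {..<4 * n}"
    and al: "\<And>k. k < 4 * n \<Longrightarrow> k \<in> Occ \<longleftrightarrow> Suc k mod (4 * n) \<notin> Occ"
    and f: "\<And>u v. {u, v} \<in> gyration n r F \<Longrightarrow> f u = f v"
begin

text \<open>
An incomplete plaquette along the perimeter has exactly one of its two external edges occupied; the
last four statements concern the corners.
\<close>
lemma alternate_sides:
  "1 \<le> i \<Longrightarrow> i < n \<Longrightarrow> vt i n \<in> F \<longleftrightarrow> vt (Suc i) n \<notin> F"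
  "1 \<le> i \<Longrightarrow> i < n \<Longrightarrow> vt i 0 \<in> F \<longleftrightarrow> vt (Suc i) 0 \<notin> F"
  "1 \<le> j \<Longrightarrow> j < n \<Longrightarrow> hz 0 j \<in> F \<longleftrightarrow> hz 0 (Suc j) \<notin> F"
  "1 \<le> j \<Longrightarrow> j < n \<Longrightarrow> hz n j \<in> F \<longleftrightarrow> hz n (Suc j) \<notin> F"
  "1 \<le> n \<Longrightarrow> vt 1 n \<in> F \<longleftrightarrow> hz 0 n \<notin> F"
  "1 \<le> n \<Longrightarrow> vt n n \<in> F \<longleftrightarrow> hz n n \<notin> F"
  "1 \<le> n \<Longrightarrow> vt n 0 \<in> F \<longleftrightarrow> hz n 1 \<notin> F"
  "1 \<le> n \<Longrightarrow> vt 1 0 \<in> F \<longleftrightarrow> hz 0 1 \<notin> F"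
proof -
  have s: "ext_edge n k \<in> F \<longleftrightarrow> ext_edge n (Suc k) \<notin> F" if "Suc k < 4 * n" for k
    using al[of k] FPL_D(4)[OF F _ O, of k] FPL_D(4)[OF F _ O, of "Suc k"] that by simp
  show "vt i n \<in> F \<longleftrightarrow> vt (Suc i) n \<notin> F" if "1 \<le> i" "i < n"
    using s[of "i - 1"] ext_edge_top[of i n] ext_edge_top[of "Suc i" n] that by simp
  show "vt i 0 \<in> F \<longleftrightarrow> vt (Suc i) 0 \<notin> F" if "1 \<le> i" "i < n"
  proof -
    have "Suc (3 * n - Suc i) = 3 * n - i" using that by simp
    then show ?thesis using s[of "3 * n - Suc i"] ext_edge_bottom[of i n] ext_edge_bottom[of "Suc i" n] that by auto
  qed
  show "hz 0 j \<in> F \<longleftrightarrow> hz 0 (Suc j) \<notin> F" if "1 \<le> j" "j < n"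
    using s[of "3 * n + j - 1"] ext_edge_left[of j n] ext_edge_left[of "Suc j" n] that by simp
  show "hz n j \<in> F \<longleftrightarrow> hz n (Suc j) \<notin> F" if "1 \<le> j" "j < n"
  proof -
    have "Suc (2 * n - Suc j) = 2 * n - j" using that by simp
    then show ?thesis using s[of "2 * n - Suc j"] ext_edge_right[of j n] ext_edge_right[of "Suc j" n] that by auto
  qed
  assume n1: "1 \<le> n"
  have "Suc (4 * n - 1) mod (4 * n) = 0" using n1 by simp
  then have "ext_edge n (4 * n - 1) \<in> F \<longleftrightarrow> ext_edge n 0 \<notin> F"
    using al[of "4 * n - 1"] FPL_D(4)[OF F _ O, of "4 * n - 1"] FPL_D(4)[OF F _ O, of 0] n1 by simp
  moreover have "3 * n + n - 1 = 4 * n - 1" by simp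
  ultimately show "vt 1 n \<in> F \<longleftrightarrow> hz 0 n \<notin> F" using ext_edge_left[of n n] ext_edge_top[of 1 n] n1 by auto
  have "Suc (n - 1) = 2 * n - n" using n1 by simp
  then show "vt n n \<in> F \<longleftrightarrow> hz n n \<notin> F" using s[of "n - 1"] ext_edge_top[of n n] ext_edge_right[of n n] n1 by auto
  have "Suc (2 * n - 1) = 3 * n - n" using n1 by simp
  then show "vt n 0 \<in> F \<longleftrightarrow> hz n 1 \<notin> F" using s[of "2 * n - 1"] ext_edge_bottom[of n n] ext_edge_right[of 1 n] n1 by auto
  have "Suc (3 * n - 1) = 3 * n + 1 - 1" using n1 by simp
  then show "vt 1 0 \<in> F \<longleftrightarrow> hz 0 1 \<notin> F" using s[of "3 * n - 1"] ext_edge_bottom[of 1 n] ext_edge_left[of 1 n] n1 by auto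
qed

lemma no_edge: "vt 0 y \<notin> F" "vt (Suc n) y \<notin> F" "hz x 0 \<notin> F" "hz x (Suc n) \<notin> F"
  using FPL_D(1)[OF F] vt_in_edges hz_in_edges by (metis not_less_eq_eq order_refl subsetD not_one_le_zero)+

lemma f_plaquette:
  assumes "even (i + j + r)"
  shows "1 \<le> i \<Longrightarrow> i \<le> n \<Longrightarrow> j \<le> n \<Longrightarrow> (vt i j \<in> F \<longleftrightarrow> alt_face n F i j) \<Longrightarrow> f (i, j) = f (i, Suc j)"
    "i < n \<Longrightarrow> j \<le> n \<Longrightarrow> (vt (Suc i) j \<in> F \<longleftrightarrow> alt_face n F i j) \<Longrightarrow> f (Suc i, j) = f (Suc i, Suc j)"
    "i \<le> n \<Longrightarrow> 1 \<le> j \<Longrightarrow> j \<le> n \<Longrightarrow> (hz i j \<in> F \<longleftrightarrow> alt_face n F i j) \<Longrightarrow> f (i, j) = f (Suc i, j)"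
    "i \<le> n \<Longrightarrow> j < n \<Longrightarrow> (hz i (Suc j) \<in> F \<longleftrightarrow> alt_face n F i j) \<Longrightarrow> f (i, Suc j) = f (Suc i, Suc j)"
  using gyration_plaquette[OF assms, of n F] f unfolding vt_def hz_def by blast+

lemma face_ok_interior:
  assumes e: "even (i + j + r)" and ij: "1 \<le> i" "i < n" "1 \<le> j" "j < n"
  shows "vt i j \<in> F \<Longrightarrow> face_ok n F f i j i j = face_ok n F f i j i (Suc j)"
    "vt (Suc i) j \<in> F \<Longrightarrow> face_ok n F f i j (Suc i) j = face_ok n F f i j (Suc i) (Suc j)"
    "hz i j \<in> F \<Longrightarrow> face_ok n F f i j i j = face_ok n F f i j (Suc i) j"
    "hz i (Suc j) \<in> F \<Longrightarrow> face_ok n F f i j i (Suc j) = face_ok n F f i j (Suc i) (Suc j)"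
proof -
  have v: "(i, j) \<in> verts n" "(Suc i, j) \<in> verts n" "(i, Suc j) \<in> verts n" "(Suc i, Suc j) \<in> verts n"
    using ij by (simp_all add: mem_verts)
  have A: "alt_face n F i j \<longleftrightarrow> vt i j \<in> F \<and> vt (Suc i) j \<in> F \<and> hz i j \<notin> F \<and> hz i (Suc j) \<notin> F \<or>
     vt i j \<notin> F \<and> vt (Suc i) j \<notin> F \<and> hz i j \<in> F \<and> hz i (Suc j) \<in> F" using ij by (simp add: alt_face_def)
  note c = f_plaquette[OF e]
  have c': "(vt i j \<in> F \<longleftrightarrow> alt_face n F i j) \<longrightarrow> f (i, j) = f (i, Suc j)"
    "(vt (Suc i) j \<in> F \<longleftrightarrow> alt_face n F i j) \<longrightarrow> f (Suc i, j) = f (Suc i, Suc j)"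
    "(hz i j \<in> F \<longleftrightarrow> alt_face n F i j) \<longrightarrow> f (i, j) = f (Suc i, j)"
    "(hz i (Suc j) \<in> F \<longleftrightarrow> alt_face n F i j) \<longrightarrow> f (i, Suc j) = f (Suc i, Suc j)"
    using c ij by (simp_all only: less_imp_le simp_thms) blast+
  note sf = square_flip1[OF A c'] square_flip2[OF A c'] square_flip3[OF A c'] square_flip4[OF A c']
  show "vt i j \<in> F \<Longrightarrow> face_ok n F f i j i j = face_ok n F f i j i (Suc j)"
    "vt (Suc i) j \<in> F \<Longrightarrow> face_ok n F f i j (Suc i) j = face_ok n F f i j (Suc i) (Suc j)"
    "hz i j \<in> F \<Longrightarrow> face_ok n F f i j i j = face_ok n F f i j (Suc i) j"
    "hz i (Suc j) \<in> F \<Longrightarrow> face_ok n F f i j i (Suc j) = face_ok n F f i j (Suc i) (Suc j)"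
    using sf unfolding face_ok_def by (simp_all only: v simp_thms)
qed

text \<open>
On the perimeter the missing side of an incomplete plaquette counts as unoccupied, and the
alternation of the external edges takes the place of the alternating case.
\<close>
lemma face_ok_vt:
  assumes "1 \<le> j" "j < n"
  shows "even (i + j + r) \<Longrightarrow> 1 \<le> i \<Longrightarrow> i \<le> n \<Longrightarrow> vt i j \<in> F \<Longrightarrow> face_ok n F f i j i j = face_ok n F f i j i (Suc j)"
    "even (i + j + r) \<Longrightarrow> i < n \<Longrightarrow> vt (Suc i) j \<in> F \<Longrightarrow> face_ok n F f i j (Suc i) j = face_ok n F f i j (Suc i) (Suc j)"
proof -
  show "face_ok n F f i j i j = face_ok n F f i j i (Suc j)" if "even (i + j + r)" "1 \<le> i" "i \<le> n" "vt i j \<in> F"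
  proof (cases "i < n")
    case True then show ?thesis using face_ok_interior(1) that assms by blast
  next
    case False
    then have i: "i = n" using that by simp
    have "(Suc n, j) \<notin> verts n" "(Suc n, Suc j) \<notin> verts n" by (simp_all add: mem_verts)
    then show ?thesis using that(4) alternate_sides(4)[of j] assms no_edge unfolding i face_ok_def by (simp add: mem_verts) blast
  qed
  show "face_ok n F f i j (Suc i) j = face_ok n F f i j (Suc i) (Suc j)" if "even (i + j + r)" "i < n" "vt (Suc i) j \<in> F"
  proof (cases "1 \<le> i")
    case True then show ?thesis using face_ok_interior(2) that assms by blast
  next
    case False
    then have i: "i = 0" by simp
    show ?thesis using that(2,3) alternate_sides(3)[of j] assms no_edge unfolding i face_ok_def by (simp add: mem_verts) blast
  qed
qed

lemma face_ok_hz: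
  assumes "1 \<le> i" "i < n"
  shows "even (i + j + r) \<Longrightarrow> 1 \<le> j \<Longrightarrow> j \<le> n \<Longrightarrow> hz i j \<in> F \<Longrightarrow> face_ok n F f i j i j = face_ok n F f i j (Suc i) j"
    "even (i + j + r) \<Longrightarrow> j < n \<Longrightarrow> hz i (Suc j) \<in> F \<Longrightarrow> face_ok n F f i j i (Suc j) = face_ok n F f i j (Suc i) (Suc j)"
proof -
  show "face_ok n F f i j i j = face_ok n F f i j (Suc i) j" if "even (i + j + r)" "1 \<le> j" "j \<le> n" "hz i j \<in> F"
  proof (cases "j < n")
    case True then show ?thesis using face_ok_interior(3) that assms by blast
  next
    case False
    then have j: "j = n" using that by simp
    show ?thesis using that(4) alternate_sides(1)[of i] assms no_edge unfolding j face_ok_def by (simp add: mem_verts) blast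
  qed
  show "face_ok n F f i j i (Suc j) = face_ok n F f i j (Suc i) (Suc j)" if "even (i + j + r)" "j < n" "hz i (Suc j) \<in> F"
  proof (cases "1 \<le> j")
    case True then show ?thesis using face_ok_interior(4) that assms by blast
  next
    case False
    then have j: "j = 0" by simp
    show ?thesis using that(2,3) alternate_sides(2)[of i] assms no_edge unfolding j face_ok_def by (simp add: mem_verts) blast
  qed
qed

lemma degree_bool:
  assumes "x < n" "y < n"
  shows "of_bool (vt (Suc x) (Suc y) \<in> F) + of_bool (vt (Suc x) y \<in> F) +
      of_bool (hz (Suc x) (Suc y) \<in> F) + of_bool (hz x (Suc y) \<in> F) = (2::nat)"
  using degree_eq[OF FPL_D(1)[OF F], of x y] FPL_D(2)[OF F, of "(Suc x, Suc y)"] assms by (simp add: mem_verts)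

text \<open>
By degree 2, if exactly one side of this plaquette is occupied at the vertex then the same holds for
the other plaquette, with the same condition; and if both are, the other condition is void.
\<close>
lemma vertex_ok_from_plaquette:
  assumes xy: "x < n" "y < n"
  shows "even (x + y + r) \<Longrightarrow> vt (Suc x) (Suc y) \<in> F \<or> hz (Suc x) (Suc y) \<in> F \<Longrightarrow>
      vertex_ok n r F f (Suc x) (Suc y) = face_ok n F f (Suc x) (Suc y) (Suc x) (Suc y)"
    "even (x + y + r) \<Longrightarrow> vt (Suc x) y \<in> F \<or> hz x (Suc y) \<in> F \<Longrightarrow>
      vertex_ok n r F f (Suc x) (Suc y) = face_ok n F f x y (Suc x) (Suc y)"
    "odd (x + y + r) \<Longrightarrow> vt (Suc x) (Suc y) \<in> F \<or> hz x (Suc y) \<in> F \<Longrightarrow>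
      vertex_ok n r F f (Suc x) (Suc y) = face_ok n F f x (Suc y) (Suc x) (Suc y)"
    "odd (x + y + r) \<Longrightarrow> vt (Suc x) y \<in> F \<or> hz (Suc x) (Suc y) \<in> F \<Longrightarrow>
      vertex_ok n r F f (Suc x) (Suc y) = face_ok n F f (Suc x) y (Suc x) (Suc y)"
proof -
  note d = degree_bool[OF xy]
  have p: "even (Suc x + Suc y + r) \<longleftrightarrow> even (x + y + r)" by simp
  have q: "Suc x - 1 = x" "Suc y - 1 = y" by simp_all
  show "vertex_ok n r F f (Suc x) (Suc y) = face_ok n F f (Suc x) (Suc y) (Suc x) (Suc y)"
    if "even (x + y + r)" "vt (Suc x) (Suc y) \<in> F \<or> hz (Suc x) (Suc y) \<in> F"
    using d that unfolding vertex_ok_def p q face_ok_def[of n F f x y] face_ok_def[of n F f "Suc x" "Suc y"]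
    by (cases "vt (Suc x) (Suc y) \<in> F"; cases "hz (Suc x) (Suc y) \<in> F"; cases "vt (Suc x) y \<in> F"; cases "hz x (Suc y) \<in> F"; simp)
  show "vertex_ok n r F f (Suc x) (Suc y) = face_ok n F f x y (Suc x) (Suc y)"
    if "even (x + y + r)" "vt (Suc x) y \<in> F \<or> hz x (Suc y) \<in> F"
    using d that unfolding vertex_ok_def p q face_ok_def[of n F f x y] face_ok_def[of n F f "Suc x" "Suc y"]
    by (cases "vt (Suc x) (Suc y) \<in> F"; cases "hz (Suc x) (Suc y) \<in> F"; cases "vt (Suc x) y \<in> F"; cases "hz x (Suc y) \<in> F"; simp)
  show "vertex_ok n r F f (Suc x) (Suc y) = face_ok n F f x (Suc y) (Suc x) (Suc y)"
    if "odd (x + y + r)" "vt (Suc x) (Suc y) \<in> F \<or> hz x (Suc y) \<in> F"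
    using d that unfolding vertex_ok_def p q face_ok_def[of n F f x "Suc y"] face_ok_def[of n F f "Suc x" y]
    by (cases "vt (Suc x) (Suc y) \<in> F"; cases "hz (Suc x) (Suc y) \<in> F"; cases "vt (Suc x) y \<in> F"; cases "hz x (Suc y) \<in> F"; simp)
  show "vertex_ok n r F f (Suc x) (Suc y) = face_ok n F f (Suc x) y (Suc x) (Suc y)"
    if "odd (x + y + r)" "vt (Suc x) y \<in> F \<or> hz (Suc x) (Suc y) \<in> F"
    using d that unfolding vertex_ok_def p q face_ok_def[of n F f x "Suc y"] face_ok_def[of n F f "Suc x" y]
    by (cases "vt (Suc x) (Suc y) \<in> F"; cases "hz (Suc x) (Suc y) \<in> F"; cases "vt (Suc x) y \<in> F"; cases "hz x (Suc y) \<in> F"; simp)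
qed

lemma vertex_ok_vt:
  assumes e: "vt x y \<in> F" and xy: "1 \<le> x" "x \<le> n" "1 \<le> y" "y < n"
  shows "vertex_ok n r F f x y = vertex_ok n r F f x (Suc y)"
proof -
  obtain x' y' where s: "x = Suc x'" "y = Suc y'" using xy by (cases x; cases y) auto
  have b: "x' < n" "y' < n" "Suc y' < n" using xy s by auto
  show ?thesis
  proof (cases "even (x' + y' + r)")
    case True
    then have p: "odd (x' + Suc y' + r)" "even (Suc x' + Suc y' + r)" by simp_all
    show ?thesis using vertex_ok_from_plaquette(1)[OF b(1,2) True] vertex_ok_from_plaquette(4)[OF b(1,3) p(1)]
        face_ok_vt(1)[OF _ _ p(2)] e xy unfolding s by simp
  next
    case False
    then have p: "even (x' + Suc y' + r)" by simp
    show ?thesis using vertex_ok_from_plaquette(3)[OF b(1,2) False] vertex_ok_from_plaquette(2)[OF b(1,3) p]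
        face_ok_vt(2)[OF _ _ p] e xy unfolding s by simp
  qed
qed

lemma vertex_ok_hz:
  assumes e: "hz x y \<in> F" and xy: "1 \<le> x" "x < n" "1 \<le> y" "y \<le> n"
  shows "vertex_ok n r F f x y = vertex_ok n r F f (Suc x) y"
proof -
  obtain x' y' where s: "x = Suc x'" "y = Suc y'" using xy by (cases x; cases y) auto
  have b: "x' < n" "y' < n" "Suc x' < n" using xy s by auto
  show ?thesis
  proof (cases "even (x' + y' + r)")
    case True
    then have p: "odd (Suc x' + y' + r)" "even (Suc x' + Suc y' + r)" by simp_all
    show ?thesis using vertex_ok_from_plaquette(1)[OF b(1,2) True] vertex_ok_from_plaquette(3)[OF b(3,2) p(1)]
        face_ok_hz(1)[OF _ _ p(2)] e xy unfolding s by simp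
  next
    case False
    then have p: "even (Suc x' + y' + r)" by simp
    show ?thesis using vertex_ok_from_plaquette(4)[OF b(1,2) False] vertex_ok_from_plaquette(2)[OF b(3,2) p]
        face_ok_hz(2)[OF _ _ p] e xy unfolding s by simp
  qed
qed

lemma vertex_ok_conn:
  assumes c: "conn F u v" and u: "u = (x, y)" "u \<in> verts n" "vertex_ok n r F f x y" and v: "v = (x', y')" "v \<in> verts n"
  shows "vertex_ok n r F f x' y'"
proof -
  define g where "g = (\<lambda>(x, y). vertex_ok n r F f x y)"
  have gm: "g (x, y) = vertex_ok n r F f x y" for x y by (simp add: g_def)
  have "g v = g u"
    by (rule conn_constant[OF FPL_D(1)[OF F] c u(2) v(2)]) (unfold gm, (rule vertex_ok_vt vertex_ok_hz; assumption)+)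
  then show ?thesis using u v by (simp add: gm)
qed

text \<open>
At an occupied external edge the incomplete plaquette is entered from outside, and the path of the
new configuration leaves through the neighbouring external edge. The next lemmas are the same for
the other sides and the corners.
\<close>
lemma vertex_ok_top:
  assumes i: "1 \<le> i" "i < n" "even (i + n + r)"
  shows "vt i n \<in> F \<Longrightarrow> vertex_ok n r F f i n = f (Suc i, n)" "vt (Suc i) n \<in> F \<Longrightarrow> vertex_ok n r F f (Suc i) n = f (i, n)"
proof -
  obtain x' y' where s: "i = Suc x'" "n = Suc y'" using i by (cases i; cases n) auto
  have p: "even (x' + y' + r)" "odd (i + y' + r)" using i(3) unfolding s by simp_all
  note a = alternate_sides(1)[OF i(1,2)]
  have t: "hz i n \<notin> F \<Longrightarrow> f (i, n) = f (Suc i, n)" using f_plaquette(3)[OF i(3)] i by (simp add: alt_face_def)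
  show "vertex_ok n r F f i n = f (Suc i, n)" if e: "vt i n \<in> F"
  proof -
    have "vertex_ok n r F f i n = face_ok n F f i n i n" using vertex_ok_from_plaquette(1)[of x' y'] p e i s by simp
    also have "\<dots> = f (Suc i, n)" using e a t i unfolding face_ok_def by (cases "hz i n \<in> F") (simp_all add: mem_verts)
    finally show ?thesis .
  qed
  show "vertex_ok n r F f (Suc i) n = f (i, n)" if e: "vt (Suc i) n \<in> F"
  proof -
    have "vertex_ok n r F f (Suc i) n = face_ok n F f i n (Suc i) n" using vertex_ok_from_plaquette(3)[of i y'] p e i s by simp
    also have "\<dots> = f (i, n)" using e a t i unfolding face_ok_def by (cases "hz i n \<in> F") (simp_all add: mem_verts)
    finally show ?thesis .
  qed
qed

lemma vertex_ok_bottom: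
  assumes i: "1 \<le> i" "i < n" "even (i + r)"
  shows "vt i 0 \<in> F \<Longrightarrow> vertex_ok n r F f i 1 = f (Suc i, 1)" "vt (Suc i) 0 \<in> F \<Longrightarrow> vertex_ok n r F f (Suc i) 1 = f (i, 1)"
proof -
  obtain x' where s: "i = Suc x'" using i by (cases i) auto
  have p: "odd (x' + 0 + r)" "even (i + 0 + r)" using i(3) unfolding s by simp_all
  note a = alternate_sides(2)[OF i(1,2)]
  have t: "hz i 1 \<notin> F \<Longrightarrow> f (i, 1) = f (Suc i, 1)" using f_plaquette(4)[OF p(2)] i by (simp add: alt_face_def)
  show "vertex_ok n r F f i 1 = f (Suc i, 1)" if e: "vt i 0 \<in> F"
  proof -
    have "vertex_ok n r F f i 1 = face_ok n F f i 0 i 1" using vertex_ok_from_plaquette(4)[of x' 0] p e i s by simp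
    also have "\<dots> = f (Suc i, 1)" using e a t i no_edge unfolding face_ok_def by (cases "hz i 1 \<in> F") (simp_all add: mem_verts)
    finally show ?thesis .
  qed
  show "vertex_ok n r F f (Suc i) 1 = f (i, 1)" if e: "vt (Suc i) 0 \<in> F"
  proof -
    have "vertex_ok n r F f (Suc i) 1 = face_ok n F f i 0 (Suc i) 1" using vertex_ok_from_plaquette(2)[of i 0] p e i s by simp
    also have "\<dots> = f (i, 1)" using e a t i no_edge unfolding face_ok_def by (cases "hz i 1 \<in> F") (simp_all add: mem_verts)
    finally show ?thesis .
  qed
qed

lemma vertex_ok_left:
  assumes j: "1 \<le> j" "j < n" "even (j + r)"
  shows "hz 0 j \<in> F \<Longrightarrow> vertex_ok n r F f 1 j = f (1, Suc j)" "hz 0 (Suc j) \<in> F \<Longrightarrow> vertex_ok n r F f 1 (Suc j) = f (1, j)"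
proof -
  obtain y' where s: "j = Suc y'" using j by (cases j) auto
  have p: "odd (0 + y' + r)" "even (0 + j + r)" using j(3) unfolding s by simp_all
  note a = alternate_sides(3)[OF j(1,2)]
  have t: "vt 1 j \<notin> F \<Longrightarrow> f (1, j) = f (1, Suc j)" using f_plaquette(2)[OF p(2)] j by (simp add: alt_face_def)
  show "vertex_ok n r F f 1 j = f (1, Suc j)" if e: "hz 0 j \<in> F"
  proof -
    have "vertex_ok n r F f 1 j = face_ok n F f 0 j 1 j" using vertex_ok_from_plaquette(3)[of 0 y'] p e j s by simp
    also have "\<dots> = f (1, Suc j)" using e a t j no_edge unfolding face_ok_def by (cases "vt 1 j \<in> F") (simp_all add: mem_verts)
    finally show ?thesis .
  qed
  show "vertex_ok n r F f 1 (Suc j) = f (1, j)" if e: "hz 0 (Suc j) \<in> F"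
  proof -
    have "vertex_ok n r F f 1 (Suc j) = face_ok n F f 0 j 1 (Suc j)" using vertex_ok_from_plaquette(2)[of 0 j] p e j s by simp
    also have "\<dots> = f (1, j)" using e a t j no_edge unfolding face_ok_def by (cases "vt 1 j \<in> F") (simp_all add: mem_verts)
    finally show ?thesis .
  qed
qed

lemma vertex_ok_right:
  assumes j: "1 \<le> j" "j < n" "even (n + j + r)"
  shows "hz n j \<in> F \<Longrightarrow> vertex_ok n r F f n j = f (n, Suc j)" "hz n (Suc j) \<in> F \<Longrightarrow> vertex_ok n r F f n (Suc j) = f (n, j)"
proof -
  obtain x' y' where s: "n = Suc x'" "j = Suc y'" using j by (cases j; cases n) auto
  have p: "even (x' + y' + r)" "odd (x' + j + r)" using j(3) unfolding s by simp_all
  note a = alternate_sides(4)[OF j(1,2)]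
  have t: "vt n j \<notin> F \<Longrightarrow> f (n, j) = f (n, Suc j)" using f_plaquette(1)[OF j(3)] j by (simp add: alt_face_def)
  show "vertex_ok n r F f n j = f (n, Suc j)" if e: "hz n j \<in> F"
  proof -
    have "vertex_ok n r F f n j = face_ok n F f n j n j" using vertex_ok_from_plaquette(1)[of x' y'] p e j s by simp
    also have "\<dots> = f (n, Suc j)" using e a t j no_edge unfolding face_ok_def by (cases "vt n j \<in> F") (simp_all add: mem_verts)
    finally show ?thesis .
  qed
  show "vertex_ok n r F f n (Suc j) = f (n, j)" if e: "hz n (Suc j) \<in> F"
  proof -
    have "vertex_ok n r F f n (Suc j) = face_ok n F f n j n (Suc j)" using vertex_ok_from_plaquette(4)[of x' j] p e j s by simp
    also have "\<dots> = f (n, j)" using e a t j no_edge unfolding face_ok_def by (cases "vt n j \<in> F") (simp_all add: mem_verts)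
    finally show ?thesis .
  qed
qed

lemma vertex_ok_corners:
  assumes n: "1 \<le> n"
  shows "even (n + r) \<Longrightarrow> vertex_ok n r F f 1 n = f (1, n)"
    "even r \<Longrightarrow> vertex_ok n r F f n n = f (n, n)"
    "even (n + r) \<Longrightarrow> vertex_ok n r F f n 1 = f (n, 1)"
    "even r \<Longrightarrow> vertex_ok n r F f 1 1 = f (1, 1)"
proof -
  obtain m where s: "n = Suc m" using n by (cases n) auto
  note a = alternate_sides(5-8)[OF n]
  have m: "m < n" "0 < n" using s by simp_all
  show "vertex_ok n r F f 1 n = f (1, n)" if e: "even (n + r)"
  proof -
    have "odd (0 + m + r)" using e s by simp
    then have "vertex_ok n r F f 1 n = face_ok n F f 0 n 1 n" using vertex_ok_from_plaquette(3)[of 0 m] a(1) m s by auto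
    also have "\<dots> = f (1, n)" using a(1) unfolding face_ok_def by blast
    finally show ?thesis .
  qed
  show "vertex_ok n r F f n n = f (n, n)" if e: "even r"
  proof -
    have "even (m + m + r)" using e by simp
    then have "vertex_ok n r F f n n = face_ok n F f n n n n" using vertex_ok_from_plaquette(1)[of m m] a(2) m s by auto
    also have "\<dots> = f (n, n)" using a(2) unfolding face_ok_def by blast
    finally show ?thesis .
  qed
  show "vertex_ok n r F f n 1 = f (n, 1)" if e: "even (n + r)"
  proof -
    have "odd (m + 0 + r)" using e s by simp
    then have "vertex_ok n r F f n 1 = face_ok n F f n 0 n 1" using vertex_ok_from_plaquette(4)[of m 0] a(3) m s by auto
    also have "\<dots> = f (n, 1)" using a(3) unfolding face_ok_def by blast
    finally show ?thesis .
  qed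
  show "vertex_ok n r F f 1 1 = f (1, 1)" if e: "even r"
  proof -
    have "even (0 + 0 + r)" using e by simp
    then have "vertex_ok n r F f 1 1 = face_ok n F f 0 0 1 1" using vertex_ok_from_plaquette(2)[of 0 0] a(4) m s by auto
    also have "\<dots> = f (1, 1)" using a(4) unfolding face_ok_def by auto
    finally show ?thesis .
  qed
qed

lemma vertex_ok_mate:
  assumes k: "k \<in> Occ" and i: "inn n k = (x, y)"
  shows "vertex_ok n r F f x y = f (inn n (mate n r k))"
proof -
  have k4: "k < 4 * n" using k O by auto
  have ek: "ext_edge n k \<in> F" using FPL_D(4)[OF F k4 O] k by simp
  have n1: "1 \<le> n" using k4 by simp
  from k4 show ?thesis
  proof (cases rule: index_cases)
    case (top z)
    have xy: "x = z" "y = n" using i inn_top[of z n] top by simp_all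
    have e: "vt z n \<in> F" using ek ext_edge_top[of z n] top by simp
    show ?thesis
    proof (cases "even (z + n + r)")
      case True
      then have ev: "even (k + 1 + n + r)" using top by simp
      show ?thesis
      proof (cases "z < n")
        case True
        then have "mate n r k = Suc z - 1" using mate_next[OF ev] top by simp
        then show ?thesis using vertex_ok_top(1)[of z] inn_top[of "Suc z" n] True \<open>even (z + n + r)\<close> top e xy by simp
      next
        case False
        then have z: "z = n" using top by simp
        then have "mate n r k = 2 * n - n" using mate_next[OF ev] top n1 by simp
        then show ?thesis using vertex_ok_corners(2)[OF n1] inn_right[of n n] \<open>even (z + n + r)\<close> z xy n1 by simp
      qed
    next
      case False
      then have od: "odd (k + 1 + n + r)" using top by simp
      show ?thesis
      proof (cases "z = 1")
        case True
        then have "k + 4 * n - 1 = 3 * n + n - 1" using top by simp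
        then have "mate n r k = 3 * n + n - 1" using od n1 by (simp add: mate_def)
        then show ?thesis using vertex_ok_corners(1)[OF n1] inn_left[of n n] False True xy n1 by simp
      next
        case z: False
        then have "mate n r k = z - 1 - 1" using mate_prev[OF od _ k4] top by simp
        moreover have "even (z - 1 + n + r)" using False z top by (cases z) auto
        ultimately show ?thesis using vertex_ok_top(2)[of "z - 1"] inn_top[of "z - 1" n] z top e xy by simp
      qed
    qed
  next
    case (right z)
    have xy: "x = n" "y = z" using i inn_right[of z n] right by simp_all
    have e: "hz n z \<in> F" using ek ext_edge_right[of z n] right by simp
    have par: "even (k + 1 + n + r) \<longleftrightarrow> odd (n + z + r)" using right by (simp, argo)
    show ?thesis
    proof (cases "even (n + z + r)")
      case True
      then have od: "odd (k + 1 + n + r)" using par by blast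
      have "mate n r k = k - 1" by (rule mate_prev[OF od _ k4]) (use right in linarith)
      show ?thesis
      proof (cases "z < n")
        case True
        then have "mate n r k = 2 * n - Suc z" using \<open>mate n r k = k - 1\<close> right by simp
        then show ?thesis using vertex_ok_right(1)[of z] inn_right[of "Suc z" n] True \<open>even (n + z + r)\<close> right e xy by simp
      next
        case False
        then have z: "z = n" using right by simp
        then have "mate n r k = n - 1" using \<open>mate n r k = k - 1\<close> right by simp
        then show ?thesis using vertex_ok_corners(2)[OF n1] inn_top[of n n] \<open>even (n + z + r)\<close> z xy n1 by simp
      qed
    next
      case False
      then have ev: "even (k + 1 + n + r)" using par by blast
      have m: "mate n r k = Suc k" by (rule mate_next[OF ev]) (use right in linarith)
      show ?thesis
      proof (cases "z = 1")
        case True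
        then have "mate n r k = 3 * n - n" using m right n1 by simp
        then show ?thesis using vertex_ok_corners(3)[OF n1] inn_bottom[of n n] False True xy n1 by simp
      next
        case z: False
        then have "mate n r k = 2 * n - (z - 1)" using m right by simp
        moreover have "even (n + (z - 1) + r)" using False z right by (cases z) auto
        ultimately show ?thesis using vertex_ok_right(2)[of "z - 1"] inn_right[of "z - 1" n] z right e xy by simp
      qed
    qed
  next
    case (bottom z)
    have xy: "x = z" "y = 1" using i inn_bottom[of z n] bottom by simp_all
    have e: "vt z 0 \<in> F" using ek ext_edge_bottom[of z n] bottom by simp
    have par: "even (k + 1 + n + r) \<longleftrightarrow> odd (z + r)" using bottom by (simp, argo)
    show ?thesis
    proof (cases "even (z + r)")
      case True
      then have od: "odd (k + 1 + n + r)" using par by blast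
      have m: "mate n r k = k - 1" by (rule mate_prev[OF od _ k4]) (use bottom n1 in linarith)
      show ?thesis
      proof (cases "z < n")
        case True
        then have "mate n r k = 3 * n - Suc z" using m bottom by simp
        then show ?thesis using vertex_ok_bottom(1)[of z] inn_bottom[of "Suc z" n] True \<open>even (z + r)\<close> bottom e xy by simp
      next
        case False
        then have z: "z = n" using bottom by simp
        then have "mate n r k = 2 * n - 1" using m bottom by simp
        then show ?thesis using vertex_ok_corners(3)[OF n1] inn_right[of 1 n] \<open>even (z + r)\<close> z xy n1 by simp
      qed
    next
      case False
      then have ev: "even (k + 1 + n + r)" using par by blast
      have m: "mate n r k = Suc k" by (rule mate_next[OF ev]) (use bottom in linarith)
      show ?thesis
      proof (cases "z = 1")
        case True
        then have "mate n r k = 3 * n + 1 - 1" using m bottom n1 by simp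
        then show ?thesis using vertex_ok_corners(4)[OF n1] inn_left[of 1 n] False True xy n1 by simp
      next
        case z: False
        then have "mate n r k = 3 * n - (z - 1)" using m bottom by simp
        moreover have "even (z - 1 + r)" using False z bottom by (cases z) auto
        ultimately show ?thesis using vertex_ok_bottom(2)[of "z - 1"] inn_bottom[of "z - 1" n] z bottom e xy by simp
      qed
    qed
  next
    case (left z)
    have xy: "x = 1" "y = z" using i inn_left[of z n] left by simp_all
    have e: "hz 0 z \<in> F" using ek ext_edge_left[of z n] left by simp
    have par: "even (k + 1 + n + r) \<longleftrightarrow> even (z + r)" using left by (cases z) auto
    show ?thesis
    proof (cases "even (z + r)")
      case True
      then have ev: "even (k + 1 + n + r)" using par by blast
      show ?thesis
      proof (cases "z < n")
        case True
        then have "mate n r k = 3 * n + Suc z - 1" using mate_next[OF ev] left by simp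
        then show ?thesis using vertex_ok_left(1)[of z] inn_left[of "Suc z" n] True \<open>even (z + r)\<close> left e xy by simp
      next
        case False
        then have z: "z = n" using left by simp
        then have "Suc k = 4 * n" using left by simp
        then have "mate n r k = 1 - 1" using ev by (simp add: mate_def)
        then show ?thesis using vertex_ok_corners(1)[OF n1] inn_top[of 1 n] \<open>even (z + r)\<close> z xy n1 by simp
      qed
    next
      case False
      then have od: "odd (k + 1 + n + r)" using par by blast
      have m: "mate n r k = k - 1" by (rule mate_prev[OF od _ k4]) (use left n1 in linarith)
      show ?thesis
      proof (cases "z = 1")
        case True
        then have "mate n r k = 3 * n - 1" using m left by simp
        then show ?thesis using vertex_ok_corners(4)[OF n1] inn_bottom[of 1 n] False True xy n1 by simp
      next
        case z: False
        then have "mate n r k = 3 * n + (z - 1) - 1" using m left by simp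
        moreover have "even (z - 1 + r)" using False z left by (cases z) auto
        ultimately show ?thesis using vertex_ok_left(2)[of "z - 1"] inn_left[of "z - 1" n] z left e xy by simp
      qed
    qed
  qed
qed

end

text \<open>
Take for \<open>f\<close> the component, after gyration, of the mate of \<open>k\<close>: the invariant travels along the path
of \<open>F\<close> from \<open>k\<close> to \<open>l\<close>.
\<close>
theorem gyration_conn:
  assumes F: "F \<in> FPL n Occ" and O: "Occ \<subseteq> {..<4 * n}"
    and al: "\<And>k. k < 4 * n \<Longrightarrow> k \<in> Occ \<longleftrightarrow> Suc k mod (4 * n) \<notin> Occ"
    and kl: "k \<in> Occ" "l \<in> Occ" and c: "conn F (inn n k) (inn n l)"
  shows "conn (gyration n r F) (inn n (mate n r k)) (inn n (mate n r l))"
proof -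
  define f where "f = conn (gyration n r F) (inn n (mate n r k))"
  have cl: "f u = f v" if "{u, v} \<in> gyration n r F" for u v
    using conn_edge[OF that] conn_sym[OF conn_edge[OF that]] unfolding f_def by (meson rtranclp_trans)
  obtain x y x' y' where xy: "inn n k = (x, y)" "inn n l = (x', y')" by (metis surj_pair)
  have v: "inn n k \<in> verts n" "inn n l \<in> verts n" using kl O by auto
  have "f (inn n (mate n r k))" by (simp add: f_def)
  then have "vertex_ok n r F f x y" using vertex_ok_mate[where f = f, OF F O al cl kl(1) xy(1)] by simp
  then have "vertex_ok n r F f x' y'"
    using vertex_ok_conn[where f = f, OF F O al cl c xy(1) v(1) _ xy(2) v(2)] by simp
  then have "f (inn n (mate n r l))" using vertex_ok_mate[where f = f, OF F O al cl kl(2) xy(2)] by simp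
  then show ?thesis by (simp add: f_def)
qed

definition turn :: "nat \<Rightarrow> nat \<Rightarrow> nat" where "turn n k = Suc k mod (4 * n)"

lemma turn_lt: "1 \<le> n \<Longrightarrow> turn n k < 4 * n" by (simp add: turn_def)

lemma turn_inj: "inj_on (turn n) {..<4 * n}"
proof (rule inj_onI)
  fix k l assume "k \<in> {..<4 * n}" "l \<in> {..<4 * n}" "turn n k = turn n l"
  then show "k = l" by (auto simp: turn_def mod_Suc split: if_splits)
qed

lemma turn_pred:
  assumes "k < 4 * n" shows "turn n ((k + 4 * n - 1) mod (4 * n)) = k"
proof -
  have "Suc ((k + 4 * n - 1) mod (4 * n)) mod (4 * n) = Suc (k + 4 * n - 1) mod (4 * n)" by (rule mod_Suc_eq)
  also have "Suc (k + 4 * n - 1) = k + 4 * n" using assms by simp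
  finally show ?thesis using assms by (simp add: turn_def)
qed

lemma pred_turn:
  assumes "k < 4 * n" shows "(turn n k + 4 * n - 1) mod (4 * n) = k"
proof (cases "Suc k = 4 * n")
  case True
  then have "turn n k + 4 * n - 1 = k" by (simp add: turn_def)
  then show ?thesis using assms by simp
next
  case False
  then have "turn n k = Suc k" using assms by (simp add: turn_def)
  then have "turn n k + 4 * n - 1 = k + 4 * n" by simp
  then have "(turn n k + 4 * n - 1) mod (4 * n) = (k + 4 * n) mod (4 * n)" by (simp only:)
  also have "\<dots> = k mod (4 * n)" by (rule mod_add_self2)
  also have "\<dots> = k" using assms by (rule mod_less)
  finally show ?thesis .
qed

text \<open>
For \<open>r\<close> of this parity the mate of an occupied external edge is the next one clockwise. The converse
inclusion follows since gyration is an involution and takes the mate back.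
\<close>
lemma link_pattern_gyration:
  assumes F: "F \<in> FPL n Occ" and O: "Occ \<subseteq> {..<4 * n}"
    and al: "\<And>k. k < 4 * n \<Longrightarrow> k \<in> Occ \<longleftrightarrow> turn n k \<notin> Occ"
    and r: "\<And>k. k \<in> Occ \<Longrightarrow> even (k + 1 + n + r)" "\<And>k. k < 4 * n \<Longrightarrow> k \<notin> Occ \<Longrightarrow> odd (k + 1 + n + r)"
  shows "link_pattern n (gyration n r F) = image (turn n) ` link_pattern n F"
proof -
  let ?O = "{..<4 * n} - Occ"
  have O': "?O \<subseteq> {..<4 * n}" by blast
  have G: "gyration n r F \<in> FPL n ?O" by (rule gyration_FPL[OF F O])
  have GG: "gyration n r (gyration n r F) = F" by (rule gyration_gyration[OF FPL_D(1)[OF F]])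
  have al1: "k \<in> Occ \<longleftrightarrow> Suc k mod (4 * n) \<notin> Occ" if "k < 4 * n" for k using al[OF that] by (simp add: turn_def)
  have al2: "k \<in> ?O \<longleftrightarrow> Suc k mod (4 * n) \<notin> ?O" if "k < 4 * n" for k
    using al1[OF that] that by auto
  have m1: "mate n r k = turn n k" if "k \<in> Occ" for k using r(1)[OF that] by (simp add: mate_def turn_def)
  have m2: "mate n r (turn n k) = k" if "k \<in> Occ" for k
  proof -
    have k: "k < 4 * n" using that O by auto
    then have "turn n k < 4 * n" "turn n k \<notin> Occ" using turn_lt[of n k] al[OF k] that by auto
    then have "odd (turn n k + 1 + n + r)" using r(2) by blast
    then show ?thesis using pred_turn[OF k] by (simp add: mate_def)
  qed
  have shift: "linked n (gyration n r F) (turn n k) (turn n l) \<longleftrightarrow> linked n F k l" if "k \<in> Occ" "l \<in> Occ" for k l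
  proof -
    have k: "k < 4 * n" "l < 4 * n" using that O by auto
    have tk: "turn n k < 4 * n" "turn n l < 4 * n" using turn_lt[of n] k by auto
    have to: "turn n k \<in> ?O" "turn n l \<in> ?O" using al[OF k(1)] al[OF k(2)] that tk by auto
    have ne: "turn n k = turn n l \<longleftrightarrow> k = l" using turn_inj k unfolding inj_on_def by auto
    have "conn (gyration n r F) (inn n (turn n k)) (inn n (turn n l)) \<longleftrightarrow> conn F (inn n k) (inn n l)"
    proof
      assume "conn F (inn n k) (inn n l)"
      then show "conn (gyration n r F) (inn n (turn n k)) (inn n (turn n l))"
        using gyration_conn[OF F O al1 that, of r] m1 that by simp
    next
      assume "conn (gyration n r F) (inn n (turn n k)) (inn n (turn n l))"
      then show "conn F (inn n k) (inn n l)"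
        using gyration_conn[OF G O' al2 to, of r] m2 that GG by simp
    qed
    then show ?thesis using linked_iff[OF F O k] linked_iff[OF G O' tk] that to ne by blast
  qed
  show ?thesis
  proof (intro equalityI subsetI)
    fix e assume "e \<in> link_pattern n (gyration n r F)"
    then obtain k l where kl: "e = {k, l}" "k < 4 * n" "l < 4 * n" "linked n (gyration n r F) k l"
      unfolding link_pattern_def by blast
    then have o: "k \<in> ?O" "l \<in> ?O" using linked_iff[OF G O' kl(2,3)] by blast+
    define k' where "k' = (k + 4 * n - 1) mod (4 * n)"
    define l' where "l' = (l + 4 * n - 1) mod (4 * n)"
    have t: "turn n k' = k" "turn n l' = l" using turn_pred kl by (simp_all add: k'_def l'_def)
    have lt: "k' < 4 * n" "l' < 4 * n" using kl by (simp_all add: k'_def l'_def)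
    have "k' \<in> Occ" "l' \<in> Occ" using al lt t o by auto
    then have "linked n F k' l'" using shift[of k' l'] t kl by simp
    then have "{k', l'} \<in> link_pattern n F" using lt unfolding link_pattern_def by blast
    moreover have "e = turn n ` {k', l'}" using t kl by simp
    ultimately show "e \<in> image (turn n) ` link_pattern n F" by blast
  next
    fix e assume "e \<in> image (turn n) ` link_pattern n F"
    then obtain k l where kl: "e = turn n ` {k, l}" "k < 4 * n" "l < 4 * n" "linked n F k l"
      unfolding link_pattern_def by blast
    then have o: "k \<in> Occ" "l \<in> Occ" using linked_iff[OF F O kl(2,3)] by blast+
    then have "linked n (gyration n r F) (turn n k) (turn n l)" using shift kl by simp
    moreover have "turn n k < 4 * n" "turn n l < 4 * n" using turn_lt[of n] kl by auto
    moreover have "e = {turn n k, turn n l}" using kl by simp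
    ultimately show "e \<in> link_pattern n (gyration n r F)" unfolding link_pattern_def by blast
  qed
qed

theorem gyration_bij:
  assumes O: "Occ \<subseteq> {..<4 * n}"
    and al: "\<And>k. k < 4 * n \<Longrightarrow> k \<in> Occ \<longleftrightarrow> turn n k \<notin> Occ"
    and r: "\<And>k. k \<in> Occ \<Longrightarrow> even (k + 1 + n + r)" "\<And>k. k < 4 * n \<Longrightarrow> k \<notin> Occ \<Longrightarrow> odd (k + 1 + n + r)"
    and M: "M \<subseteq> Pow {..<4 * n}"
  shows "bij_betw (gyration n r) {F \<in> FPL n Occ. link_pattern n F = M}
    {F \<in> FPL n ({..<4 * n} - Occ). link_pattern n F = image (turn n) ` M}"
proof (rule bij_betw_byWitness[where f' = "gyration n r"])
  let ?O = "{..<4 * n} - Occ"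
  have OO: "{..<4 * n} - ?O = Occ" using O by blast
  show "\<forall>F\<in>{F \<in> FPL n Occ. link_pattern n F = M}. gyration n r (gyration n r F) = F"
  proof
    fix F assume "F \<in> {F \<in> FPL n Occ. link_pattern n F = M}"
    then have "F \<in> FPL n (Occ)" by simp
    from gyration_gyration[OF FPL_D(1)[OF this]] show "gyration n r (gyration n r F) = F" .
  qed
  show "\<forall>F\<in>{F \<in> FPL n ?O. link_pattern n F = image (turn n) ` M}. gyration n r (gyration n r F) = F"
  proof
    fix F assume "F \<in> {F \<in> FPL n ?O. link_pattern n F = image (turn n) ` M}"
    then have "F \<in> FPL n (?O)" by simp
    from gyration_gyration[OF FPL_D(1)[OF this]] show "gyration n r (gyration n r F) = F" .
  qed
  show "gyration n r ` {F \<in> FPL n Occ. link_pattern n F = M} \<subseteq> {F \<in> FPL n ?O. link_pattern n F = image (turn n) ` M}"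
  proof
    fix H assume "H \<in> gyration n r ` {F \<in> FPL n Occ. link_pattern n F = M}"
    then obtain F where F: "F \<in> FPL n Occ" "link_pattern n F = M" "H = gyration n r F" by blast
    have "link_pattern n H = image (turn n) ` M" using link_pattern_gyration[OF F(1) O al r] F(2,3) by simp
    then show "H \<in> {F \<in> FPL n ?O. link_pattern n F = image (turn n) ` M}"
      using gyration_FPL[OF F(1) O, of r] F(3) by simp
  qed
  show "gyration n r ` {F \<in> FPL n ?O. link_pattern n F = image (turn n) ` M} \<subseteq> {F \<in> FPL n Occ. link_pattern n F = M}"
  proof
    fix H assume "H \<in> gyration n r ` {F \<in> FPL n ?O. link_pattern n F = image (turn n) ` M}"
    then obtain F where F: "F \<in> FPL n ?O" "link_pattern n F = image (turn n) ` M" "H = gyration n r F" by blast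
    have H: "H \<in> FPL n Occ" using gyration_FPL[OF F(1), of r] F(3) OO by auto
    have "gyration n r H = F" using gyration_gyration[OF FPL_D(1)[OF F(1)]] F(3) by simp
    then have "image (turn n) ` link_pattern n H = image (turn n) ` M"
      using link_pattern_gyration[OF H O al r] F(2) by simp
    moreover have "inj_on (image (turn n)) (Pow {..<4 * n})" by (rule inj_on_image_Pow[OF turn_inj])
    moreover have "link_pattern n H \<subseteq> Pow {..<4 * n}" unfolding link_pattern_def by blast
    ultimately have "link_pattern n H = M" by (simp add: inj_on_image_eq_iff[OF _ _ M])
    then show "H \<in> {F \<in> FPL n Occ. link_pattern n F = M}" using H by blast
  qed
qed

section \<open>Symmetries of plane partitions\<close>

lemma box_pattern_bij:
  assumes "0 < a" "0 < c" "c \<le> b" "n = a + b + c"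
  shows "\<exists>f. bij_betw f {F \<in> FPL n {k. k < 4 * n \<and> odd (k + b + c)}. link_pattern n F =
    arches n (4 * n + c - b) a \<union> arches n (n + a) b \<union> arches n (3 * n - a) c} (plane_partitions a b c)"
proof -
  interpret box a b c n by unfold_locales (use assms in auto)
  show ?thesis using pattern_bij unfolding pattern_def occ_def .
qed

definition equinum :: "'a set \<Rightarrow> 'b set \<Rightarrow> bool" where
  "equinum A B \<longleftrightarrow> (\<exists>f. bij_betw f A B)"

lemma equinum_trans: "equinum A B \<Longrightarrow> equinum B C \<Longrightarrow> equinum A C"
  unfolding equinum_def by (meson bij_betw_trans)

lemma transpose_in:
  "\<pi> \<in> plane_partitions a b c \<Longrightarrow> (\<lambda>i j. \<pi> j i) \<in> plane_partitions b a c"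
  unfolding plane_partitions_def by auto

lemma plane_partitions_transpose: "equinum (plane_partitions a b c) (plane_partitions b a c)"
  unfolding equinum_def
proof
  show "bij_betw (\<lambda>\<pi> i j. \<pi> j i) (plane_partitions a b c) (plane_partitions b a c)"
    by (rule bij_betw_byWitness[where f' = "\<lambda>\<pi> i j. \<pi> j i"]) (use transpose_in in auto)
qed

text \<open>
Conjugation of the rows, which exchanges the last two sides of the box.
\<close>
definition conjugate :: "nat \<Rightarrow> nat \<Rightarrow> nat \<Rightarrow> (nat \<Rightarrow> nat \<Rightarrow> nat) \<Rightarrow> nat \<Rightarrow> nat \<Rightarrow> nat" where
  "conjugate a b c \<pi> i l = (if i \<in> {1..a} \<and> l \<in> {1..c} then card {j \<in> {1..b}. l \<le> \<pi> i j} else 0)"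

lemma conjugate_in:
  assumes p: "\<pi> \<in> plane_partitions a b c"
  shows "conjugate a b c \<pi> \<in> plane_partitions a c b"
proof -
  have 1: "card {j \<in> {1..b}. l \<le> \<pi> i j} \<le> b" for i l
  proof -
    have "card {j \<in> {1..b}. l \<le> \<pi> i j} \<le> card {1..b}" by (rule card_mono) auto
    then show ?thesis by simp
  qed
  have 2: "card {j \<in> {1..b}. l' \<le> \<pi> i j} \<le> card {j \<in> {1..b}. l \<le> \<pi> i j}" if "l \<le> l'" for i l l'
    by (rule card_mono) (use that in auto)
  have 3: "card {j \<in> {1..b}. l \<le> \<pi> i' j} \<le> card {j \<in> {1..b}. l \<le> \<pi> i j}"
    if "i \<in> {1..a}" "i' \<in> {1..a}" "i \<le> i'" for i i' l
  proof (rule card_mono)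
    have "\<pi> i' j \<le> \<pi> i j" if "j \<in> {1..b}" for j using p that \<open>i \<in> {1..a}\<close> \<open>i' \<in> {1..a}\<close> \<open>i \<le> i'\<close>
      unfolding plane_partitions_def by blast
    then show "{j \<in> {1..b}. l \<le> \<pi> i' j} \<subseteq> {j \<in> {1..b}. l \<le> \<pi> i j}" by fastforce
  qed simp
  show ?thesis unfolding plane_partitions_def mem_Collect_eq conjugate_def using 1 2 3 by auto
qed

lemma conjugate_conjugate:
  assumes p: "\<pi> \<in> plane_partitions a b c"
  shows "conjugate a c b (conjugate a b c \<pi>) = \<pi>"
proof (intro ext)
  fix i j
  show "conjugate a c b (conjugate a b c \<pi>) i j = \<pi> i j"
  proof (cases "i \<in> {1..a} \<and> j \<in> {1..b}")
    case False then show ?thesis using p by (auto simp: conjugate_def plane_partitions_def)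
  next
    case True
    then have c: "\<pi> i j \<le> c" using p by (auto simp: plane_partitions_def)
    have dec: "\<pi> i (Suc k) \<le> \<pi> i k" if "1 \<le> k" "Suc k \<le> b" for k
      using p True that unfolding plane_partitions_def by auto
    have key: "j \<le> card {j' \<in> {1..b}. l \<le> \<pi> i j'} \<longleftrightarrow> l \<le> \<pi> i j" for l
    proof (rule down_card)
      show "l \<le> \<pi> i k" if "1 \<le> k" "Suc k \<le> b" "l \<le> \<pi> i (Suc k)" for k
        using dec[OF that(1,2)] that(3) by simp
    qed (use True in simp_all)
    have "j \<le> conjugate a b c \<pi> i l \<longleftrightarrow> l \<le> \<pi> i j" if "l \<in> {1..c}" for l
      using True that key[of l] unfolding conjugate_def by presburger
    then have "{l \<in> {1..c}. j \<le> conjugate a b c \<pi> i l} = {l \<in> {1..c}. l \<le> \<pi> i j}" by blast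
    also have "\<dots> = {1..\<pi> i j}" using c by auto
    finally show ?thesis using True by (simp add: conjugate_def[of a c b])
  qed
qed

lemma plane_partitions_conjugate: "equinum (plane_partitions a b c) (plane_partitions a c b)"
  unfolding equinum_def
proof
  show "bij_betw (conjugate a b c) (plane_partitions a b c) (plane_partitions a c b)"
    by (rule bij_betw_byWitness[where f' = "conjugate a c b"]) (use conjugate_in conjugate_conjugate in auto)
qed

section \<open>Rotation to the normal position\<close>

lemma alternating_D:
  assumes "alternating n Occ"
  shows "Occ \<subseteq> {..<4 * n}" "k < 4 * n \<Longrightarrow> k \<in> Occ \<longleftrightarrow> turn n k \<notin> Occ"
  using assms unfolding alternating_def turn_def by blast+

lemma alternating_parity:
  assumes al: "alternating n Occ" and k: "k < 4 * n"
  shows "k \<in> Occ \<longleftrightarrow> (even k \<longleftrightarrow> 0 \<in> Occ)"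
  using k
proof (induction k)
  case (Suc k)
  then have "turn n k = Suc k" by (simp add: turn_def)
  moreover have "k \<in> Occ \<longleftrightarrow> turn n k \<notin> Occ" using alternating_D(2)[OF al, of k] Suc.prems by simp
  ultimately show ?case using Suc by (simp only: even_Suc Suc_lessD) blast
qed simp

lemma alternating_mod:
  assumes al: "alternating n Occ" and n: "1 \<le> n"
  shows "(X + t) mod (4 * n) \<in> Occ \<longleftrightarrow> (even t \<longleftrightarrow> X mod (4 * n) \<in> Occ)"
proof -
  have par: "even (m mod (4 * n)) \<longleftrightarrow> even m" for m :: nat by (simp add: dvd_mod_iff)
  have "m mod (4 * n) \<in> Occ \<longleftrightarrow> (even m \<longleftrightarrow> 0 \<in> Occ)" for m
    using alternating_parity[OF al, of "m mod (4 * n)"] n unfolding par by simp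
  then show ?thesis by (simp only: even_add) blast
qed

lemma turn_arches:
  assumes "s \<le> 2 * n"
  shows "image (turn n) ` arches n X s = arches n (Suc X) s"
proof -
  have e: "turn n ` {(X + 2 * j - 1) mod (4 * n), (X + 4 * n + 1 - 2 * j) mod (4 * n)} =
    {(Suc X + 2 * j - 1) mod (4 * n), (Suc X + 4 * n + 1 - 2 * j) mod (4 * n)}" if "j \<in> {1..s}" for j
  proof -
    have "Suc (X + 2 * j - 1) = Suc X + 2 * j - 1" "Suc (X + 4 * n + 1 - 2 * j) = Suc X + 4 * n + 1 - 2 * j"
      using that assms by auto
    then show ?thesis unfolding turn_def image_insert image_empty mod_Suc_eq by (simp only:)
  qed
  show ?thesis unfolding arches_def Setcompr_eq_image image_image Collect_mem_eq
    using e by (rule image_cong[OF refl])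
qed

lemma arches_mod: 
  assumes "s \<le> 2 * n" "X mod (4 * n) = Y mod (4 * n)"
  shows "arches n X s = arches n Y s"
proof -
  have e: "(X + 2 * j - 1) mod (4 * n) = (Y + 2 * j - 1) mod (4 * n) \<and>
    (X + 4 * n + 1 - 2 * j) mod (4 * n) = (Y + 4 * n + 1 - 2 * j) mod (4 * n)" if "j \<in> {1..s}" for j
  proof -
    have "X + 2 * j - 1 = X + (2 * j - 1)" "Y + 2 * j - 1 = Y + (2 * j - 1)"
      "X + 4 * n + 1 - 2 * j = X + (4 * n + 1 - 2 * j)" "Y + 4 * n + 1 - 2 * j = Y + (4 * n + 1 - 2 * j)"
      using that assms by auto
    then show ?thesis using assms(2) by (metis mod_add_left_eq)
  qed
  show ?thesis unfolding arches_def Setcompr_eq_image Collect_mem_eq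
    by (rule image_cong[OF refl]) (simp only: e)
qed

definition FPL3 :: "nat \<Rightarrow> nat set \<Rightarrow> nat \<Rightarrow> nat \<Rightarrow> nat \<Rightarrow> nat \<Rightarrow> nat \<Rightarrow> nat \<Rightarrow> point set set set" where
  "FPL3 n Occ A B C a b c = {F \<in> FPL n Occ. link_pattern n F = arches n A a \<union> arches n B b \<union> arches n C c}"

lemma FPL3_turn:
  assumes al: "alternating n Occ" and n: "1 \<le> n" and s: "a \<le> 2 * n" "b \<le> 2 * n" "c \<le> 2 * n"
  shows "alternating n ({..<4 * n} - Occ)"
    "equinum (FPL3 n Occ A B C a b c) (FPL3 n ({..<4 * n} - Occ) (Suc A) (Suc B) (Suc C) a b c)"
proof -
  note O = alternating_D[OF al]
  show "alternating n ({..<4 * n} - Occ)"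
    unfolding alternating_def turn_def[symmetric]
  proof (intro conjI allI impI)
    fix k assume k: "k < 4 * n"
    show "k \<in> {..<4 * n} - Occ \<longleftrightarrow> turn n k \<notin> {..<4 * n} - Occ"
      using O(2)[OF k] k turn_lt[OF n, of k] by blast
  qed blast
  \<comment> \<open>The parity for which the mate of each occupied external edge is the next one clockwise.\<close>
  define r where "r = (if 0 \<in> Occ then n + 1 else n)"
  have r: "k \<in> Occ \<longleftrightarrow> even (k + 1 + n + r)" if "k < 4 * n" for k
  proof -
    have "even (k + 1 + n + r) \<longleftrightarrow> (even k \<longleftrightarrow> 0 \<in> Occ)"
      by (cases "even k"; cases "even n"; simp add: r_def)
    then show ?thesis using alternating_parity[OF al that] by simp
  qed
  define M where "M = arches n A a \<union> arches n B b \<union> arches n C c"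
  have "M \<subseteq> Pow {..<4 * n}" using n unfolding M_def arches_def by auto
  then have "bij_betw (gyration n r) {F \<in> FPL n Occ. link_pattern n F = M}
    {F \<in> FPL n ({..<4 * n} - Occ). link_pattern n F = image (turn n) ` M}"
    using r O(1) by (intro gyration_bij[OF O]) blast+
  moreover have "image (turn n) ` M = arches n (Suc A) a \<union> arches n (Suc B) b \<union> arches n (Suc C) c"
    unfolding M_def image_Un using turn_arches s by simp
  ultimately have "bij_betw (gyration n r) (FPL3 n Occ A B C a b c) (FPL3 n ({..<4 * n} - Occ) (Suc A) (Suc B) (Suc C) a b c)"
    unfolding FPL3_def M_def by (simp only:)
  then show "equinum (FPL3 n Occ A B C a b c) (FPL3 n ({..<4 * n} - Occ) (Suc A) (Suc B) (Suc C) a b c)"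
    unfolding equinum_def by (intro exI[of _ "gyration n r"])
qed

lemma FPL3_rotate:
  assumes al: "alternating n Occ" and n: "1 \<le> n" and s: "a \<le> 2 * n" "b \<le> 2 * n" "c \<le> 2 * n"
  shows "\<exists>Occ'. alternating n Occ' \<and> (A mod (4 * n) \<in> Occ \<longleftrightarrow> (A + t) mod (4 * n) \<in> Occ') \<and>
    equinum (FPL3 n Occ A B C a b c) (FPL3 n Occ' (A + t) (B + t) (C + t) a b c)"
proof (induction t)
  case 0
  have "equinum (FPL3 n Occ A B C a b c) (FPL3 n Occ A B C a b c)" unfolding equinum_def using bij_betw_id by blast
  then show ?case using al by (intro exI[of _ Occ]) simp
next
  case (Suc t)
  then obtain Occ' where O': "alternating n Occ'" "A mod (4 * n) \<in> Occ \<longleftrightarrow> (A + t) mod (4 * n) \<in> Occ'"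
    "equinum (FPL3 n Occ A B C a b c) (FPL3 n Occ' (A + t) (B + t) (C + t) a b c)" by blast
  have lt: "(A + t) mod (4 * n) < 4 * n" using n by simp
  have "turn n ((A + t) mod (4 * n)) = (A + Suc t) mod (4 * n)" by (simp add: turn_def mod_Suc_eq)
  moreover have "(A + Suc t) mod (4 * n) < 4 * n" using n by simp
  ultimately have "(A + t) mod (4 * n) \<in> Occ' \<longleftrightarrow> (A + Suc t) mod (4 * n) \<in> {..<4 * n} - Occ'"
    using alternating_D(2)[OF O'(1) lt] by simp
  moreover note FPL3_turn(1)[OF O'(1) n s]
  moreover have "equinum (FPL3 n Occ A B C a b c) (FPL3 n ({..<4 * n} - Occ') (A + Suc t) (B + Suc t) (C + Suc t) a b c)"
    unfolding add_Suc_right by (rule equinum_trans[OF O'(3) FPL3_turn(2)[OF O'(1) n s]])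
  ultimately show ?case using O'(2) by blast
qed

text \<open>
The three numbers of arches determine the positions of \<open>B\<close> and \<open>C\<close> relative to \<open>A\<close>, so one rotation
brings all three centres to their normal positions, and the parity of the position of \<open>A\<close> then
determines the occupied external edges.
\<close>
lemma FPL3_normal:
  assumes al: "alternating n Occ" and pos: "0 < a" "0 < b" "0 < c" and n: "n = a + b + c" and cb: "c \<le> b"
    and A: "A < 4 * n" "A \<notin> Occ" and B: "B = (A + 2 * (a + b)) mod (4 * n)" and C: "C = (B + 2 * (b + c)) mod (4 * n)"
  shows "equinum (FPL3 n Occ A B C a b c) (plane_partitions a b c)"
proof -
  \<comment> \<open>Twice \<open>4 * n\<close> keeps the number of steps from being truncated; modulo \<open>4 * n\<close> one copy is redundant.\<close>
  define t where "t = 8 * n + c - b - A"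
  have n1: "1 \<le> n" and s: "a \<le> 2 * n" "b \<le> 2 * n" "c \<le> 2 * n" using n pos by auto
  obtain Occ' where O': "alternating n Occ'" "A mod (4 * n) \<in> Occ \<longleftrightarrow> (A + t) mod (4 * n) \<in> Occ'"
    "equinum (FPL3 n Occ A B C a b c) (FPL3 n Occ' (A + t) (B + t) (C + t) a b c)"
    using FPL3_rotate[OF al n1 s] by blast
  have At: "A + t = 4 * n + c - b + 4 * n" using A n by (simp add: t_def)
  have mA: "(A + t) mod (4 * n) = (4 * n + c - b) mod (4 * n)" unfolding At by (rule mod_add_self2)
  have mB: "(B + t) mod (4 * n) = (n + a) mod (4 * n)"
  proof -
    have "(B + t) mod (4 * n) = (A + 2 * (a + b) + t) mod (4 * n)" unfolding B by (rule mod_add_left_eq)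
    also have "A + 2 * (a + b) + t = n + a + 4 * n + 4 * n" using At n cb by simp
    also have "(n + a + 4 * n + 4 * n) mod (4 * n) = (n + a) mod (4 * n)" by (simp only: mod_add_self2)
    finally show ?thesis .
  qed
  have mC: "(C + t) mod (4 * n) = (3 * n - a) mod (4 * n)"
  proof -
    have "(C + t) mod (4 * n) = (B + 2 * (b + c) + t) mod (4 * n)" unfolding C by (rule mod_add_left_eq)
    also have "B + 2 * (b + c) + t = (B + t) + 2 * (b + c)" by simp
    also have "(B + t + 2 * (b + c)) mod (4 * n) = ((B + t) mod (4 * n) + 2 * (b + c)) mod (4 * n)"
      by (rule mod_add_left_eq[symmetric])
    also have "\<dots> = (n + a + 2 * (b + c)) mod (4 * n)" unfolding mB by (rule mod_add_left_eq)
    also have "n + a + 2 * (b + c) = 3 * n - a" using n by simp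
    finally show ?thesis .
  qed
  have par: "even (m mod (4 * n)) \<longleftrightarrow> even m" for m :: nat by (simp add: dvd_mod_iff)
  have "(A + t) mod (4 * n) \<notin> Occ'" using O'(2) A by simp
  moreover have "even ((A + t) mod (4 * n)) \<longleftrightarrow> even (b + c)"
  proof -
    have "A + t + b = 8 * n + c" using At n by simp
    then have "even (A + t + b) \<longleftrightarrow> even (8 * n + c)" by (simp only:)
    then show ?thesis unfolding par by auto
  qed
  moreover have lt: "(A + t) mod (4 * n) < 4 * n" using n1 by simp
  ultimately have z: "0 \<in> Occ' \<longleftrightarrow> odd (b + c)" using alternating_parity[OF O'(1) lt] by auto
  have "Occ' = {k. k < 4 * n \<and> odd (k + b + c)}"
    using alternating_parity[OF O'(1)] alternating_D(1)[OF O'(1)] z by auto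
  moreover have "arches n (A + t) a = arches n (4 * n + c - b) a" "arches n (B + t) b = arches n (n + a) b"
    "arches n (C + t) c = arches n (3 * n - a) c" using arches_mod s mA mB mC by blast+
  ultimately have "equinum (FPL3 n Occ' (A + t) (B + t) (C + t) a b c) (plane_partitions a b c)"
    unfolding equinum_def FPL3_def using box_pattern_bij[OF pos(1,3) cb n] by simp
  then show ?thesis using O'(3) equinum_trans by blast
qed

lemma FPL3_cycle: "FPL3 n Occ A B C a b c = FPL3 n Occ B C A b c a"
  unfolding FPL3_def by (simp add: Un_ac)

text \<open>
Among three numbers arranged in a circle, some one is at most its predecessor, so a cyclic
relabelling achieves the inequality required of the normal position.
\<close>
lemma FPL3_clockwise:
  assumes al: "alternating n Occ" and pos: "0 < a" "0 < b" "0 < c" and n: "n = a + b + c"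
    and lt: "A < 4 * n" "B < 4 * n" "C < 4 * n" and un: "A \<notin> Occ" "B \<notin> Occ" "C \<notin> Occ"
    and B: "B = (A + 2 * (a + b)) mod (4 * n)" and C: "C = (B + 2 * (b + c)) mod (4 * n)"
    and A: "A = (C + 2 * (c + a)) mod (4 * n)"
  shows "equinum (FPL3 n Occ A B C a b c) (plane_partitions a b c)"
proof -
  consider "c \<le> b" | "a \<le> c" | "b \<le> a" by linarith
  then show ?thesis
  proof cases
    case 1 then show ?thesis using FPL3_normal[OF al pos n _ lt(1) un(1) B C] by blast
  next
    case 2
    have "equinum (FPL3 n Occ B C A b c a) (plane_partitions b c a)"
      by (rule FPL3_normal[OF al pos(2,3,1) _ 2 lt(2) un(2) C A]) (use n in simp)
    then have "equinum (FPL3 n Occ A B C a b c) (plane_partitions b c a)" by (simp add: FPL3_cycle[of n Occ A])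
    then show ?thesis
      using equinum_trans plane_partitions_conjugate plane_partitions_transpose by meson
  next
    case 3
    have "equinum (FPL3 n Occ C A B c a b) (plane_partitions c a b)"
      by (rule FPL3_normal[OF al pos(3,1,2) _ 3 lt(3) un(3) A B]) (use n in simp)
    then have "equinum (FPL3 n Occ A B C a b c) (plane_partitions c a b)"
      using FPL3_cycle[of n Occ C A B c a b] by simp
    then show ?thesis
      using equinum_trans plane_partitions_conjugate plane_partitions_transpose by meson
  qed
qed

section \<open>Arches and arcs around the perimeter\<close>

lemma filter_odd_upt: "filter odd [1..<2 * m] = map (\<lambda>j. 2 * j + 1) [0..<m]"
proof (induction m)
  case (Suc m)
  show ?case
  proof (cases "m = 0")
    case False
    then have "[1..<2 * Suc m] = [1..<2 * m] @ [2 * m, Suc (2 * m)]" by simp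
    then show ?thesis using Suc by simp
  qed (simp add: numeral_2_eq_2)
qed simp

lemma nested_arches_eq:
  assumes al: "alternating n Occ" and n: "1 \<le> n" and A: "A < 4 * n" "A \<notin> Occ" and s: "s \<le> 2 * n"
  shows "nested_arches n Occ A s = arches n A s"
proof -
  have Am: "A mod (4 * n) = A" using A by simp
  have cw: "occ_cw n Occ A ! (j - 1) = (A + 2 * j - 1) mod (4 * n)" if j: "j \<in> {1..s}" for j
  proof -
    have jn: "j - 1 < 2 * n" using j s by auto
    have "occ_cw n Occ A = map (\<lambda>t. (A + t) mod (4 * n)) (filter (\<lambda>t. (A + t) mod (4 * n) \<in> Occ) [1..<4 * n])"
      unfolding occ_cw_def filter_map comp_def ..
    also have "filter (\<lambda>t. (A + t) mod (4 * n) \<in> Occ) [1..<4 * n] = filter odd [1..<2 * (2 * n)]"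
      using alternating_mod[OF al n, of A] A Am by (intro filter_cong) auto
    finally have "occ_cw n Occ A ! (j - 1) = (A + (2 * (j - 1) + 1)) mod (4 * n)"
      using jn unfolding filter_odd_upt by simp
    moreover have "A + (2 * (j - 1) + 1) = A + 2 * j - 1" using j by auto
    ultimately show ?thesis by simp
  qed
  have ccw: "occ_ccw n Occ A ! (j - 1) = (A + 4 * n + 1 - 2 * j) mod (4 * n)" if j: "j \<in> {1..s}" for j
  proof -
    have jn: "j - 1 < 2 * n" using j s by auto
    have "occ_ccw n Occ A = map (\<lambda>t. (A + (4 * n - t)) mod (4 * n)) (filter (\<lambda>t. (A + (4 * n - t)) mod (4 * n) \<in> Occ) [1..<4 * n])"
      unfolding occ_ccw_def filter_map comp_def ..
    also have "filter (\<lambda>t. (A + (4 * n - t)) mod (4 * n) \<in> Occ) [1..<4 * n] = filter odd [1..<2 * (2 * n)]"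
    proof (rule filter_cong)
      fix t assume "t \<in> set [1..<2 * (2 * n)]"
      then have "t \<le> 4 * n" by simp
      then have "even (4 * n - t) \<longleftrightarrow> even t" by simp
      then show "(A + (4 * n - t)) mod (4 * n) \<in> Occ \<longleftrightarrow> odd t"
        using alternating_mod[OF al n, of A "4 * n - t"] A(2) Am by simp
    qed simp
    finally have "occ_ccw n Occ A ! (j - 1) = (A + (4 * n - (2 * (j - 1) + 1))) mod (4 * n)"
      using jn unfolding filter_odd_upt by simp
    moreover have "A + (4 * n - (2 * (j - 1) + 1)) = A + 4 * n + 1 - 2 * j" using j s by auto
    ultimately show ?thesis by simp
  qed
  show ?thesis unfolding nested_arches_def arches_def Setcompr_eq_image Collect_mem_eq
    by (rule image_cong[OF refl]) (simp only: cw ccw)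
qed

text \<open>
Between two unoccupied positions the unoccupied external edges alternate with the occupied ones, so the
distance is twice the number of occupied ones.
\<close>
lemma cw_arc_card:
  assumes al: "alternating n Occ" and A: "A < 4 * n" "A \<notin> Occ" and B: "B < 4 * n" "B \<notin> Occ" and ne: "A \<noteq> B"
  shows "B = (A + 2 * card (cw_arc n A B \<inter> Occ)) mod (4 * n)"
proof -
  have n: "1 \<le> n" using A by simp
  define d where "d = (if A < B then B - A else B + 4 * n - A)"
  have d: "1 \<le> d" "d < 4 * n" using A B ne by (auto simp: d_def)
  have Bd: "B = (A + d) mod (4 * n)"
  proof (cases "A < B")
    case True then show ?thesis using B by (simp add: d_def)
  next
    case False
    then have "A + d = B + 4 * n" using A by (simp add: d_def)
    then have "(A + d) mod (4 * n) = (B + 4 * n) mod (4 * n)" by (simp only:)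
    then show ?thesis using B by simp
  qed
  have Am: "A mod (4 * n) = A" using A by simp
  have "even d" using alternating_mod[OF al n, of A d] Bd B A Am by auto
  then obtain m where m: "d = 2 * m" by (elim evenE)
  define g where "g = (\<lambda>j. (A + (2 * j + 1)) mod (4 * n))"
  have g1: "g j = (if A + (2 * j + 1) < 4 * n then A + (2 * j + 1) else A + (2 * j + 1) - 4 * n)" if "j < m" for j
    using that m d A unfolding g_def by (simp add: mod_if)
  have arc: "cw_arc n A B \<inter> Occ = g ` {..<m}"
  proof (intro equalityI subsetI)
    fix x assume x: "x \<in> cw_arc n A B \<inter> Occ"
    define t where "t = (if A < x then x - A else x + 4 * n - A)"
    have x4: "x < 4 * n" using x alternating_D(1)[OF al] by auto
    have t: "t < d" "x = (A + t) mod (4 * n)" 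
    proof -
      show "t < d" using x A B ne x4 by (auto simp: t_def d_def cw_arc_def split: if_splits)
      show "x = (A + t) mod (4 * n)"
      proof (cases "A < x")
        case True then show ?thesis using x4 by (simp add: t_def)
      next
        case False
        then have "A + t = x + 4 * n" using A by (simp add: t_def)
        then have "(A + t) mod (4 * n) = (x + 4 * n) mod (4 * n)" by (simp only:)
        then show ?thesis using x4 by simp
      qed
    qed
    have "odd t" using alternating_mod[OF al n, of A t] t x A Am by auto
    then obtain j where j: "t = 2 * j + 1" by (elim oddE)
    then have "j < m" using t m by simp
    moreover have "x = g j" using t j by (simp add: g_def)
    ultimately show "x \<in> g ` {..<m}" by blast
  next
    fix x assume "x \<in> g ` {..<m}"
    then obtain j where j: "j < m" "x = g j" by blast
    have "x \<in> Occ" using alternating_mod[OF al n, of A "2 * j + 1"] A Am j by (simp add: g_def)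
    moreover have "x \<in> cw_arc n A B" using g1[OF j(1)] j m d A B ne
      by (auto simp: cw_arc_def d_def split: if_splits)
    ultimately show "x \<in> cw_arc n A B \<inter> Occ" by blast
  qed
  have "inj_on g {..<m}"
  proof (rule inj_onI)
    fix i j assume "i \<in> {..<m}" "j \<in> {..<m}" "g i = g j"
    then show "i = j" using g1[of i] g1[of j] m d A by (auto split: if_splits)
  qed
  then have "card (cw_arc n A B \<inter> Occ) = m" unfolding arc by (simp add: card_image)
  then show ?thesis using Bd m by simp
qed

lemma cw_arc_cyclic:
  assumes "A < 4 * n" "B < 4 * n" "C < 4 * n" "A \<noteq> B" "B \<noteq> C" "C \<noteq> A"
  shows "C \<in> cw_arc n A B \<longleftrightarrow> A \<in> cw_arc n B C" "C \<in> cw_arc n A B \<longleftrightarrow> B \<in> cw_arc n C A"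
  using assms unfolding cw_arc_def by (auto split: if_splits)

theorem mainTheorem1:
  fixes a b c n A B C :: nat and Occ :: "nat set"
  assumes "a > 0" and "b > 0" and "c > 0"
    and "n = a + b + c"
    and "alternating n Occ"
    and "A < 4 * n" and "B < 4 * n" and "C < 4 * n"
    and "A \<noteq> B" and "B \<noteq> C" and "C \<noteq> A"
    and "A \<notin> Occ" and "B \<notin> Occ" and "C \<notin> Occ"
    and "card (arc_avoiding n A B C \<inter> Occ) = a + b"
    and "card (arc_avoiding n B C A \<inter> Occ) = b + c"
    and "card (arc_avoiding n C A B \<inter> Occ) = c + a"
  shows "\<exists>f. bij_betw f (FPL_of_type n Occ A B C a b c) (plane_partitions a b c)"
proof -
  note pos = assms(1-3) and n = assms(4) and al = assms(5) and lt = assms(6-8) and ne = assms(9-11) and un = assms(12-14)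
    and cards = assms(15-17)
  have n1: "1 \<le> n" and s: "a \<le> 2 * n" "b \<le> 2 * n" "c \<le> 2 * n" using n pos by auto
  have type: "FPL_of_type n Occ A B C a b c = FPL3 n Occ A B C a b c"
    unfolding FPL_of_type_def FPL3_def
    using nested_arches_eq[OF al n1 lt(1) un(1) s(1)] nested_arches_eq[OF al n1 lt(2) un(2) s(2)]
      nested_arches_eq[OF al n1 lt(3) un(3) s(3)] by simp
  note cyc = cw_arc_cyclic[OF lt ne]
  have "equinum (FPL3 n Occ A B C a b c) (plane_partitions a b c)"
  \<comment> \<open>The second case is the first one for the orientation \<open>A\<close>, \<open>C\<close>, \<open>B\<close>.\<close>
  proof (cases "C \<in> cw_arc n A B")
    case False
    then have "card (cw_arc n A B \<inter> Occ) = a + b" "card (cw_arc n B C \<inter> Occ) = b + c" "card (cw_arc n C A \<inter> Occ) = c + a"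
      using cards cyc unfolding arc_avoiding_def by auto
    then have "B = (A + 2 * (a + b)) mod (4 * n)" "C = (B + 2 * (b + c)) mod (4 * n)" "A = (C + 2 * (c + a)) mod (4 * n)"
      using cw_arc_card[OF al lt(1) un(1) lt(2) un(2) ne(1)] cw_arc_card[OF al lt(2) un(2) lt(3) un(3) ne(2)]
        cw_arc_card[OF al lt(3) un(3) lt(1) un(1) ne(3)] by simp_all
    then show ?thesis by (rule FPL3_clockwise[OF al pos n lt un])
  next
    case True
    then have counts: "card (cw_arc n B A \<inter> Occ) = b + a" "card (cw_arc n C B \<inter> Occ) = c + b" "card (cw_arc n A C \<inter> Occ) = a + c"
      using cards cyc unfolding arc_avoiding_def by auto
    have n': "n = a + c + b" using n by simp
    from counts have "C = (A + 2 * (a + c)) mod (4 * n)" "B = (C + 2 * (c + b)) mod (4 * n)" "A = (B + 2 * (b + a)) mod (4 * n)"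
      using cw_arc_card[OF al lt(2) un(2) lt(1) un(1) ne(1)[symmetric]] cw_arc_card[OF al lt(3) un(3) lt(2) un(2) ne(2)[symmetric]]
        cw_arc_card[OF al lt(1) un(1) lt(3) un(3) ne(3)[symmetric]] by simp_all
    then have "equinum (FPL3 n Occ A C B a c b) (plane_partitions a c b)"
      by (rule FPL3_clockwise[OF al pos(1,3,2) n' lt(1,3,2) un(1,3,2)])
    moreover have "FPL3 n Occ A C B a c b = FPL3 n Occ A B C a b c" unfolding FPL3_def by (simp add: Un_ac)
    ultimately show ?thesis using equinum_trans plane_partitions_conjugate by metis
  qed
  then show ?thesis unfolding type equinum_def .
qed

end
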